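(* Let $k$ be an algebraically closed field of characteristic zero. Let $Y$ be the hypersurface in $\mathbb{A}^{d+1}_k$ defined by $y_1\cdots y_{d+1}=0$, and let $\mathfrak{q}\in Y$ be a point that, among the irreducible components $\{y_j=0\}$ of $Y$, lies precisely on those given by $y_1=0,\ldots,y_e=0$. Then $$\operatorname{HP}_{J_\infty^{\mathfrak{q}}(Y)}(t)=\left(\prod_{i=1}^{e-1}\frac{1}{1-t^i}\right)^{d+1}\left(\prod_{i\geq e}\frac{1}{1-t^i}\right)^{d}.$$
   Context: For $X=\operatorname{Spec} k[x_1,\ldots,x_n]/(g_1,\ldots,g_r)$, $1\leq l\leq r$ and $j\in\mathbb{N}=\{0,1,2,\ldots\}$ let $G_l^{(j)}\in k[x_s^{(i)};1\leq s\leq n,i\in\mathbb{N}]$ be the coefficient of $t^j$ in $g_l\bigl(\sum_{i\geq 0}x_1^{(i)}t^i,\ldots,\sum_{i\geq 0}x_n^{(i)}t^i\bigr)$. The arc algebra is $J_\infty(X)=k[x_s^{(i)};1\leq s\leq n,i\in\mathbb{N}]/(G_l^{(j)};1\leq l\leq r,j\in\mathbb{N})$. It is graded by giving $x_s^{(i)}$ weight $i$ (each $G_l^{(j)}$ is homogeneous of weight $j$). Let $J_0(X)=\Gamma(X,\mathcal{O}_X)$, which maps to $J_\infty(X)$ by $x_s\mapsto x_s^{(0)}$. For a point $\mathfrak{p}\in X$ (a scheme-theoretic point) with residue field $\kappa(\mathfrak{p})$, the focussed arc algebra of $X$ at $\mathfrak{p}$ is $J_\infty^{\mathfrak{p}}(X)=J_\infty(X)\otimes_{J_0(X)}\kappa(\mathfrak{p})$,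 a graded $\kappa(\mathfrak{p})$-algebra, and $\operatorname{HP}_{J_\infty^{\mathfrak{p}}(X)}(t)=\sum_{j\geq 0}\dim_{\kappa(\mathfrak{p})}\bigl(J_\infty^{\mathfrak{p}}(X)\bigr)_j\,t^j$. *)

theory Defs
  imports
    "HOL-Library.Poly_Mapping"
    "HOL-Computational_Algebra.Computational_Algebra"
    "HOL-Analysis.Infinite_Products"
    "HOL-Algebra.QuotRing"
    "HOL-Algebra.Embedded_Algebras"
begin

text \<open>Multivariate polynomials, as finitely supported functions from monomials (exponent vectors)
  to coefficients; the ring operations are those of \<^theory>\<open>HOL-Library.Poly_Mapping\<close>.\<close>

type_synonym ('v, 'k) mpol = "('v \<Rightarrow>\<^sub>0 nat) \<Rightarrow>\<^sub>0 'k"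

definition mconst :: "'k::comm_ring_1 \<Rightarrow> ('v, 'k) mpol" where
  "mconst c = Poly_Mapping.single 0 c"

definition mvar :: "'v \<Rightarrow> ('v, 'k::comm_ring_1) mpol" where
  "mvar v = Poly_Mapping.single (Poly_Mapping.single v 1) 1"

definition mpol_ring :: "'v set \<Rightarrow> ('v, 'k::comm_ring_1) mpol ring" where
  "mpol_ring V = \<lparr>carrier = {f. \<forall>m\<in>Poly_Mapping.keys f. Poly_Mapping.keys m \<subseteq> V},
     monoid.mult = (*), one = 1, zero = 0, add = (+)\<rparr>"

text \<open>Evaluation at the point \<open>a\<close>, where the coefficients are mapped by \<open>h\<close>.\<close>

definition meval :: "('k::comm_ring_1 \<Rightarrow> 'b::comm_ring_1) \<Rightarrow> ('v \<Rightarrow> 'b) \<Rightarrow> ('v, 'k) mpol \<Rightarrow> 'b" where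
  "meval h a f = (\<Sum>m\<in>Poly_Mapping.keys f. h (Poly_Mapping.lookup f m) *
     (\<Prod>v\<in>Poly_Mapping.keys m. a v ^ Poly_Mapping.lookup m v))"


text \<open>Affine schemes: a point is a prime ideal.\<close>

definition spec :: "('a, 'm) ring_scheme \<Rightarrow> 'a set set" where
  "spec A = {\<pp>. primeideal \<pp> A}"

definition zero_locus :: "('a, 'm) ring_scheme \<Rightarrow> 'a \<Rightarrow> 'a set set" where
  "zero_locus A a = {\<pp> \<in> spec A. a \<in> \<pp>}"


text \<open>The field of fractions of a domain: \<open>fraction R a b\<close> is the class of \<open>a / b\<close>. The unions
  below run over all representatives; they are all the same class since the operations are
  well defined.\<close>

definition fraction :: "('a, 'm) ring_scheme \<Rightarrow> 'a \<Rightarrow> 'a \<Rightarrow> ('a \<times> 'a) set" where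
  "fraction R a b = {(c, d). c \<in> carrier R \<and> d \<in> carrier R - {\<zero>\<^bsub>R\<^esub>} \<and> a \<otimes>\<^bsub>R\<^esub> d = c \<otimes>\<^bsub>R\<^esub> b}"

definition fraction_field :: "('a, 'm) ring_scheme \<Rightarrow> ('a \<times> 'a) set ring" where
  "fraction_field R =
    \<lparr>carrier = {fraction R a b | a b. a \<in> carrier R \<and> b \<in> carrier R - {\<zero>\<^bsub>R\<^esub>}},
     monoid.mult = (\<lambda>X Y. \<Union>(a, b)\<in>X. \<Union>(c, d)\<in>Y. fraction R (a \<otimes>\<^bsub>R\<^esub> c) (b \<otimes>\<^bsub>R\<^esub> d)),
     one = fraction R \<one>\<^bsub>R\<^esub> \<one>\<^bsub>R\<^esub>,
     zero = fraction R \<zero>\<^bsub>R\<^esub> \<one>\<^bsub>R\<^esub>,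
     add = (\<lambda>X Y. \<Union>(a, b)\<in>X. \<Union>(c, d)\<in>Y.
       fraction R (a \<otimes>\<^bsub>R\<^esub> d \<oplus>\<^bsub>R\<^esub> c \<otimes>\<^bsub>R\<^esub> b) (b \<otimes>\<^bsub>R\<^esub> d))\<rparr>"

definition residue_field :: "('a, 'm) ring_scheme \<Rightarrow> 'a set \<Rightarrow> ('a set \<times> 'a set) set ring" where
  "residue_field A \<pp> = fraction_field (A Quot \<pp>)"

definition to_residue_field :: "('a, 'm) ring_scheme \<Rightarrow> 'a set \<Rightarrow> 'a \<Rightarrow> ('a set \<times> 'a set) set" where
  "to_residue_field A \<pp> a = fraction (A Quot \<pp>) (\<pp> +>\<^bsub>A\<^esub> a) \<one>\<^bsub>A Quot \<pp>\<^esub>"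


text \<open>The tensor product \<open>B \<otimes>\<^sub>A C\<close> of commutative \<open>A\<close>-algebras with structure maps \<open>f\<close> and \<open>g\<close>: the
  free abelian group on \<open>B \<times> C\<close>, with \<open>(b, c) (b', c') = (b b', c c')\<close> extended bilinearly, modulo
  the usual relations. The subgroup generated by these relations is stable under multiplication
  by generators, so it agrees with the ideal they generate.\<close>

definition pair_ring :: "('b, 'm) ring_scheme \<Rightarrow> ('c, 'n) ring_scheme \<Rightarrow> ('b \<times> 'c \<Rightarrow>\<^sub>0 int) ring" where
  "pair_ring B C =
    \<lparr>carrier = {u. Poly_Mapping.keys u \<subseteq> carrier B \<times> carrier C},
     monoid.mult = (\<lambda>u v. frag_extend (\<lambda>(b, c). frag_extend (\<lambda>(b', c').
       frag_of (b \<otimes>\<^bsub>B\<^esub> b', c \<otimes>\<^bsub>C\<^esub> c')) v) u),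
     one = frag_of (\<one>\<^bsub>B\<^esub>, \<one>\<^bsub>C\<^esub>),
     zero = 0,
     add = (+)\<rparr>"

definition tensor_relations ::
  "('a, 'l) ring_scheme \<Rightarrow> ('b, 'm) ring_scheme \<Rightarrow> ('c, 'n) ring_scheme \<Rightarrow>
   ('a \<Rightarrow> 'b) \<Rightarrow> ('a \<Rightarrow> 'c) \<Rightarrow> ('b \<times> 'c \<Rightarrow>\<^sub>0 int) set" where
  "tensor_relations A B C f g =
     {frag_of (b \<oplus>\<^bsub>B\<^esub> b', c) - frag_of (b, c) - frag_of (b', c) | b b' c.
        b \<in> carrier B \<and> b' \<in> carrier B \<and> c \<in> carrier C} \<union>
     {frag_of (b, c \<oplus>\<^bsub>C\<^esub> c') - frag_of (b, c) - frag_of (b, c') | b c c'.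
        b \<in> carrier B \<and> c \<in> carrier C \<and> c' \<in> carrier C} \<union>
     {frag_of (f a \<otimes>\<^bsub>B\<^esub> b, c) - frag_of (b, g a \<otimes>\<^bsub>C\<^esub> c) | a b c.
        a \<in> carrier A \<and> b \<in> carrier B \<and> c \<in> carrier C}"

definition tensor_ideal ::
  "('a, 'l) ring_scheme \<Rightarrow> ('b, 'm) ring_scheme \<Rightarrow> ('c, 'n) ring_scheme \<Rightarrow>
   ('a \<Rightarrow> 'b) \<Rightarrow> ('a \<Rightarrow> 'c) \<Rightarrow> ('b \<times> 'c \<Rightarrow>\<^sub>0 int) set" where
  "tensor_ideal A B C f g = genideal (pair_ring B C) (tensor_relations A B C f g)"

definition tensor_algebra ::
  "('a, 'l) ring_scheme \<Rightarrow> ('b, 'm) ring_scheme \<Rightarrow> ('c, 'n) ring_scheme \<Rightarrow>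
   ('a \<Rightarrow> 'b) \<Rightarrow> ('a \<Rightarrow> 'c) \<Rightarrow> ('b \<times> 'c \<Rightarrow>\<^sub>0 int) set ring" where
  "tensor_algebra A B C f g = pair_ring B C Quot tensor_ideal A B C f g"

definition tensor ::
  "('a, 'l) ring_scheme \<Rightarrow> ('b, 'm) ring_scheme \<Rightarrow> ('c, 'n) ring_scheme \<Rightarrow>
   ('a \<Rightarrow> 'b) \<Rightarrow> ('a \<Rightarrow> 'c) \<Rightarrow> 'b \<Rightarrow> 'c \<Rightarrow> ('b \<times> 'c \<Rightarrow>\<^sub>0 int) set" where
  "tensor A B C f g b c = tensor_ideal A B C f g +>\<^bsub>pair_ring B C\<^esub> frag_of (b, c)"


text \<open>The affine scheme \<open>X = Spec k[x\<^sub>1, \<dots>, x\<^sub>n] / (g\<^sub>1, \<dots>, g\<^sub>r)\<close> is given by \<open>n\<close> and the list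
  \<open>gs = [g\<^sub>1, \<dots>, g\<^sub>r]\<close>. The variable \<open>x\<^sub>s\<close> is \<open>mvar s\<close> with \<open>s \<in> {1..n}\<close>, and \<open>x\<^sub>s\<^sup>(\<^sup>i\<^sup>)\<close> is
  \<open>mvar (s, i)\<close>.\<close>

definition J0_ideal :: "nat \<Rightarrow> (nat, 'k::comm_ring_1) mpol list \<Rightarrow> (nat, 'k) mpol set" where
  "J0_ideal n gs = genideal (mpol_ring {1..n}) (set gs)"

definition J0 :: "nat \<Rightarrow> (nat, 'k::comm_ring_1) mpol list \<Rightarrow> (nat, 'k) mpol set ring" where
  "J0 n gs = mpol_ring {1..n} Quot J0_ideal n gs"

definition J0_class :: "nat \<Rightarrow> (nat, 'k::comm_ring_1) mpol list \<Rightarrow> (nat, 'k) mpol \<Rightarrow> (nat, 'k) mpol set" where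
  "J0_class n gs f = J0_ideal n gs +>\<^bsub>mpol_ring {1..n}\<^esub> f"

definition generic_arc :: "nat \<Rightarrow> (nat \<times> nat, 'k::comm_ring_1) mpol fps" where
  "generic_arc s = Abs_fps (\<lambda>i. mvar (s, i))"

definition arc_coeff :: "(nat, 'k::comm_ring_1) mpol \<Rightarrow> nat \<Rightarrow> (nat \<times> nat, 'k) mpol" where
  "arc_coeff g j = fps_nth (meval (\<lambda>c. fps_const (mconst c)) generic_arc g) j"

abbreviation arc_vars :: "nat \<Rightarrow> (nat \<times> nat) set" where
  "arc_vars n \<equiv> {1..n} \<times> UNIV"

definition Jinf_ideal :: "nat \<Rightarrow> (nat, 'k::comm_ring_1) mpol list \<Rightarrow> (nat \<times> nat, 'k) mpol set" where
  "Jinf_ideal n gs = genideal (mpol_ring (arc_vars n)) {arc_coeff g j | g j. g \<in> set gs}"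

definition Jinf :: "nat \<Rightarrow> (nat, 'k::comm_ring_1) mpol list \<Rightarrow> (nat \<times> nat, 'k) mpol set ring" where
  "Jinf n gs = mpol_ring (arc_vars n) Quot Jinf_ideal n gs"

definition Jinf_class ::
  "nat \<Rightarrow> (nat, 'k::comm_ring_1) mpol list \<Rightarrow> (nat \<times> nat, 'k) mpol \<Rightarrow> (nat \<times> nat, 'k) mpol set" where
  "Jinf_class n gs f = Jinf_ideal n gs +>\<^bsub>mpol_ring (arc_vars n)\<^esub> f"

text \<open>The ring homomorphism induced by \<open>x\<^sub>s \<mapsto> x\<^sub>s\<^sup>(\<^sup>0\<^sup>)\<close>.\<close>

definition J0_to_Jinf ::
  "nat \<Rightarrow> (nat, 'k::comm_ring_1) mpol list \<Rightarrow> (nat, 'k) mpol set \<Rightarrow> (nat \<times> nat, 'k) mpol set" where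
  "J0_to_Jinf n gs a = the_elem ((\<lambda>f. Jinf_class n gs (meval mconst (\<lambda>s. mvar (s, 0)) f)) ` a)"

definition weight :: "(nat \<times> nat \<Rightarrow>\<^sub>0 nat) \<Rightarrow> nat" where
  "weight m = (\<Sum>v\<in>Poly_Mapping.keys m. Poly_Mapping.lookup m v * snd v)"

definition Jinf_graded ::
  "nat \<Rightarrow> (nat, 'k::comm_ring_1) mpol list \<Rightarrow> nat \<Rightarrow> (nat \<times> nat, 'k) mpol set set" where
  "Jinf_graded n gs j =
     Jinf_class n gs ` {f \<in> carrier (mpol_ring (arc_vars n)). \<forall>m\<in>Poly_Mapping.keys f. weight m = j}"


type_synonym 'k kappa = "((nat, 'k) mpol set set \<times> (nat, 'k) mpol set set) set"
type_synonym 'k focussed = "((nat \<times> nat, 'k) mpol set \<times> 'k kappa \<Rightarrow>\<^sub>0 int) set"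

definition focussed_arc_algebra ::
  "nat \<Rightarrow> (nat, 'k::comm_ring_1) mpol list \<Rightarrow> (nat, 'k) mpol set set \<Rightarrow> 'k focussed ring" where
  "focussed_arc_algebra n gs \<pp> =
     tensor_algebra (J0 n gs) (Jinf n gs) (residue_field (J0 n gs) \<pp>)
       (J0_to_Jinf n gs) (to_residue_field (J0 n gs) \<pp>)"

definition focussed_tensor ::
  "nat \<Rightarrow> (nat, 'k::comm_ring_1) mpol list \<Rightarrow> (nat, 'k) mpol set set \<Rightarrow>
   (nat \<times> nat, 'k) mpol set \<Rightarrow> 'k kappa \<Rightarrow> 'k focussed" where
  "focussed_tensor n gs \<pp> =
     tensor (J0 n gs) (Jinf n gs) (residue_field (J0 n gs) \<pp>)
       (J0_to_Jinf n gs) (to_residue_field (J0 n gs) \<pp>)"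

text \<open>The weight \<open>j\<close> part is the image of \<open>J\<^sub>\<infinity>(X)\<^sub>j \<otimes> \<kappa>(\<pp>)\<close>.\<close>

definition focussed_graded ::
  "nat \<Rightarrow> (nat, 'k::comm_ring_1) mpol list \<Rightarrow> (nat, 'k) mpol set set \<Rightarrow> nat \<Rightarrow> 'k focussed set" where
  "focussed_graded n gs \<pp> j =
     generate (add_monoid (focussed_arc_algebra n gs \<pp>))
       {focussed_tensor n gs \<pp> b c | b c.
          b \<in> Jinf_graded n gs j \<and> c \<in> carrier (residue_field (J0 n gs) \<pp>)}"

text \<open>Library dimensions are over a subfield of the ambient ring, so the scalars \<open>\<kappa>(\<pp>)\<close> are taken
  as \<open>{1 \<otimes> c}\<close>. The weight 0 part of \<open>J\<^sub>\<infinity>(X)\<close> is \<open>J\<^sub>0(X)\<close>, hence the weight 0 part of the focussed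
  arc algebra is \<open>\<kappa>(\<pp>)\<close> and \<open>c \<mapsto> 1 \<otimes> c\<close> is injective.\<close>

definition focussed_scalars ::
  "nat \<Rightarrow> (nat, 'k::comm_ring_1) mpol list \<Rightarrow> (nat, 'k) mpol set set \<Rightarrow> 'k focussed set" where
  "focussed_scalars n gs \<pp> =
     focussed_tensor n gs \<pp> \<one>\<^bsub>Jinf n gs\<^esub> ` carrier (residue_field (J0 n gs) \<pp>)"

definition focussed_HP ::
  "nat \<Rightarrow> (nat, 'k::comm_ring_1) mpol list \<Rightarrow> (nat, 'k) mpol set set \<Rightarrow> rat fps" where
  "focussed_HP n gs \<pp> = Abs_fps (\<lambda>j. of_nat
     (ring.dim (focussed_arc_algebra n gs \<pp>) (focussed_scalars n gs \<pp>) (focussed_graded n gs \<pp> j)))"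


definition coord_product :: "nat \<Rightarrow> (nat, 'k::comm_ring_1) mpol" where
  "coord_product n = (\<Prod>s\<in>{1..n}. mvar s)"

end

theory Submission
  imports Defs "HOL-Algebra.Free_Abelian_Groups"
begin

text \<open>Let \<open>c\<^sub>s\<close> be the image of \<open>y\<^sub>s\<close> in \<open>\<kappa>(\<qq>)\<close>, so \<open>c\<^sub>s = 0\<close> exactly for \<open>s \<le> e\<close>. The focussed arc algebra is
  \<open>\<kappa>(\<qq>)[y\<^sub>s\<^sup>(\<^sup>i\<^sup>); i > 0]\<close> modulo the coefficients \<open>G\<^sub>l\<close> of \<open>t\<^sup>l\<close> in \<open>\<Prod>\<^sub>s (c\<^sub>s + \<Sum>\<^sub>i y\<^sub>s\<^sup>(\<^sup>i\<^sup>) t\<^sup>i)\<close>. Rescaling the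
  variables with \<open>s > e\<close> turns every nonzero \<open>c\<^sub>s\<close> into \<open>1\<close>, so that the Hilbert series may be computed over \<open>k\<close>.

  For \<open>a\<^sub>s \<ge> 1\<close> let \<open>I(a, N)\<close> be generated by the \<open>y\<^sub>s\<^sup>(\<^sup>i\<^sup>)\<close> with \<open>i < a\<^sub>s\<close> and the \<open>G\<^sub>l\<close> with \<open>l < N\<close>, and put
  \<open>|a| = \<Sum>\<^bsub>s \<le> e\<^esub> a\<^sub>s\<close>. By induction on \<open>N - |a|\<close>, the Hilbert series of the quotient by \<open>I(a, N)\<close> is that of the
  quotient by \<open>I(a, 0)\<close> times \<open>\<Prod>\<^bsub>|a| \<le> l < N\<^esub> (1 - t\<^sup>l)\<close>, which says that the \<open>G\<^sub>l\<close> form a regular sequence: the lower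
  bound holds since \<open>I(a, N) = I(a, N - 1) + (G\<^bsub>N-1\<^esub>)\<close>; for the upper bound, \<open>G\<^bsub>|a|\<^esub>\<close> is congruent to the product of
  the \<open>u\<^sub>s = y\<^sub>s\<^sup>(\<^sup>a\<^sup>)\<close>, \<open>a = a\<^sub>s\<close>, \<open>s \<le> e\<close>, which allows to filter the quotient by these partial products, while adjoining
  \<open>u\<^sub>s\<close> to \<open>I(a, N)\<close> merely increases \<open>a\<^sub>s\<close> by one.\<close>

section \<open>Polynomials and evaluation\<close>

text \<open>The regularity of the G_l is never argued directly. Both bounds are coefficientwise
  inequalities of integer power series, and ideals mixing variables with coefficients G_l appear
  because that class is stable under both reductions.

  Polynomials over k form a type with algebraic structure, while \<kappa>(\<qq>) is a carrier set
  built from cosets and fractions. Hence there is no base change of polynomial rings: in each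
  weight, finite data are transported from k, namely monomials with the relations by which they span
  and with functionals dual to them. The relations need inverses of the coordinates not vanishing at
  \<qq>, so denominators are cleared and cancelled at the end. The functionals take polynomial
  values, which are evaluated at \<qq> last.

  A fixed weight j sees only finitely many G_l, so the series identities are proved for finite
  products modulo t^N with N > j, and the infinite product enters only by comparison. The series of
  the polynomial ring is not obtained by counting monomials: killing all variables of weight below N
  leaves 1 modulo t^N.\<close>

type_synonym 'k arc_poly = "(nat \<times> nat, 'k) mpol"

abbreviation mpols :: "'v set \<Rightarrow> ('v, 'k::comm_ring_1) mpol set" where "mpols V \<equiv> carrier (mpol_ring V)"
abbreviation single :: "'a \<Rightarrow> 'b \<Rightarrow> 'a \<Rightarrow>\<^sub>0 'b::zero" where "single \<equiv> Poly_Mapping.single"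
abbreviation keys :: "('a \<Rightarrow>\<^sub>0 'b::zero) \<Rightarrow> 'a set" where "keys \<equiv> Poly_Mapping.keys"
abbreviation lookup :: "('a \<Rightarrow>\<^sub>0 'b::zero) \<Rightarrow> 'a \<Rightarrow> 'b" where "lookup \<equiv> Poly_Mapping.lookup"

lemma poly_mapping_induct_add [case_names zero single add]:
  fixes f :: "'a \<Rightarrow>\<^sub>0 'b::comm_monoid_add"
  assumes "P 0" "\<And>m c. m \<in> keys f \<Longrightarrow> P (single m c)" "\<And>f g. P f \<Longrightarrow> P g \<Longrightarrow> P (f + g)"
  shows "P f"
  using assms(2)
proof (induction f rule: Poly_Mapping.update_induct)
  case const
  show ?case by (rule assms(1))
next
  case (update f a b)
  have up: "Poly_Mapping.update a b f = f + single a b"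
    using update(1) by (intro poly_mapping_eqI) (auto simp: lookup_update lookup_add lookup_single in_keys_iff)
  have k: "keys (Poly_Mapping.update a b f) = insert a (keys f)"
    using update(2) by (auto simp: in_keys_iff lookup_update split: if_splits)
  show ?case unfolding up by (rule assms(3)) (use update k in auto)
qed

text \<open>For an additive family this is the unique additive map with value
  \<open>\<phi> m c\<close> on \<open>single m c\<close>. Evaluation, \<open>weight\<close> and the
  functionals used below are all of this form, so additivity is checked once.\<close>

definition additive_ext :: "('a \<Rightarrow> 'b \<Rightarrow> 'c) \<Rightarrow> ('a \<Rightarrow>\<^sub>0 'b::comm_monoid_add) \<Rightarrow> 'c::comm_monoid_add" where
  "additive_ext \<phi> f = (\<Sum>m\<in>keys f. \<phi> m (lookup f m))"

locale additive_family =
  fixes \<phi> :: "'a \<Rightarrow> 'b::comm_monoid_add \<Rightarrow> 'c::comm_monoid_add"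
  assumes zero_right: "\<phi> m 0 = 0"
    and add_right: "\<phi> m (c + c') = \<phi> m c + \<phi> m c'"
begin

lemma ext_zero [simp]: "additive_ext \<phi> 0 = 0"
  by (simp add: additive_ext_def)

lemma ext_superset:
  assumes "finite A" "keys f \<subseteq> A"
  shows "additive_ext \<phi> f = (\<Sum>m\<in>A. \<phi> m (lookup f m))"
  unfolding additive_ext_def using assms
  by (intro sum.mono_neutral_left) (auto simp: in_keys_iff zero_right)

lemma ext_add: "additive_ext \<phi> (f + g) = additive_ext \<phi> f + additive_ext \<phi> g"
proof -
  have "finite (keys f \<union> keys g)" by simp
  then show ?thesis
    using keys_add[of f g]
    by (simp add: ext_superset[of "keys f \<union> keys g"] lookup_add add_right sum.distrib)
qed

lemma ext_single [simp]: "additive_ext \<phi> (single m c) = \<phi> m c"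
  by (cases "c = 0") (simp_all add: additive_ext_def zero_right)

end

definition monom_eval :: "('v \<Rightarrow> 'b::comm_ring_1) \<Rightarrow> ('v \<Rightarrow>\<^sub>0 nat) \<Rightarrow> 'b" where
  "monom_eval a m = (\<Prod>v\<in>keys m. a v ^ lookup m v)"

lemma monom_eval_superset:
  assumes "finite A" "keys m \<subseteq> A"
  shows "monom_eval a m = (\<Prod>v\<in>A. a v ^ lookup m v)"
  unfolding monom_eval_def using assms
  by (intro prod.mono_neutral_left) (auto simp: in_keys_iff)

lemma monom_eval_zero [simp]: "monom_eval a 0 = 1"
  by (simp add: monom_eval_def)

lemma monom_eval_add: "monom_eval a (m + m') = monom_eval a m * monom_eval a m'"
proof -
  have "finite (keys m \<union> keys m')" by simp
  then show ?thesis using keys_add[of m m']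
    by (simp add: monom_eval_superset[of "keys m \<union> keys m'"] lookup_add power_add prod.distrib)
qed

lemma monom_eval_single [simp]: "monom_eval a (single v k) = a v ^ k"
  by (cases "k = 0") (simp_all add: monom_eval_def)

text \<open>Ring homomorphisms between types. Evaluations along such a map are again instances, so
  the laws proved here also serve for the substitutions of variables used later.\<close>

locale coeff_hom =
  fixes h :: "'k::comm_ring_1 \<Rightarrow> 'b::comm_ring_1"
  assumes h_zero [simp]: "h 0 = 0" and h_one [simp]: "h 1 = 1"
    and h_add: "h (x + y) = h x + h y" and h_mult: "h (x * y) = h x * h y"
begin

sublocale ext: additive_family "\<lambda>m c. h c * monom_eval a m" for a :: "'v \<Rightarrow> 'b"
  by standard (simp_all add: h_add algebra_simps)

lemma meval_eq_ext: "meval h a f = additive_ext (\<lambda>m c. h c * monom_eval a m) f"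
  by (simp add: meval_def additive_ext_def monom_eval_def)

lemma meval_zero [simp]: "meval h a 0 = 0"
  by (simp add: meval_eq_ext)

lemma meval_single: "meval h a (single m c) = h c * monom_eval a m"
  by (simp add: meval_eq_ext)

lemma meval_add: "meval h a (f + g) = meval h a f + meval h a g"
  by (simp add: meval_eq_ext ext.ext_add)

lemma meval_mult: "meval h a (f * g) = meval h a f * meval h a g"
proof (induction f rule: poly_mapping_induct_add)
  case (single m c)
  show ?case
    by (induction g rule: poly_mapping_induct_add)
       (simp_all add: mult_single meval_single h_mult monom_eval_add algebra_simps meval_add)
qed (simp_all add: meval_add algebra_simps)

lemma meval_const [simp]: "meval h a (mconst c) = h c"
  by (simp add: mconst_def meval_single)

lemma meval_var [simp]: "meval h a (mvar v) = a v"
  by (simp add: mvar_def meval_single)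

lemma meval_one [simp]: "meval h a 1 = 1"
  using meval_const[of a 1] by (simp add: mconst_def)

lemma meval_prod: "meval h a (prod F A) = (\<Prod>i\<in>A. meval h a (F i))"
  by (induction A rule: infinite_finite_induct) (simp_all add: meval_mult)

lemma meval_power: "meval h a (f ^ k) = meval h a f ^ k"
  by (induction k) (simp_all add: meval_mult)

end

lemma mconst_0 [simp]: "mconst 0 = 0" and mconst_1 [simp]: "mconst 1 = 1"
  and mconst_add: "mconst (x + y) = mconst x + mconst y"
  and mconst_mult: "mconst (x * y) = mconst x * mconst y"
  and mconst_uminus: "mconst (- x) = - mconst x"
  by (simp_all add: mconst_def single_add mult_single single_uminus)

interpretation mconst: coeff_hom mconst
  by standard (simp_all add: mconst_add mconst_mult)

interpretation fps_mconst: coeff_hom "\<lambda>c. fps_const (mconst c)"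
  by standard (simp_all add: mconst_add mconst_mult)

abbreviation monom :: "('v \<Rightarrow>\<^sub>0 nat) \<Rightarrow> ('v, 'k::comm_ring_1) mpol" where
  "monom m \<equiv> single m 1"

lemma mconst_mult_single: "mconst c * single m d = single m (c * d)"
  by (simp add: mconst_def mult_single)

lemma single_eq_mconst_monom: "single m c = mconst c * monom m"
  by (simp add: mconst_mult_single)

lemma lookup_mconst_mult [simp]: "lookup (mconst c * f) m = c * lookup f m"
  by (induction f rule: poly_mapping_induct_add)
     (auto simp: mconst_mult_single lookup_single lookup_add algebra_simps when_def)

lemma monom_eval_mvar: "monom_eval mvar m = monom m"
proof (induction m rule: poly_mapping_induct_add)
  case (single v k)
  have "(mvar v :: ('a, 'b) mpol) ^ k = monom (single v k)"
    by (induction k) (simp_all add: mvar_def mult_single flip: single_add)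
  then show ?case by simp
qed (simp_all add: monom_eval_add mult_single)

lemma mpol_expand: "f = (\<Sum>m\<in>keys f. single m (lookup f m))"
proof -
  interpret additive_family "single :: 'a \<Rightarrow> 'b \<Rightarrow> 'a \<Rightarrow>\<^sub>0 'b"
    by standard (simp_all add: single_add)
  have "f = additive_ext single f"
    by (induction f rule: poly_mapping_induct_add) (simp_all add: ext_add)
  then show ?thesis by (simp add: additive_ext_def)
qed

lemma carrier_mpol_ring: "f \<in> mpols V \<longleftrightarrow> (\<forall>m\<in>keys f. keys m \<subseteq> V)"
  by (simp add: mpol_ring_def)

lemma mpol_ring_simps [simp]:
  "x \<otimes>\<^bsub>mpol_ring V\<^esub> y = x * y" "x \<oplus>\<^bsub>mpol_ring V\<^esub> y = x + y"
  "\<one>\<^bsub>mpol_ring V\<^esub> = 1" "\<zero>\<^bsub>mpol_ring V\<^esub> = 0"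
  by (simp_all add: mpol_ring_def)

lemma keys_mult_subset: "keys m \<subseteq> V \<Longrightarrow> keys m' \<subseteq> V \<Longrightarrow> keys (m + m') \<subseteq> V"
  for m m' :: "'v \<Rightarrow>\<^sub>0 nat"
  using keys_add[of m m'] by blast

lemma mpol_ring_closed [simp, intro]:
  shows "0 \<in> mpols V" "1 \<in> mpols V"
    "x \<in> mpols V \<Longrightarrow> y \<in> mpols V \<Longrightarrow> x + y \<in> mpols V"
    "x \<in> mpols V \<Longrightarrow> - x \<in> mpols V"
    "mconst c \<in> mpols V"
    "v \<in> V \<Longrightarrow> mvar v \<in> mpols V"
  unfolding carrier_mpol_ring
  using keys_add[of x y] by (auto simp: mconst_def mvar_def)

lemma mpol_ring_mult_closed [simp, intro]:
  assumes "x \<in> mpols V" "y \<in> mpols V"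
  shows "x * y \<in> mpols V"
  unfolding carrier_mpol_ring
proof
  fix m assume "m \<in> keys (x * y)"
  then obtain a b where "a \<in> keys x" "b \<in> keys y" "m = a + b"
    using keys_mult[of x y] by blast
  then show "keys m \<subseteq> V" using assms keys_mult_subset[of a V b] by (auto simp: carrier_mpol_ring)
qed

lemma mpol_ring_prod: "(\<And>i. i \<in> A \<Longrightarrow> F i \<in> mpols V) \<Longrightarrow> prod F A \<in> mpols V"
  by (induction A rule: infinite_finite_induct) auto

lemma mpol_ring_power: "x \<in> mpols V \<Longrightarrow> x ^ k \<in> mpols V"
  by (induction k) auto

lemma mpol_ring_single: "keys m \<subseteq> V \<Longrightarrow> single m c \<in> mpols V"
  by (simp add: carrier_mpol_ring)

lemma mpol_ring_cring: "cring (mpol_ring V)"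
proof (rule cringI)
  show "abelian_group (mpol_ring V)"
  proof (rule abelian_groupI)
    fix x assume "x \<in> mpols V"
    then show "\<exists>y\<in>mpols V. y \<oplus>\<^bsub>mpol_ring V\<^esub> x = \<zero>\<^bsub>mpol_ring V\<^esub>"
      by (intro bexI[of _ "- x"]) auto
  qed (auto simp: algebra_simps)
  show "Group.comm_monoid (mpol_ring V)"
    by (rule comm_monoidI) (auto simp: algebra_simps)
qed (auto simp: algebra_simps)

lemma mpol_ring_minus: 
  assumes "x \<in> mpols V"
  shows "\<ominus>\<^bsub>mpol_ring V\<^esub> x = - x"
proof -
  interpret cring "mpol_ring V" by (rule mpol_ring_cring)
  show ?thesis using assms minus_equality[of "- x" x] by auto
qed

lemma mpol_ring_induct [consumes 1, case_names const var add mult]: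
  assumes f: "f \<in> mpols V"
    and const: "\<And>c. P (mconst c)" and var: "\<And>v. v \<in> V \<Longrightarrow> P (mvar v)"
    and add: "\<And>f g. f \<in> mpols V \<Longrightarrow> g \<in> mpols V \<Longrightarrow> P f \<Longrightarrow> P g \<Longrightarrow> P (f + g)"
    and mult: "\<And>f g. f \<in> mpols V \<Longrightarrow> g \<in> mpols V \<Longrightarrow> P f \<Longrightarrow> P g \<Longrightarrow> P (f * g)"
  shows "P f"
proof -
  let ?Q = "\<lambda>f. f \<in> mpols V \<and> P f"
  have pow: "?Q (mvar v ^ k)" if "v \<in> V" for v k
    using that const[of 1] by (induction k) (auto intro!: var mult)
  have mon: "?Q (monom m)" if "keys m \<subseteq> V" for m
  proof -
    have "?Q (\<Prod>v\<in>A. mvar v ^ lookup m v)" if "A \<subseteq> V" for A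
      using that const[of 1] by (induction A rule: infinite_finite_induct) (use pow in \<open>auto intro!: mult\<close>)
    from this[OF that] show ?thesis
      by (simp flip: monom_eval_mvar add: monom_eval_def)
  qed
  have "?Q (\<Sum>m\<in>A. single m (lookup f m))" if "A \<subseteq> keys f" for A
    using that
  proof (induction A rule: infinite_finite_induct)
    case (insert m A)
    have "?Q (monom m)" using insert f by (intro mon) (auto simp: carrier_mpol_ring)
    then have "?Q (single m (lookup f m))"
      using const[of "lookup f m"] by (auto simp: single_eq_mconst_monom[of _ "lookup f m"] intro!: mult)
    then show ?case using insert by (auto intro!: add)
  qed (use const[of 0] in auto)
  from this[OF order_refl] show ?thesis by (simp flip: mpol_expand)
qed

section \<open>Graded ideals and Hilbert series\<close>

interpretation mpv: vector_space "\<lambda>(c::'k::field) (f :: ('v, 'k) mpol). mconst c * f"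
  by standard (simp_all add: algebra_simps mconst_add mconst_mult)

lemma mpv_mult_hom: "module_hom (\<lambda>c f. mconst c * f) (\<lambda>c f. mconst c * f) ((*) u)"
  for u :: "('v, 'k::field) mpol"
  by (intro module_hom.intro module_hom_axioms.intro mpv.module_axioms) (simp_all add: algebra_simps)

lemma mpv_span_mult_image: "mpv.span ((*) u ` S) = (*) u ` mpv.span S"
  for u :: "('v, 'k::field) mpol"
  by (rule module_hom.span_image[OF mpv_mult_hom])

text \<open>The ambient space may be infinite-dimensional, so finiteness has to come from a finite
  \<open>F\<close> whose span contains \<open>A\<close>. Prescribing \<open>S\<close> yields bases
  compatible with a subspace.\<close>

lemma mpv_finite_basis:
  fixes A F :: "('v, 'k::field) mpol set"
  assumes "mpv.subspace A" "A \<subseteq> mpv.span F" "finite F" "S \<subseteq> A" "mpv.independent S"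
  obtains B where "S \<subseteq> B" "B \<subseteq> A" "mpv.independent B" "mpv.span B = A" "finite B" "card B = mpv.dim A"
proof -
  obtain B where B: "S \<subseteq> B" "B \<subseteq> A" "mpv.independent B" "A \<subseteq> mpv.span B"
    using mpv.maximal_independent_subset_extend[OF assms(4,5)] .
  have "mpv.span B = A" using B(2,4) assms(1) mpv.span_minimal by blast
  moreover have "finite B"
    using mpv.independent_span_bound[OF assms(3) B(3)] B(2) assms(2) by blast
  moreover have "card B = mpv.dim A"
    using mpv.basis_card_eq_dim[OF B(2,4,3)] .
  ultimately show ?thesis using that B by blast
qed

lemma mpv_dim_mono:
  fixes A B F :: "('v, 'k::field) mpol set"
  assumes "mpv.subspace A" "mpv.subspace B" "A \<subseteq> B" "B \<subseteq> mpv.span F" "finite F"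
  shows "mpv.dim A \<le> mpv.dim B"
proof -
  obtain S where S: "S \<subseteq> A" "mpv.independent S" "card S = mpv.dim A"
    by (rule mpv_finite_basis[OF assms(1) order_trans[OF assms(3,4)] assms(5) empty_subsetI mpv.independent_empty])
  obtain T where "S \<subseteq> T" "finite T" "card T = mpv.dim B"
    by (rule mpv_finite_basis[OF assms(2,4,5) order_trans[OF S(1) assms(3)] S(2)])
  then show ?thesis using S(3) card_mono by metis
qed

text \<open>Rank-nullity for multiplication by \<open>u\<close> from \<open>E\<close> to the
  quotient by \<open>I\<close>: the kernel is \<open>?C\<close> and the image is (I + uE)/I.
  Quotient spaces are avoided: a basis \<open>B0\<close> of the kernel is extended to a basis
  \<open>B\<close> of \<open>E\<close>, and a basis \<open>D\<close> of \<open>I\<close> together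
  with u(B - B0) is one of I + uE.\<close>

lemma mpv_dim_sum_image:
  fixes u :: "('v, 'k::field) mpol"
  assumes I: "mpv.subspace I" "I \<subseteq> mpv.span F" "finite F"
    and E: "mpv.subspace E" "E \<subseteq> mpv.span F'" "finite F'"
  shows "mpv.dim {a + u * b | a b. a \<in> I \<and> b \<in> E} + mpv.dim {b \<in> E. u * b \<in> I} = mpv.dim I + mpv.dim E"
proof -
  let ?C = "{b \<in> E. u * b \<in> I}"
  interpret u: module_hom "\<lambda>c f. mconst c * f" "\<lambda>c f. mconst c * f" "(*) u" by (rule mpv_mult_hom)
  have subC: "mpv.subspace ?C"
    using I(1) E(1) by (auto simp: mpv.subspace_def u.add u.scale)
  obtain B0 where B0: "B0 \<subseteq> ?C" "mpv.independent B0" "mpv.span B0 = ?C" "finite B0" "card B0 = mpv.dim ?C"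
    using mpv_finite_basis[OF subC _ E(3), of "{}"] E(2) mpv.independent_empty by auto
  obtain B where B: "B0 \<subseteq> B" "B \<subseteq> E" "mpv.independent B" "mpv.span B = E" "finite B" "card B = mpv.dim E"
    using mpv_finite_basis[OF E _ B0(2)] B0(1) by auto
  obtain D where D: "D \<subseteq> I" "mpv.independent D" "mpv.span D = I" "finite D" "card D = mpv.dim I"
    using mpv_finite_basis[OF I, of "{}"] mpv.independent_empty by auto
  \<comment> \<open>Independence and cardinality go together: an image outside the span reached so
    far is both new and independent of it.\<close>
  have key: "mpv.independent (D \<union> (*) u ` S) \<and> card (D \<union> (*) u ` S) = card D + card S"
    if "S \<subseteq> B - B0" for S
  proof -
    have "finite S" using that B(5) finite_subset by blast
    then show ?thesis using that
    proof (induction S)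
      case empty
      then show ?case using D by simp
    next
      case (insert s S)
      have notin: "u * s \<notin> mpv.span (D \<union> (*) u ` S)"
      proof
        assume "u * s \<in> mpv.span (D \<union> (*) u ` S)"
        then obtain d t where dt: "u * s = d + u * t" "d \<in> I" "t \<in> mpv.span S"
          unfolding mpv.span_Un mpv_span_mult_image D(3) by auto
        have "S \<subseteq> E" "s \<in> E" using insert.prems B(2) by auto
        then have "t \<in> E" using dt(3) E(1) mpv.span_minimal by blast
        \<comment> \<open>The difference is multiplied into \<open>I\<close>, so it lies in the
          kernel and thus in the span of \<open>B0\<close>; then \<open>s\<close> depends on other
          elements of \<open>B\<close>.\<close>
        then have "s - t \<in> ?C"
          using dt \<open>s \<in> E\<close> mpv.subspace_diff[OF E(1)] by (auto simp: algebra_simps)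
        then have "s - t \<in> mpv.span B0" using B0(3) by simp
        moreover have "B0 \<subseteq> B - {s}" "S \<subseteq> B - {s}" using insert.prems insert.hyps B(1) by auto
        ultimately have "s - t \<in> mpv.span (B - {s})" "t \<in> mpv.span (B - {s})"
          using dt(3) mpv.span_mono by blast+
        then have "(s - t) + t \<in> mpv.span (B - {s})" by (rule mpv.span_add)
        moreover have "s \<in> B" using insert.prems by blast
        ultimately have "mpv.dependent B" by (subst mpv.dependent_def) (auto simp only: diff_add_cancel)
        then show False using B(3) by blast
      qed
      have new: "u * s \<notin> D \<union> (*) u ` S" using notin by (rule contrapos_nn) (rule mpv.span_base)
      have IH: "mpv.independent (D \<union> (*) u ` S)" "card (D \<union> (*) u ` S) = card D + card S"
        using insert.IH insert.prems by auto
      have eq: "D \<union> (*) u ` insert s S = insert (u * s) (D \<union> (*) u ` S)" by simp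
      have "finite (D \<union> (*) u ` S)" using D(4) insert.hyps by simp
      then have "card (insert (u * s) (D \<union> (*) u ` S)) = card D + card (insert s S)"
        using new IH(2) insert.hyps by simp
      then show ?case unfolding eq using mpv.independent_insertI[OF notin IH(1)] by blast
    qed
  qed
  have sp: "mpv.span (D \<union> (*) u ` (B - B0)) = {a + u * b | a b. a \<in> I \<and> b \<in> E}" (is "?L = ?R")
  proof
    show "?L \<subseteq> ?R"
      unfolding mpv.span_Un mpv_span_mult_image D(3)
      using B(4) mpv.span_mono[of "B - B0" B] by blast
    show "?R \<subseteq> ?L"
    proof clarify
      fix a b assume ab: "a \<in> I" "b \<in> E"
      then obtain b0 b1 where b: "b = b0 + b1" "b0 \<in> mpv.span B0" "b1 \<in> mpv.span (B - B0)"
        using B(1,4) mpv.span_Un[of B0 "B - B0"] by (auto simp: Un_absorb1)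
      have "a + u * b0 \<in> I" using b(2) B0(3) ab(1) I(1) by (auto simp: mpv.subspace_def)
      moreover have "a + u * b = (a + u * b0) + u * b1" by (simp add: b algebra_simps)
      ultimately show "a + u * b \<in> ?L"
        unfolding mpv.span_Un mpv_span_mult_image D(3) using b(3) by blast
    qed
  qed
  have "mpv.dim ?R = card D + card (B - B0)"
    using key[of "B - B0"] mpv.dim_span_eq_card_independent[of "D \<union> (*) u ` (B - B0)"] sp by simp
  also have "card (B - B0) = card B - card B0" using B(1) B0(4) by (simp add: card_Diff_subset)
  finally show ?thesis using B(6) B0(5) D(5) card_mono[OF B(5,1)] by simp
qed

section \<open>Monomials and polynomials of fixed weight, homogeneous ideals\<close>

lemma weight_eq_ext: "weight m = additive_ext (\<lambda>v k. k * snd v) m"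
  by (simp add: weight_def additive_ext_def)

lemma weight_family: "additive_family (\<lambda>v k. k * snd v :: nat)"
  by standard (simp_all add: algebra_simps)

lemma weight_add [simp]: "weight (m + m') = weight m + weight m'"
  by (simp add: weight_eq_ext additive_family.ext_add[OF weight_family])

lemma weight_single [simp]: "weight (single v k) = k * snd v"
  by (simp add: weight_eq_ext additive_family.ext_single[OF weight_family])

lemma weight_zero [simp]: "weight 0 = 0"
  by (simp add: weight_def)

text \<open>The two conditions make every weight piece finite-dimensional and the piece of weight
  zero equal to the base field.\<close>

locale weighted_variables =
  fixes V :: "(nat \<times> nat) set"
  assumes finite_slices: "finite {v \<in> V. snd v \<le> j}"
    and positive_weights: "v \<in> V \<Longrightarrow> 0 < snd v"
begin

definition monoms :: "nat \<Rightarrow> (nat \<times> nat \<Rightarrow>\<^sub>0 nat) set" where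
  "monoms j = {m. keys m \<subseteq> V \<and> weight m = j}"

definition homog :: "nat \<Rightarrow> ('k::field) arc_poly set" where
  "homog j = {f. keys f \<subseteq> monoms j}"

lemma exponent_bounds:
  assumes "m \<in> monoms j" "v \<in> keys m"
  shows "snd v \<le> j" "lookup m v \<le> j" "v \<in> V"
proof -
  show v: "v \<in> V" using assms by (auto simp: monoms_def)
  have "lookup m v * snd v \<le> weight m"
    unfolding weight_def using assms(2) by (intro member_le_sum) auto
  moreover have "lookup m v > 0" "snd v > 0" using assms(2) positive_weights[OF v] by (auto simp: in_keys_iff)
  moreover have "weight m = j" using assms(1) by (simp add: monoms_def)
  moreover have "snd v \<le> lookup m v * snd v" "lookup m v \<le> lookup m v * snd v"
    using calculation(2,3) by auto
  ultimately show "snd v \<le> j" "lookup m v \<le> j" by linarith+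
qed

lemma finite_monoms: "finite (monoms j)"
proof -
  let ?X = "{v \<in> V. snd v \<le> j}"
  have "lookup ` monoms j \<subseteq> {f. (\<forall>x. (x \<in> ?X \<longrightarrow> f x \<in> {..j}) \<and> (x \<notin> ?X \<longrightarrow> f x = 0))}"
  proof (intro image_subsetI CollectI allI conjI impI)
    fix m x assume m: "m \<in> monoms j"
    show "lookup m x \<in> {..j}"
      using exponent_bounds(2)[OF m, of x] by (cases "x \<in> keys m") (auto simp: in_keys_iff)
    show "lookup m x = 0" if "x \<notin> ?X"
      using exponent_bounds(1,3)[OF m, of x] that by (auto simp: in_keys_iff)
  qed
  moreover have "finite {f. (\<forall>x. (x \<in> ?X \<longrightarrow> f x \<in> {..j}) \<and> (x \<notin> ?X \<longrightarrow> f x = 0))}"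
    by (rule finite_set_of_finite_funs) (use finite_slices in auto)
  ultimately have "finite (lookup ` monoms j)" by (rule finite_subset)
  then show ?thesis by (rule finite_imageD) (auto simp: inj_on_def poly_mapping_eqI)
qed

lemma monoms_0: "monoms 0 = {0}"
proof -
  have "m = 0" if "m \<in> monoms 0" for m
  proof -
    have "v \<notin> keys m" for v
      using exponent_bounds[OF that, of v] positive_weights[of v] by auto
    then show ?thesis by (metis keys_eq_empty ex_in_conv)
  qed
  then show ?thesis by (auto simp: monoms_def)
qed

lemma monoms_add: "m \<in> monoms i \<Longrightarrow> m' \<in> monoms j \<Longrightarrow> m + m' \<in> monoms (i + j)"
  unfolding monoms_def using keys_mult_subset[of m V m'] by simp

lemma homog_subspace: "mpv.subspace (homog j :: ('k::field) arc_poly set)"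
proof (rule mpv.subspaceI)
  show "f + g \<in> homog j" if "f \<in> homog j" "g \<in> homog j" for f g :: "'k arc_poly"
    using that keys_add[of f g] by (auto simp: homog_def)
  show "mconst c * f \<in> homog j" if "f \<in> homog j" for c and f :: "'k arc_poly"
    using that by (auto simp: homog_def in_keys_iff)
qed (simp add: homog_def)

lemma homog_single: "m \<in> monoms j \<Longrightarrow> single m c \<in> homog j"
  by (auto simp: homog_def)

lemma homog_eq_span: "(homog j :: ('k::field) arc_poly set) = mpv.span (monom ` monoms j)"
  (is "?L = ?R")
proof
  show "?R \<subseteq> ?L"
    by (rule mpv.span_minimal[OF _ homog_subspace]) (auto simp: homog_single)
  show "?L \<subseteq> ?R"
  proof
    fix f :: "'k arc_poly" assume f: "f \<in> homog j"
    have "(\<Sum>m\<in>keys f. mconst (lookup f m) * monom m) \<in> mpv.span (monom ` monoms j)"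
    proof (rule mpv.span_sum, rule mpv.span_scale, rule mpv.span_base)
      fix m assume "m \<in> keys f"
      then show "monom m \<in> monom ` monoms j" using f by (auto simp: homog_def)
    qed
    then show "f \<in> mpv.span (monom ` monoms j)"
      by (simp flip: single_eq_mconst_monom mpol_expand)
  qed
qed

lemma homog_mult: 
  assumes "f \<in> homog i" "g \<in> homog j" shows "f * g \<in> homog (i + j)"
  unfolding homog_def
proof clarify
  fix m assume "m \<in> keys (f * g)"
  then obtain a b where "a \<in> keys f" "b \<in> keys g" "m = a + b" using keys_mult[of f g] by blast
  then show "m \<in> monoms (i + j)" using assms by (auto simp: homog_def intro!: monoms_add)
qed

lemma homog_induct [consumes 1, case_names zero single add]:
  assumes "f \<in> homog j"
    and "P 0" "\<And>m c. m \<in> monoms j \<Longrightarrow> P (single m c)"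
    and "\<And>f g. P f \<Longrightarrow> P g \<Longrightarrow> P (f + g)"
  shows "P f"
proof -
  have "P (\<Sum>m\<in>A. single m (lookup f m))" if "A \<subseteq> keys f" for A
    using that assms(1) by (induction A rule: infinite_finite_induct) (auto intro!: assms(2-4) simp: homog_def)
  from this[OF order_refl] show ?thesis by (simp flip: mpol_expand)
qed

text \<open>A homogeneous ideal is represented by its weight pieces, so that every dimension count
  takes place in some finite-dimensional \<open>homog j\<close>.\<close>

definition graded_ideal :: "(nat \<Rightarrow> ('k::field) arc_poly set) \<Rightarrow> bool" where
  "graded_ideal J \<longleftrightarrow> (\<forall>j. mpv.subspace (J j) \<and> J j \<subseteq> homog j) \<and>
     (\<forall>i j. \<forall>f\<in>J i. \<forall>g\<in>homog j. f * g \<in> J (i + j))"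

lemma graded_idealD:
  assumes "graded_ideal J"
  shows "mpv.subspace (J j)" "J j \<subseteq> homog j" "f \<in> J i \<Longrightarrow> g \<in> homog j \<Longrightarrow> f * g \<in> J (i + j)"
  using assms by (auto simp: graded_ideal_def)

text \<open>The weight pieces of J + (u) for \<open>u\<close> of weight \<open>w\<close>. The case
  distinction guards against truncated subtraction: for \<open>j < w\<close> the difference would be
  0 and let constant multiples of \<open>u\<close> into the wrong weight.\<close>

definition adjoin :: "(nat \<Rightarrow> ('k::field) arc_poly set) \<Rightarrow> 'k arc_poly \<Rightarrow> nat \<Rightarrow>
    nat \<Rightarrow> 'k arc_poly set" where
  "adjoin J u w j = (if w \<le> j then {a + u * b | a b. a \<in> J j \<and> b \<in> homog (j - w)} else J j)"

definition colon :: "(nat \<Rightarrow> ('k::field) arc_poly set) \<Rightarrow> 'k arc_poly \<Rightarrow> nat \<Rightarrow>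
    nat \<Rightarrow> 'k arc_poly set" where
  "colon J u w j = {b \<in> homog j. u * b \<in> J (j + w)}"

text \<open>The Hilbert series of the quotient by \<open>J\<close>; integer coefficients allow the subtraction.\<close>

definition hilb :: "(nat \<Rightarrow> ('k::field) arc_poly set) \<Rightarrow> int fps" where
  "hilb J = Abs_fps (\<lambda>j. int (mpv.dim (homog j :: 'k arc_poly set)) - int (mpv.dim (J j)))"

lemma hilb_mono:
  fixes J J' :: "nat \<Rightarrow> ('k::field) arc_poly set"
  assumes "\<And>j. mpv.subspace (J j)" "\<And>j. mpv.subspace (J' j)" "\<And>j. J j \<subseteq> J' j" "\<And>j. J' j \<subseteq> homog j"
  shows "hilb J' $ j \<le> hilb J $ j"
proof -
  have "mpv.dim (J j) \<le> mpv.dim (J' j)"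
    using mpv_dim_mono[OF assms(1-3), of j "monom ` monoms j"] assms(4)[of j] finite_monoms[of j]
    by (auto simp: homog_eq_span)
  then show ?thesis by (simp add: hilb_def)
qed

lemma graded_ideal_colon:
  fixes J :: "nat \<Rightarrow> ('k::field) arc_poly set"
  assumes J: "graded_ideal J" and u: "u \<in> homog w"
  shows "graded_ideal (colon J u w)"
  unfolding graded_ideal_def
proof (intro conjI allI ballI)
  fix j
  show "mpv.subspace (colon J u w j)"
    using graded_idealD(1)[OF J, of "j + w"] homog_subspace[of j]
    by (auto simp: colon_def mpv.subspace_def distrib_left mult.left_commute[of u])
  show "colon J u w j \<subseteq> homog j" by (auto simp: colon_def)
next
  fix i j and f g :: "'k arc_poly" assume "f \<in> colon J u w i" and g: "g \<in> homog j"
  then show "f * g \<in> colon J u w (i + j)"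
    using graded_idealD(3)[OF J _ g, of "u * f" "i + w"] homog_mult[of f i g j]
    by (auto simp: colon_def algebra_simps)
qed

lemma colon_superset:
  assumes "graded_ideal J" "u \<in> homog w"
  shows "J j \<subseteq> colon J u w j"
  using graded_idealD(2,3)[OF assms(1)] assms(2) by (auto simp: colon_def mult.commute[of u])

lemma adjoin_superset: "J j \<subseteq> adjoin J u w j"
proof
  fix x assume "x \<in> J j"
  then have "\<exists>a b. x = a + u * b \<and> a \<in> J j \<and> b \<in> homog (j - w)"
    using mpv.subspace_0[OF homog_subspace] by (metis add.right_neutral mult_zero_right)
  then show "x \<in> adjoin J u w j" using \<open>x \<in> J j\<close> by (auto simp: adjoin_def)
qed

lemma adjoin_mono: "(\<And>j. J j \<subseteq> J' j) \<Longrightarrow> adjoin J u w j \<subseteq> adjoin J' u w j"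
  unfolding adjoin_def by (auto; blast)

lemma graded_ideal_adjoin:
  fixes J :: "nat \<Rightarrow> ('k::field) arc_poly set"
  assumes J: "graded_ideal J" and u: "u \<in> homog w"
  shows "graded_ideal (adjoin J u w)"
  unfolding graded_ideal_def
proof (intro conjI allI ballI)
  fix j
  have "mpv.subspace {x + y |x y. x \<in> J j \<and> y \<in> (*) u ` homog (j - w)}"
    by (intro mpv.subspace_sums graded_idealD[OF J] module_hom.subspace_image[OF mpv_mult_hom] homog_subspace)
  moreover have "{x + y |x y. x \<in> J j \<and> y \<in> (*) u ` homog (j - w)} =
      {a + u * b | a b. a \<in> J j \<and> b \<in> homog (j - w)}" by auto
  ultimately show "mpv.subspace (adjoin J u w j)"
    using graded_idealD(1)[OF J] by (simp add: adjoin_def)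
  show "adjoin J u w j \<subseteq> homog j"
    using graded_idealD(2)[OF J, of j] homog_mult[OF u, of _ "j - w"]
    by (auto simp: adjoin_def subset_iff intro!: mpv.subspace_add[OF homog_subspace[of j]])
next
  fix i j and f g :: "'k arc_poly" assume f: "f \<in> adjoin J u w i" and g: "g \<in> homog j"
  show "f * g \<in> adjoin J u w (i + j)"
  proof (cases "w \<le> i")
    case True
    then obtain a b where ab: "f = a + u * b" "a \<in> J i" "b \<in> homog (i - w)"
      using f by (auto simp: adjoin_def)
    have "f * g = a * g + u * (b * g)" by (simp add: ab algebra_simps)
    moreover have "b * g \<in> homog (i + j - w)" using homog_mult[OF ab(3) g] True by simp
    ultimately show ?thesis using graded_idealD(3)[OF J ab(2) g] True by (auto simp: adjoin_def)
  next
    case False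
    then have "f * g \<in> J (i + j)" using f graded_idealD(3)[OF J _ g] by (simp add: adjoin_def)
    then show ?thesis using adjoin_superset by blast
  qed
qed

text \<open>Multiplication by \<open>u\<close> gives the exact sequence 0 -> P/(J : u) -> P/J ->
  P/(J + (u)) -> 0, P the polynomial ring, in which the first map raises weights by
  \<open>w\<close>. Below weight \<open>w\<close> nothing is adjoined.\<close>

lemma hilb_exact:
  fixes J :: "nat \<Rightarrow> ('k::field) arc_poly set"
  assumes J: "graded_ideal J" and u: "u \<in> homog w"
  shows "hilb J = hilb (adjoin J u w) + fps_X ^ w * hilb (colon J u w)"
proof (rule fps_ext)
  fix j
  show "hilb J $ j = (hilb (adjoin J u w) + fps_X ^ w * hilb (colon J u w)) $ j"
  proof (cases "j < w")
    case False
    define i where "i = j - w"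
    have j: "j = i + w" using False by (simp add: i_def)
    have "mpv.dim {a + u * b | a b. a \<in> J j \<and> b \<in> homog i} + mpv.dim {b \<in> homog i. u * b \<in> J j} =
        mpv.dim (J j) + mpv.dim (homog i :: 'k arc_poly set)"
      by (rule mpv_dim_sum_image[of _ "monom ` monoms j" _ "monom ` monoms i"])
        (use graded_idealD[OF J] finite_monoms in \<open>auto simp: homog_subspace simp flip: homog_eq_span\<close>)
    then show ?thesis
      by (simp add: hilb_def adjoin_def colon_def fps_X_power_mult_nth j)
  qed (simp add: hilb_def adjoin_def fps_X_power_mult_nth)
qed

text \<open>The colon ideal contains \<open>J\<close>, so its quotient is at most as large; equality
  of the two series means that \<open>u\<close> is a nonzerodivisor modulo \<open>J\<close>.\<close>

lemma hilb_adjoin_ge: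
  assumes "graded_ideal J" "u \<in> homog w"
  shows "((1 - fps_X ^ w) * hilb J) $ j \<le> hilb (adjoin J u w) $ j"
proof -
  have "hilb (colon J u w) $ (j - w) \<le> hilb J $ (j - w)"
    by (intro hilb_mono graded_idealD[OF graded_ideal_colon] graded_idealD[OF assms(1)] colon_superset assms)
  then show ?thesis
    using hilb_exact[OF assms] by (simp add: left_diff_distrib fps_X_power_mult_nth)
qed

text \<open>If the product of the \<open>u\<^sub>r\<close> vanishes in the quotient \<open>A\<close> by \<open>J\<close>, then \<open>A\<close> is filtered by
  \<open>u\<^sub>1 \<dots> u\<^sub>r A\<close>, whose subquotients are, up to a shift, quotients of \<open>A / u\<^bsub>r+1\<^esub> A\<close>. The bounds
  on their Hilbert series telescope.\<close>

lemma hilb_le_of_product: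
  fixes C :: "int fps"
  assumes "graded_ideal J" "\<And>u w. (u, w) \<in> set us \<Longrightarrow> u \<in> homog w"
    and "prod_list (map fst us) \<in> J (sum_list (map snd us))"
    and "\<And>u w j. (u, w) \<in> set us \<Longrightarrow> hilb (adjoin J u w) $ j \<le> ((1 - fps_X ^ w) * C) $ j"
  shows "hilb J $ j \<le> ((1 - fps_X ^ sum_list (map snd us)) * C) $ j"
  using assms
proof (induction us arbitrary: J j)
  case Nil
  \<comment> \<open>The empty product is 1, so \<open>J\<close> is the unit ideal and both sides of
    the bound are zero.\<close>
  have "homog j \<subseteq> J j" 
    using graded_idealD(3)[OF Nil(1), of 1 0 _ j] Nil(3) by auto
  then have "J j = homog j" using graded_idealD(2)[OF Nil(1), of j] by blast
  then show ?case by (simp add: hilb_def)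
next
  case (Cons uw us)
  obtain u w where uw: "uw = (u, w)" by (cases uw)
  define s where "s = sum_list (map snd us)"
  have u: "u \<in> homog w" using Cons.prems(2) uw by auto
  \<comment> \<open>Up to a shift, the submodule generated by \<open>u\<close> is the quotient by
    this ideal, and there the product of the remaining factors vanishes.\<close>
  let ?J = "colon J u w"
  have J: "graded_ideal J" by fact
  have J': "graded_ideal ?J" by (rule graded_ideal_colon[OF J u])
  have prod_homog: "prod_list (map fst us') \<in> homog (sum_list (map snd us'))" if "set us' \<subseteq> set us" for us'
    using that
  proof (induction us')
    case Nil
    then show ?case using homog_single[of 0 0 1] by (simp add: monoms_0)
  next
    case (Cons a us')
    then show ?case using Cons.prems Cons.IH homog_mult[of "fst a" "snd a"] \<open>\<And>u w. (u, w) \<in> set (uw # us) \<Longrightarrow> u \<in> homog w\<close>[of "fst a" "snd a"]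
      by auto
  qed
  have IH: "hilb ?J $ i \<le> ((1 - fps_X ^ s) * C) $ i" for i
    unfolding s_def
  proof (rule Cons.IH[OF J'])
    show "prod_list (map fst us) \<in> ?J (sum_list (map snd us))"
      using prod_homog[of us] Cons.prems(3) by (simp add: uw colon_def add.commute)
    fix u' w' i assume in_us: "(u', w') \<in> set us"
    then have u': "u' \<in> homog w'" using Cons.prems(2) by auto
    \<comment> \<open>Passing to the colon ideal only enlarges the ideal, so the bounds assumed for
      the remaining factors are inherited.\<close>
    have "hilb (adjoin ?J u' w') $ i \<le> hilb (adjoin J u' w') $ i"
      by (rule hilb_mono)
        (intro graded_idealD[OF graded_ideal_adjoin] J J' u' adjoin_mono colon_superset[OF J u])+
    also have "\<dots> \<le> ((1 - fps_X ^ w') * C) $ i" using Cons.prems(4) in_us by auto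
    finally show "hilb (adjoin ?J u' w') $ i \<le> ((1 - fps_X ^ w') * C) $ i" .
  qed (use Cons.prems(2) in auto)
  have "hilb J $ j = hilb (adjoin J u w) $ j + (fps_X ^ w * hilb ?J) $ j"
    by (subst hilb_exact[OF J u]) simp
  also have "\<dots> \<le> ((1 - fps_X ^ w) * C) $ j + (fps_X ^ w * ((1 - fps_X ^ s) * C)) $ j"
    using Cons.prems(4)[of u w j] IH[of "j - w"] by (auto simp: uw fps_X_power_mult_nth)
  \<comment> \<open>The telescoping identity (1 - t^w) + t^w (1 - t^s) = 1 - t^(w+s).\<close>
  also have "\<dots> = ((1 - fps_X ^ (w + s)) * C) $ j"
    by (simp add: algebra_simps power_add flip: fps_add_nth)
  finally show ?case by (simp add: uw s_def)
qed

text \<open>Each generator is paired with its weight, which a polynomial does not determine when it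
  is zero, as happens below for \<open>red_coeff l\<close> with \<open>l < e\<close>.\<close>

definition generated :: "(('k::field) arc_poly \<times> nat) set \<Rightarrow> nat \<Rightarrow> 'k arc_poly set" where
  "generated G j = mpv.span {monom m * g | m g w i. (g, w) \<in> G \<and> m \<in> monoms i \<and> i + w = j}"

lemma generated_mono: "G \<subseteq> G' \<Longrightarrow> generated G j \<subseteq> generated G' j"
  unfolding generated_def by (rule mpv.span_mono) blast

lemma generated_base: 
  assumes "(g, w) \<in> G" shows "g \<in> generated G w"
proof -
  have "monom 0 * g \<in> generated G w"
    unfolding generated_def using assms monoms_0 by (intro mpv.span_base) fastforce
  then show ?thesis by simp
qed

lemma graded_ideal_generated:
  fixes G :: "(('k::field) arc_poly \<times> nat) set"
  assumes G: "\<And>g w. (g, w) \<in> G \<Longrightarrow> g \<in> homog w"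
  shows "graded_ideal (generated G)"
  unfolding graded_ideal_def
proof (intro conjI allI ballI)
  fix j
  show "mpv.subspace (generated G j)" by (simp add: generated_def mpv.subspace_span)
  show "generated G j \<subseteq> homog j"
    unfolding generated_def
  proof (rule mpv.span_minimal[OF _ homog_subspace], clarify)
    fix m and g :: "'k arc_poly" and w i assume "(g, w) \<in> G" "m \<in> monoms i"
    then show "monom m * g \<in> homog (i + w)" using G by (intro homog_mult homog_single)
  qed
next
  fix i j and f g :: "'k arc_poly" assume f: "f \<in> generated G i" and g: "g \<in> homog j"
  have sub: "mpv.subspace (generated G (i + j))" by (simp add: generated_def mpv.subspace_span)
  have monom: "f * monom m \<in> generated G (i + j)" if m: "m \<in> monoms j" for m
    using f unfolding generated_def[of G i]
  proof (induction rule: mpv.span_induct)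
    case base
    then show ?case using sub by (auto simp: mpv.subspace_def distrib_right mult.assoc)
  next
    case (step x)
    then obtain m' g' w' i' where *: "x = monom m' * g'" "(g', w') \<in> G" "m' \<in> monoms i'" "i' + w' = i" by blast
    then have "x * monom m = monom (m' + m) * g'" by (simp add: mult_single flip: mult.assoc) (simp add: mult_single mult.commute mult.left_commute)
    moreover have "m' + m \<in> monoms (i' + j)" by (rule monoms_add) fact+
    moreover have "i' + j + w' = i + j" using * by simp
    ultimately show ?case unfolding generated_def using *(2) by (intro mpv.span_base) blast
  qed
  show "f * g \<in> generated G (i + j)"
    using g
  proof (induction rule: homog_induct)
    case (single m c)
    then show ?case using mpv.subspace_scale[OF sub monom[OF single], of c]
      by (simp add: single_eq_mconst_monom[of m c] mult.left_commute)
  qed (use sub in \<open>auto simp: distrib_left mpv.subspace_def\<close>)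
qed

text \<open>The bridge from generating sets to the exact sequence: one more generator, be it a
  variable or a coefficient, is one application of \<open>adjoin\<close>.\<close>

lemma generated_insert:
  fixes u :: "('k::field) arc_poly"
  shows "generated (insert (u, w) G) = adjoin (generated G) u w"
proof
  fix j
  let ?S = "{monom m * g | m g w i. (g, w) \<in> G \<and> m \<in> monoms i \<and> i + w = j}"
  show "generated (insert (u, w) G) j = adjoin (generated G) u w j"
  proof (cases "w \<le> j")
    case True
    have "{monom m * g | m g w' i. (g, w') \<in> insert (u, w) G \<and> m \<in> monoms i \<and> i + w' = j} =
        ?S \<union> (*) u ` monom ` monoms (j - w)" (is "?L = ?R")
    proof
      show "?L \<subseteq> ?R" by (auto simp: mult.commute) 
      show "?R \<subseteq> ?L"
      proof (intro Un_least image_subsetI)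
        fix f :: "'k arc_poly" assume "f \<in> monom ` monoms (j - w)"
        then obtain m where "f = monom m" "m \<in> monoms (j - w)" by blast
        then have "u * f = monom m * u \<and> (u, w) \<in> insert (u, w) G \<and> m \<in> monoms (j - w) \<and> (j - w) + w = j"
          using True by (simp add: mult.commute)
        then show "u * f \<in> ?L" by blast
      qed blast
    qed
    then show ?thesis using True
      unfolding generated_def adjoin_def homog_eq_span by (simp only: mpv.span_Un mpv_span_mult_image) (simp, blast)
  next
    case False
    then have "{monom m * g | m g w' i. (g, w') \<in> insert (u, w) G \<and> m \<in> monoms i \<and> i + w' = j} = ?S"
      by auto
    then show ?thesis using False by (simp add: generated_def adjoin_def)
  qed
qed

end

section \<open>The coefficients of a product of arcs\<close>

text \<open>With \<open>H\<close> the homogeneous pieces this gives homogeneity of the coefficients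
  of a product of arcs, with a constant \<open>H\<close> it gives membership in a polynomial
  subring.\<close>

lemma fps_prod_in_family:
  fixes F :: "'s \<Rightarrow> ('v, 'k::comm_ring_1) mpol fps" and H :: "nat \<Rightarrow> ('v, 'k) mpol set"
  assumes "\<And>s i. s \<in> A \<Longrightarrow> F s $ i \<in> H i"
    and "\<And>i. 0 \<in> H i" "1 \<in> H 0" "\<And>i f g. f \<in> H i \<Longrightarrow> g \<in> H i \<Longrightarrow> f + g \<in> H i"
    and "\<And>i j f g. f \<in> H i \<Longrightarrow> g \<in> H j \<Longrightarrow> f * g \<in> H (i + j)"
  shows "prod F A $ i \<in> H i"
  using assms(1)
proof (induction A arbitrary: i rule: infinite_finite_induct)
  case (insert s A)
  have sum: "sum f B \<in> H i" if "\<And>x. x \<in> B \<Longrightarrow> f x \<in> H i" for f and B :: "nat set"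
    using that by (induction B rule: infinite_finite_induct) (auto intro: assms)
  have "(\<Sum>j=0..i. F s $ j * prod F A $ (i - j)) \<in> H i"
  proof (rule sum)
    fix j assume "j \<in> {0..i}"
    then show "F s $ j * prod F A $ (i - j) \<in> H i"
      using assms(5)[OF insert.prems insert.IH, of s j "i - j"] insert.prems by simp
  qed
  then show ?case using insert.hyps by (simp add: fps_mult_nth)
qed (use assms in auto)

locale reduced_arcs =
  fixes n e :: nat
  assumes e_pos: "1 \<le> e" and e_le: "e \<le> n"
begin

definition pos_vars :: "(nat \<times> nat) set" where
  "pos_vars = {1..n} \<times> {0<..}"

sublocale weighted_variables pos_vars
proof
  show "finite {v \<in> pos_vars. snd v \<le> j}" for j :: nat
    by (rule finite_subset[of _ "{1..n} \<times> {..j}"]) (auto simp: pos_vars_def)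
qed (auto simp: pos_vars_def)

lemma mem_pos_vars: "(s, i) \<in> pos_vars \<longleftrightarrow> s \<in> {1..n} \<and> 0 < i"
  by (simp add: pos_vars_def)

text \<open>The arc through the rescaled point: the variable of weight zero is replaced by its
  value, 0 on the components through the point and 1 on the others, which leaves variables of
  positive weight only.\<close>

definition red_arc :: "nat \<Rightarrow> ('k::field) arc_poly fps" where
  "red_arc s = Abs_fps (\<lambda>i. if i = 0 then (if s \<le> e then 0 else 1) else mvar (s, i))"

definition red_coeff :: "nat \<Rightarrow> ('k::field) arc_poly" where
  "red_coeff l = (\<Prod>s\<in>{1..n}. red_arc s) $ l"

text \<open>For \<open>s \<le> e\<close>, killing these variables gives \<open>red_arc s\<close>
  order at least \<open>a s\<close>. The bounds for \<open>s > e\<close> may vary as well, so that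
  all variables below a given weight can be killed.\<close>

definition low_vars :: "(nat \<Rightarrow> nat) \<Rightarrow> (('k::field) arc_poly \<times> nat) set" where
  "low_vars a = {(mvar (s, i), i) | s i. s \<in> {1..n} \<and> 1 \<le> i \<and> i < a s}"

definition arc_gens :: "(nat \<Rightarrow> nat) \<Rightarrow> nat \<Rightarrow> (('k::field) arc_poly \<times> nat) set" where
  "arc_gens a N = low_vars a \<union> {(red_coeff l, l) | l. l < N}"

definition total_order :: "(nat \<Rightarrow> nat) \<Rightarrow> nat" where
  "total_order a = (\<Sum>s\<in>{1..e}. a s)"

lemma mvar_homog: "s \<in> {1..n} \<Longrightarrow> 1 \<le> i \<Longrightarrow> mvar (s, i) \<in> homog i"
  unfolding mvar_def by (rule homog_single) (auto simp: monoms_def mem_pos_vars)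

lemma one_homog: "1 \<in> homog 0"
  using homog_single[of 0 0 1] by (simp add: monoms_0)

lemma red_arc_homog: "s \<in> {1..n} \<Longrightarrow> red_arc s $ i \<in> homog i"
  using mpv.subspace_0[OF homog_subspace] one_homog by (auto simp: red_arc_def intro!: mvar_homog)

lemma prod_red_arc_homog: "A \<subseteq> {1..n} \<Longrightarrow> prod red_arc A $ i \<in> homog i"
  by (rule fps_prod_in_family)
    (auto simp del: One_nat_def intro: red_arc_homog one_homog homog_mult mpv.subspace_0[OF homog_subspace] mpv.subspace_add[OF homog_subspace])

lemma red_coeff_homog: "red_coeff l \<in> homog l"
  unfolding red_coeff_def by (rule prod_red_arc_homog) simp

lemma low_vars_homog: "(g, w) \<in> low_vars a \<Longrightarrow> g \<in> homog w"
  by (auto simp: low_vars_def intro: mvar_homog)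

lemma arc_gens_homog: "(g, w) \<in> arc_gens a N \<Longrightarrow> g \<in> homog w"
  by (auto simp: arc_gens_def intro: low_vars_homog red_coeff_homog)

lemma low_vars_ideal: "graded_ideal (generated (low_vars a))"
  by (intro graded_ideal_generated low_vars_homog)

lemma arc_gens_ideal: "graded_ideal (generated (arc_gens a N))"
  by (intro graded_ideal_generated arc_gens_homog)

text \<open>An ideal generated by variables is a monomial ideal, so membership is tested one
  monomial at a time.\<close>

lemma mem_generated_low_vars:
  "f \<in> generated (low_vars a) j \<longleftrightarrow>
     f \<in> homog j \<and> (\<forall>m\<in>keys f. \<exists>s i. (s, i) \<in> keys m \<and> s \<in> {1..n} \<and> 1 \<le> i \<and> i < a s)"
  (is "?L \<longleftrightarrow> _ \<and> (\<forall>m\<in>keys f. ?low m)")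
proof (intro iffI conjI)
  let ?S = "{f \<in> homog j. \<forall>m\<in>keys f. ?low m} :: (nat \<times> nat, 'a) mpol set"
  assume f: ?L
  have sub: "mpv.subspace ?S"
  proof (rule mpv.subspaceI)
    show "f + g \<in> ?S" if "f \<in> ?S" "g \<in> ?S" for f g
      using that keys_add[of f g] mpv.subspace_add[OF homog_subspace[of j], of f g] by blast
    show "mconst c * f \<in> ?S" if "f \<in> ?S" for c f
      using that mpv.subspace_scale[OF homog_subspace[of j], of f c] by (auto simp: in_keys_iff)
  qed (use mpv.subspace_0[OF homog_subspace] in auto)
  have "generated (low_vars a) j \<subseteq> ?S"
    unfolding generated_def
  proof (rule mpv.span_minimal[OF _ sub], clarify)
    fix m and g :: "(nat \<times> nat, 'a) mpol" and w i
    assume *: "(g, w) \<in> low_vars a" "m \<in> monoms i"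
    then obtain s where g: "g = mvar (s, w)" "s \<in> {1..n}" "1 \<le> w" "w < a s" by (auto simp: low_vars_def)
    have "monom m * g \<in> homog (i + w)" using * low_vars_homog by (intro homog_mult homog_single)
    moreover have "(s, w) \<in> keys m'" if "m' \<in> keys (monom m * g)" for m'
      using that by (auto simp: g mvar_def mult_single in_keys_iff lookup_add split: if_splits)
    ultimately show "monom m * g \<in> homog (i + w) \<and> (\<forall>m'\<in>keys (monom m * g). ?low m')"
      using g by blast
  qed
  then show "f \<in> homog j" "\<forall>m\<in>keys f. ?low m" using f by auto
next
  assume f: "f \<in> homog j \<and> (\<forall>m\<in>keys f. ?low m)"
  have "(\<Sum>m\<in>keys f. mconst (lookup f m) * monom m) \<in> generated (low_vars a) j"
    unfolding generated_def
  proof (intro mpv.span_sum mpv.span_scale mpv.span_base)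
    fix m assume m: "m \<in> keys f"
    then obtain s i where si: "(s, i) \<in> keys m" "s \<in> {1..n}" "1 \<le> i" "i < a s" using f by blast
    define m' where "m' = m - single (s, i) 1"
    have mm: "m = m' + single (s, i) 1"
      using si(1) unfolding m'_def
      by (intro poly_mapping_eqI) (auto simp: lookup_add lookup_minus lookup_single in_keys_iff when_def)
    have "m \<in> monoms j" using f m by (auto simp: homog_def)
    then have "m' \<in> monoms (weight m')" "weight m' + i = j"
      using mm by (auto simp: monoms_def in_keys_iff lookup_add subset_iff)
    moreover have "monom m = monom m' * mvar (s, i)"
      by (simp add: mm mvar_def mult_single)
    moreover have "(mvar (s, i), i) \<in> low_vars a" using si by (auto simp: low_vars_def)
    ultimately show "monom m \<in> {monom m * g | m g w i. (g, w) \<in> low_vars a \<and> m \<in> monoms i \<and> i + w = j}"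
      by blast
  qed
  then show ?L by (simp flip: single_eq_mconst_monom mpol_expand)
qed

text \<open>A variable is a nonzerodivisor modulo an ideal generated by other variables.\<close>

lemma low_vars_colon:
  assumes r: "r \<in> {1..n}" and "1 \<le> a r"
  shows "colon (generated (low_vars a)) (mvar (r, a r)) (a r) = 
         (generated (low_vars a) :: nat \<Rightarrow> ('k::field) arc_poly set)"
proof (intro ext antisym)
  fix j
  have u: "(mvar (r, a r) :: 'k arc_poly) \<in> homog (a r)" by (rule mvar_homog) fact+
  show "generated (low_vars a) j \<subseteq> colon (generated (low_vars a)) (mvar (r, a r) :: 'k arc_poly) (a r) j"
    by (rule colon_superset[OF low_vars_ideal u])
  show "colon (generated (low_vars a)) (mvar (r, a r) :: 'k arc_poly) (a r) j \<subseteq> generated (low_vars a) j"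
  proof
    fix b :: "'k arc_poly" assume b: "b \<in> colon (generated (low_vars a)) (mvar (r, a r)) (a r) j"
    let ?v = "single (r, a r) 1 :: nat \<times> nat \<Rightarrow>\<^sub>0 nat"
    \<comment> \<open>Multiplication by a variable shifts exponents, so the coefficients of
      \<open>b\<close> can be read off from the product.\<close>
    have look: "lookup (mvar (r, a r) * b) (?v + m) = lookup b m" for m
      by (induction b rule: poly_mapping_induct_add)
        (auto simp: mvar_def mult_single lookup_single distrib_left lookup_add when_def)
    have "\<exists>s i. (s, i) \<in> keys m \<and> s \<in> {1..n} \<and> 1 \<le> i \<and> i < a s" if "m \<in> keys b" for m
    proof -
      have "?v + m \<in> keys (mvar (r, a r) * b)" using that by (auto simp: in_keys_iff look simp del: One_nat_def)
      then obtain s i where si: "(s, i) \<in> keys (?v + m)" "s \<in> {1..n}" "1 \<le> i" "i < a s"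
        using b by (auto simp: colon_def mem_generated_low_vars)
      \<comment> \<open>The low variable found has \<open>i < a s\<close>, so it is not
        \<open>(r, a r)\<close> and must already occur in \<open>m\<close>.\<close>
      then have "(s, i) \<in> keys m" by (auto simp: in_keys_iff lookup_add lookup_single when_def split: if_splits)
      then show ?thesis using si by blast
    qed
    then show "b \<in> generated (low_vars a) j" using b by (auto simp: mem_generated_low_vars colon_def)
  qed
qed

lemma low_vars_Suc:
  "r \<in> {1..n} \<Longrightarrow> 1 \<le> a r \<Longrightarrow> low_vars (a(r := Suc (a r))) = insert (mvar (r, a r), a r) (low_vars a)"
  unfolding low_vars_def by (auto simp: less_Suc_eq split: if_splits)

lemma hilb_low_vars_Suc:
  fixes a :: "nat \<Rightarrow> nat"
  assumes r: "r \<in> {1..n}" "1 \<le> a r"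
  shows "hilb (generated (low_vars (a(r := Suc (a r)))) :: nat \<Rightarrow> ('k::field) arc_poly set) = 
    (1 - fps_X ^ a r) * hilb (generated (low_vars a) :: nat \<Rightarrow> 'k arc_poly set)"
proof -
  have u: "(mvar (r, a r) :: 'k arc_poly) \<in> homog (a r)" by (rule mvar_homog) fact+
  show ?thesis
    using hilb_exact[OF low_vars_ideal u, of a]
    by (simp add: low_vars_Suc[of r a, OF r] generated_insert low_vars_colon[of r a, OF r] algebra_simps)
qed

lemma arc_gens_Suc_order:
  "r \<in> {1..n} \<Longrightarrow> 1 \<le> a r \<Longrightarrow> arc_gens (a(r := Suc (a r))) N = insert (mvar (r, a r), a r) (arc_gens a N)"
  by (simp add: arc_gens_def low_vars_Suc)

lemma arc_gens_Suc: "arc_gens a (Suc N) = insert (red_coeff N, N) (arc_gens a N)"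
  by (auto simp: arc_gens_def less_Suc_eq)

text \<open>Modulo the low variables, orders add and leading coefficients multiply. An arc with
  \<open>s \<le> e\<close> contributes order \<open>a s\<close> and leading coefficient
  \<open>mvar (s, a s)\<close>, one with \<open>s > e\<close> order 0 and constant term 1.\<close>

lemma prod_red_arc_order:
  assumes "A \<subseteq> {1..n}" "\<And>s. s \<in> {1..n} \<Longrightarrow> 1 \<le> a s"
  defines "\<alpha> \<equiv> \<Sum>s\<in>A \<inter> {1..e}. a s"
  shows "(\<forall>l<\<alpha>. prod red_arc A $ l \<in> (generated (low_vars a) l :: ('k::field) arc_poly set)) \<and>
    prod red_arc A $ \<alpha> - (\<Prod>s\<in>A \<inter> {1..e}. mvar (s, a s)) \<in> (generated (low_vars a) \<alpha> :: 'k arc_poly set)"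
proof -
  let ?M = "generated (low_vars a) :: nat \<Rightarrow> 'k arc_poly set"
  note gi = graded_idealD[OF low_vars_ideal[of a]]
  have zero: "0 \<in> ?M j" for j using mpv.subspace_0[OF gi(1)] .
  have gi': "g * f \<in> ?M (j + i)" if "f \<in> ?M i" "g \<in> homog j" for f g i j
    using gi(3)[OF that] by (simp add: mult.commute add.commute)
  have step: "(\<forall>l<\<beta> + \<gamma>. (F * G) $ l \<in> ?M l) \<and> (F * G) $ (\<beta> + \<gamma>) - u * v \<in> ?M (\<beta> + \<gamma>)"
    if F: "\<And>i. F $ i \<in> homog i" "\<forall>l<\<beta>. F $ l \<in> ?M l" "F $ \<beta> - u \<in> ?M \<beta>"
      and G: "\<And>i. G $ i \<in> homog i" "\<forall>l<\<gamma>. G $ l \<in> ?M l" "G $ \<gamma> - v \<in> ?M \<gamma>" "v \<in> homog \<gamma>"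
    for F G and u v :: "'k arc_poly" and \<beta> \<gamma>
  proof (intro conjI allI impI)
    have tm: "F $ i * G $ (l - i) \<in> ?M l" if "i \<le> l" "i < \<beta> \<or> l - i < \<gamma>" for i l
      using that gi(3)[OF F(2)[rule_format, of i] G(1), of "l - i"] gi'[OF G(2)[rule_format, of "l - i"] F(1), of i] by auto
    fix l assume l: "l < \<beta> + \<gamma>"
    show "(F * G) $ l \<in> ?M l"
      unfolding fps_mult_nth using l by (intro mpv.subspace_sum[OF gi(1)] tm) auto
  next
    \<comment> \<open>Away from \<open>i = \<beta>\<close> one of the two indices lies below its
      order bound.\<close>
    have tm: "F $ i * G $ (\<beta> + \<gamma> - i) \<in> ?M (\<beta> + \<gamma>)" if "i \<in> {0..\<beta> + \<gamma>} - {\<beta>}" for i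
      using that gi(3)[OF F(2)[rule_format, of i] G(1), of "\<beta> + \<gamma> - i"]
        gi'[OF G(2)[rule_format, of "\<beta> + \<gamma> - i"] F(1), of i] by (cases "i < \<beta>") auto
    have "(F * G) $ (\<beta> + \<gamma>) = F $ \<beta> * G $ \<gamma> + (\<Sum>i\<in>{0..\<beta> + \<gamma>} - {\<beta>}. F $ i * G $ (\<beta> + \<gamma> - i))"
      unfolding fps_mult_nth by (subst sum.remove[of _ \<beta>]) auto
    then have "(F * G) $ (\<beta> + \<gamma>) - u * v = (F $ \<beta> - u) * v + F $ \<beta> * (G $ \<gamma> - v) + 
        (\<Sum>i\<in>{0..\<beta> + \<gamma>} - {\<beta>}. F $ i * G $ (\<beta> + \<gamma> - i))"
      by (simp add: algebra_simps)
    also have "\<dots> \<in> ?M (\<beta> + \<gamma>)"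
      by (intro mpv.subspace_add[OF gi(1)] mpv.subspace_sum[OF gi(1)] tm gi(3) gi' F G)
    finally show "(F * G) $ (\<beta> + \<gamma>) - u * v \<in> ?M (\<beta> + \<gamma>)" .
  qed
  have "finite A" using assms(1) finite_subset by blast
  then show ?thesis using assms(1) unfolding \<alpha>_def
  proof (induction A)
    case empty
    then show ?case by (simp add: zero)
  next
    case (insert s A)
    let ?\<gamma> = "\<Sum>s\<in>A \<inter> {1..e}. a s"
    have s: "s \<in> {1..n}" and A: "A \<subseteq> {1..n}" using insert.prems by auto
    have v: "(\<Prod>s\<in>B. mvar (s, a s) :: 'k arc_poly) \<in> homog (\<Sum>s\<in>B. a s)" if "B \<subseteq> A" for B
      using that A assms(2)
      by (induction B rule: infinite_finite_induct) (auto intro!: homog_mult mvar_homog one_homog)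
    note IH = conjunct1[OF insert.IH[OF A]] conjunct2[OF insert.IH[OF A]]
    note hom = red_arc_homog[OF s] prod_red_arc_homog[OF A] v[of "A \<inter> {1..e}", OF Int_lower1]
    show ?case
    proof (cases "s \<le> e")
      case True
      have eq: "insert s A \<inter> {1..e} = insert s (A \<inter> {1..e})" using True s by auto
      have "(\<forall>l<a s + ?\<gamma>. (red_arc s * prod red_arc A) $ l \<in> ?M l) \<and>
        (red_arc s * prod red_arc A) $ (a s + ?\<gamma>) - mvar (s, a s) * (\<Prod>s\<in>A \<inter> {1..e}. mvar (s, a s)) \<in> ?M (a s + ?\<gamma>)"
      proof (rule step)
        show "\<forall>l<a s. red_arc s $ l \<in> ?M l"
        proof (intro allI impI)
          fix l assume "l < a s"
          moreover from this have "(mvar (s, l) :: 'k arc_poly, l) \<in> low_vars a" if "l \<noteq> 0"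
            using s that by (auto simp: low_vars_def)
          ultimately show "red_arc s $ l \<in> ?M l"
            using s True zero[of 0] generated_base[of "mvar (s, l) :: 'k arc_poly" l "low_vars a"] 
            by (cases "l = 0") (auto simp: red_arc_def)
        qed
        show "red_arc s $ a s - mvar (s, a s) \<in> ?M (a s)"
          using assms(2)[OF s] zero by (auto simp: red_arc_def)
      qed (fact hom IH)+
      then show ?thesis unfolding eq using insert.hyps by simp
    next
      case False
      have eq: "insert s A \<inter> {1..e} = A \<inter> {1..e}" using False by auto
      have "(\<forall>l<0 + ?\<gamma>. (red_arc s * prod red_arc A) $ l \<in> ?M l) \<and>
        (red_arc s * prod red_arc A) $ (0 + ?\<gamma>) - 1 * (\<Prod>s\<in>A \<inter> {1..e}. mvar (s, a s)) \<in> ?M (0 + ?\<gamma>)"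
      proof (rule step)
        show "red_arc s $ 0 - 1 \<in> ?M 0" using False zero by (simp add: red_arc_def)
      qed (fact hom IH | simp)+
      then show ?thesis unfolding eq using insert.hyps by simp
    qed
  qed
qed

lemma red_coeff_order:
  assumes "\<And>s. s \<in> {1..n} \<Longrightarrow> 1 \<le> a s"
  shows "l < total_order a \<Longrightarrow> red_coeff l \<in> generated (low_vars a) l"
    and "red_coeff (total_order a) - (\<Prod>s\<in>{1..e}. mvar (s, a s)) \<in> generated (low_vars a) (total_order a)"
proof -
  have "{1..n} \<inter> {1..e} = {1..e}" using e_le by auto
  then show "l < total_order a \<Longrightarrow> red_coeff l \<in> generated (low_vars a) l"
    and "red_coeff (total_order a) - (\<Prod>s\<in>{1..e}. mvar (s, a s)) \<in> generated (low_vars a) (total_order a)"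
    using prod_red_arc_order[of "{1..n}" a] assms by (auto simp: red_coeff_def total_order_def)
qed

text \<open>The start of the induction: below the total order the coefficients already lie in the
  monomial ideal.\<close>

lemma generated_arc_gens_base:
  assumes "\<And>s. s \<in> {1..n} \<Longrightarrow> 1 \<le> a s"
  shows "generated (arc_gens a (total_order a)) = 
    (generated (low_vars a) :: nat \<Rightarrow> ('k::field) arc_poly set)"
proof (intro ext antisym)
  fix j
  show "generated (low_vars a) j \<subseteq> generated (arc_gens a (total_order a)) j"
    by (rule generated_mono) (simp add: arc_gens_def)
  let ?M = "generated (low_vars a) :: nat \<Rightarrow> 'k arc_poly set"
  note gi = graded_idealD[OF low_vars_ideal[of a]]
  show "generated (arc_gens a (total_order a)) j \<subseteq> ?M j"
    unfolding generated_def[of "arc_gens a (total_order a)"]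
  proof (rule mpv.span_minimal[OF _ gi(1)], clarify)
    fix m and g :: "'k arc_poly" and w i
    assume *: "(g, w) \<in> arc_gens a (total_order a)" "m \<in> monoms i"
    then have "g \<in> generated (low_vars a) w"
      using red_coeff_order(1)[OF assms] generated_base by (auto simp: arc_gens_def)
    then show "monom m * g \<in> ?M (i + w)"
      using graded_idealD(3)[OF low_vars_ideal, of g a w "monom m" i] homog_single[OF *(2), of "1 :: 'k"]
      by (simp add: mult.commute[of g] add.commute[of w])
  qed
qed

lemma hilb_arc_gens:
  assumes "\<And>s. s \<in> {1..n} \<Longrightarrow> 1 \<le> a s" "total_order a \<le> N"
  shows "hilb (generated (arc_gens a N) :: nat \<Rightarrow> ('k::field) arc_poly set) =
    hilb (generated (low_vars a) :: nat \<Rightarrow> 'k arc_poly set) * (\<Prod>j\<in>{total_order a..<N}. 1 - fps_X ^ j)"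
  using assms
proof (induction "N - total_order a" arbitrary: a N)
  case 0
  then have "N = total_order a" by simp
  show ?case unfolding \<open>N = total_order a\<close> by (subst generated_arc_gens_base[OF 0(2)]) simp_all
next
  case (Suc k)
  let ?I = "\<lambda>a N. generated (arc_gens a N) :: nat \<Rightarrow> 'k arc_poly set"
  let ?H = "hilb (generated (low_vars a) :: nat \<Rightarrow> 'k arc_poly set)"
  let ?t = "total_order a"
  obtain N' where N: "N = Suc N'" and N': "?t \<le> N'" "k = N' - ?t" using Suc.hyps(2) by (cases N) auto
  \<comment> \<open>Chosen to serve all \<open>r\<close> at once: adjoining
    \<open>mvar (r, a r)\<close> raises the total order by one, which drops the factor with exponent
    \<open>?t\<close>, and multiplies the series of the monomial ideal by 1 - t^w with
    \<open>w = a r\<close>.\<close>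
  let ?C = "?H * (\<Prod>j\<in>{Suc ?t..<N}. 1 - fps_X ^ j)"
  have ivl: "{?t..<N} = insert ?t {Suc ?t..<N}" "{?t..<N} = insert N' {?t..<N'}" using N N' by auto
  have target: "?H * (\<Prod>j\<in>{?t..<N}. 1 - fps_X ^ j) = (1 - fps_X ^ ?t) * ?C"
    by (simp add: ivl(1) mult.left_commute)
  show ?case
  proof (rule fps_ext, rule antisym)
    fix j
    define us where "us = map (\<lambda>s. (mvar (s, a s) :: 'k arc_poly, a s)) [1..<Suc e]"
    have sum: "sum_list (map snd us) = ?t"
      unfolding us_def total_order_def by (simp add: comp_def interv_sum_list_conv_sum_set_nat atLeastLessThanSuc_atLeastAtMost del: upt_Suc)
    have prod: "prod_list (map fst us) = (\<Prod>s\<in>{1..e}. mvar (s, a s))"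
      using prod.distinct_set_conv_list[of "[1..<Suc e]" "\<lambda>s. mvar (s, a s) :: 'k arc_poly"]
      by (simp add: us_def comp_def atLeastLessThanSuc_atLeastAtMost del: upt_Suc)
    have "hilb (?I a N) $ j \<le> ((1 - fps_X ^ sum_list (map snd us)) * ?C) $ j"
    proof (rule hilb_le_of_product)
      show "graded_ideal (?I a N)" by (rule arc_gens_ideal)
      \<comment> \<open>The coefficient belongs to the ideal because \<open>?t < N\<close>, and so
        does its difference from the product of the leading variables; hence the product does
        too.\<close>
      have "red_coeff ?t \<in> ?I a N ?t"
        by (rule generated_base) (use N N' in \<open>auto simp: arc_gens_def\<close>)
      moreover have "red_coeff ?t - (\<Prod>s\<in>{1..e}. mvar (s, a s)) \<in> ?I a N ?t"
        by (rule subsetD[OF generated_mono red_coeff_order(2)[OF Suc.prems(1)]]) (auto simp: arc_gens_def)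
      ultimately have "red_coeff ?t - (red_coeff ?t - (\<Prod>s\<in>{1..e}. mvar (s, a s))) \<in> ?I a N ?t"
        by (rule mpv.subspace_diff[OF graded_idealD(1)[OF arc_gens_ideal]])
      then show "prod_list (map fst us) \<in> ?I a N (sum_list (map snd us))" by (simp add: sum prod)
    next
      fix u w assume "(u, w) \<in> set us"
      then obtain r where r: "u = mvar (r, a r)" "w = a r" "r \<in> {1..e}" by (auto simp: us_def less_Suc_eq_le)
      have rn: "r \<in> {1..n}" using r e_le by auto
      have ar: "1 \<le> a r" using Suc.prems(1)[OF rn] .
      show "u \<in> homog w" unfolding r by (rule mvar_homog[OF rn ar])
      let ?b = "a(r := Suc (a r))"
      have "total_order ?b = Suc ?t"
        using r(3) unfolding total_order_def by (simp add: sum.remove[of _ r])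
      then have "hilb (?I ?b N) = hilb (generated (low_vars ?b) :: nat \<Rightarrow> 'k arc_poly set) * (\<Prod>j\<in>{Suc ?t..<N}. 1 - fps_X ^ j)"
        using Suc.hyps(1)[of N ?b] Suc.prems(1) N N' by auto
      also have "\<dots> = (1 - fps_X ^ w) * ?C"
        by (subst hilb_low_vars_Suc[of r a, OF rn ar]) (simp add: r mult.assoc)
      finally show "hilb (adjoin (?I a N) u w) $ i \<le> ((1 - fps_X ^ w) * ?C) $ i" for i
        by (simp add: r(1,2) arc_gens_Suc_order[of r a, OF rn ar] generated_insert)
    qed
    then show "hilb (?I a N) $ j \<le> (?H * (\<Prod>j\<in>{?t..<N}. 1 - fps_X ^ j)) $ j"
      by (simp only: target sum)
    have "((1 - fps_X ^ N') * hilb (?I a N')) $ j \<le> hilb (?I a N) $ j"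
      unfolding N arc_gens_Suc generated_insert by (rule hilb_adjoin_ge[OF arc_gens_ideal red_coeff_homog])
    moreover have "hilb (?I a N') = ?H * (\<Prod>j\<in>{?t..<N'}. 1 - fps_X ^ j)"
      using Suc.hyps(1)[of N' a] Suc.prems(1) N' by blast
    ultimately show "(?H * (\<Prod>j\<in>{?t..<N}. 1 - fps_X ^ j)) $ j \<le> hilb (?I a N) $ j"
      by (simp add: ivl(2) mult.left_commute)
  qed
qed

end

section \<open>Series identities and monomial bases\<close>

definition fps_cong :: "nat \<Rightarrow> 'a::comm_ring_1 fps \<Rightarrow> 'a fps \<Rightarrow> bool" where
  "fps_cong N F G \<longleftrightarrow> (\<forall>j<N. F $ j = G $ j)"

lemma fps_cong_refl: "fps_cong N F F"
  by (simp add: fps_cong_def)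

lemma fps_cong_mult: "fps_cong N F F' \<Longrightarrow> fps_cong N G G' \<Longrightarrow> fps_cong N (F * G) (F' * G')"
  unfolding fps_cong_def fps_mult_nth by (auto intro!: sum.cong)

lemma fps_cong_power: "fps_cong N F F' \<Longrightarrow> fps_cong N (F ^ k) (F' ^ k)"
  by (induction k) (auto intro: fps_cong_mult fps_cong_refl)

text \<open>The factors from index \<open>k\<close> on are congruent to 1 modulo t^(e+k), so partial
  products are stable to that precision.\<close>

lemma prodinf_geometric:
  fixes e :: nat
  assumes "1 \<le> e"
  defines "a \<equiv> (\<lambda>i. 1 / (1 - fps_X ^ (e + i)) :: rat fps)"
  shows "fps_cong (e + k) (prod a {..<k}) (prodinf a)"
proof -
  have one: "fps_cong (e + i) (a i) 1" for i
  proof -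
    have "a i * (1 - fps_X ^ (e + i)) = 1"
      unfolding a_def using assms(1) by (simp add: fps_divide_unit inverse_mult_eq_1)
    then have "a i = 1 + a i * fps_X ^ (e + i)" by (simp add: algebra_simps)
    then have "a i $ j = (1 + a i * fps_X ^ (e + i)) $ j" for j by simp
    then show ?thesis by (simp add: fps_cong_def fps_X_power_mult_right_nth)
  qed
  have stable: "fps_cong (e + k) (prod a {..<m}) (prod a {..<k})" if "k \<le> m" for k m
    using that
  proof (induction m rule: dec_induct)
    case (step m)
    have "fps_cong (e + k) (prod a {..<m} * a m) (prod a {..<k} * 1)"
      using one[of m] step by (intro fps_cong_mult) (auto simp: fps_cong_def)
    then show ?case by simp
  qed (rule fps_cong_refl)
  \<comment> \<open>The coefficient of t^j is read off from the \<open>j\<close>-th partial product,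
    which is stable there because \<open>j < e + j\<close>.\<close>
  define L where "L = Abs_fps (\<lambda>j. prod a {..<j} $ j)"
  have L: "prod a {..<m} $ j = L $ j" if "j < e + m" for j m
  proof (cases "j \<le> m")
    case True
    then show ?thesis using stable[OF True] assms(1) by (simp add: fps_cong_def L_def)
  next
    case False
    then show ?thesis using stable[of m j] that by (simp add: fps_cong_def L_def)
  qed
  have "(\<lambda>m. \<Prod>i\<le>m. a i) \<longlonglongrightarrow> L"
  proof (rule tendsto_fpsI)
    fix j
    show "eventually (\<lambda>m. (\<Prod>i\<le>m. a i) $ j = L $ j) sequentially"
      using eventually_ge_at_top[of j]
      by eventually_elim (use assms(1) in \<open>simp add: lessThan_Suc_atMost[symmetric] L del: prod.lessThan_Suc\<close>)
  qed
  \<comment> \<open>The constant term shows that the limit is nonzero, as \<open>has_prod\<close>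
    demands.\<close>
  moreover have "L $ 0 = 1" by (simp add: L_def)
  then have "L \<noteq> 0" by auto
  ultimately have "a has_prod L" by (simp add: has_prod_def raw_has_prod_def)
  then have "prodinf a = L" by (rule has_prod_unique[symmetric])
  then show ?thesis using L by (simp add: fps_cong_def)
qed

definition rat_fps :: "int fps \<Rightarrow> rat fps" where
  "rat_fps F = Abs_fps (\<lambda>j. of_int (F $ j))"

lemma rat_fps_simps [simp]:
  "rat_fps (F * G) = rat_fps F * rat_fps G" "rat_fps 1 = 1" "rat_fps (F - G) = rat_fps F - rat_fps G"
  "rat_fps fps_X = fps_X"
  by (auto simp: rat_fps_def fps_eq_iff fps_mult_nth fps_X_def)

lemma rat_fps_power [simp]: "rat_fps (F ^ k) = rat_fps F ^ k"
  by (induction k) simp_all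

lemma rat_fps_prod [simp]: "rat_fps (prod F A) = (\<Prod>i\<in>A. rat_fps (F i))"
  by (induction A rule: infinite_finite_induct) simp_all

section \<open>The Hilbert series of the reduced arc algebra and a monomial basis in each
  weight\<close>

context reduced_arcs
begin

text \<open>Raising the bounds of the \<open>n\<close> arcs one after another kills the
  \<open>n\<close> variables of weight \<open>p\<close>, each at the cost of one factor.\<close>

lemma hilb_low_vars_step:
  assumes "1 \<le> p"
  shows "hilb (generated (low_vars (\<lambda>_. Suc p)) :: nat \<Rightarrow> ('k::field) arc_poly set) =
    (1 - fps_X ^ p) ^ n * hilb (generated (low_vars (\<lambda>_. p)) :: nat \<Rightarrow> 'k arc_poly set)"
proof -
  let ?H = "\<lambda>a. hilb (generated (low_vars a) :: nat \<Rightarrow> 'k arc_poly set)"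
  let ?a = "\<lambda>A s. if s \<in> A then Suc p else p"
  have "?H (?a A) = (1 - fps_X ^ p) ^ card A * ?H (\<lambda>_. p)" if "A \<subseteq> {1..n}" for A
  proof -
    have "finite A" using that finite_subset by blast
    then show ?thesis using that
    proof (induction A)
      case (insert r A)
      have "?a (insert r A) = (?a A)(r := Suc (?a A r))" using insert.hyps by auto
      moreover have "?H ((?a A)(r := Suc (?a A r))) = (1 - fps_X ^ ?a A r) * ?H (?a A)"
        by (rule hilb_low_vars_Suc) (use insert assms in auto)
      moreover have "?H (?a A) = (1 - fps_X ^ p) ^ card A * ?H (\<lambda>_. p)"
        using insert by blast
      ultimately show ?case using insert.hyps by (simp only: card_insert_disjoint power_Suc) simp
    qed simp
  qed
  from this[of "{1..n}"] have "?H (?a {1..n}) = (1 - fps_X ^ p) ^ n * ?H (\<lambda>_. p)" by simp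
  moreover have "low_vars (?a {1..n}) = (low_vars (\<lambda>_. Suc p) :: ('k arc_poly \<times> nat) set)"
    unfolding low_vars_def by auto
  ultimately show ?thesis by simp
qed

lemma hilb_low_vars_prod:
  assumes "1 \<le> p"
  shows "hilb (generated (low_vars (\<lambda>_. p)) :: nat \<Rightarrow> ('k::field) arc_poly set) =
    (\<Prod>i\<in>{1..<p}. 1 - fps_X ^ i) ^ n * hilb (generated (low_vars (\<lambda>_. 1)) :: nat \<Rightarrow> 'k arc_poly set)"
  using assms
proof (induction p rule: dec_induct)
  case (step p)
  have "{1..<Suc p} = insert p {1..<p}" using step by auto
  then show ?case
    by (subst hilb_low_vars_step) (use step in \<open>simp_all add: power_mult_distrib\<close>)
qed simp

text \<open>A nonconstant monomial of weight below \<open>p\<close> contains a variable of weight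
  below \<open>p\<close>, so only constants survive. Together with \<open>hilb_low_vars_prod\<close>
  this determines the series of the polynomial ring modulo t^p.\<close>

lemma hilb_low_vars_coeff:
  assumes "j < p"
  shows "hilb (generated (low_vars (\<lambda>_. p)) :: nat \<Rightarrow> ('k::field) arc_poly set) $ j = (if j = 0 then 1 else 0)"
proof (cases "j = 0")
  case False
  have "\<exists>s i. (s, i) \<in> keys m \<and> s \<in> {1..n} \<and> 1 \<le> i \<and> i < p" if m: "m \<in> monoms j" for m
  proof -
    have "m \<noteq> 0" using m False by (auto simp: monoms_def)
    then obtain s i where v: "(s, i) \<in> keys m" by (metis keys_eq_empty ex_in_conv surj_pair)
    then have "s \<in> {1..n} \<and> 1 \<le> i \<and> i < p" using exponent_bounds[OF m v] assms by (simp add: mem_pos_vars)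
    then show ?thesis using v by blast
  qed
  then have "generated (low_vars (\<lambda>_. p)) j = (homog j :: 'k arc_poly set)"
    by (auto simp: mem_generated_low_vars homog_def subset_iff)
  then show ?thesis using False by (simp add: hilb_def)
next
  case True
  have h0: "homog 0 = mpv.span {1 :: 'k arc_poly}"
    by (simp add: homog_eq_span monoms_0)
  have "mpv.dim (homog 0 :: 'k arc_poly set) = 1"
    unfolding h0 by (subst mpv.dim_span_eq_card_independent) simp_all
  moreover have "generated (low_vars (\<lambda>_. p)) 0 = {0 :: 'k arc_poly}"
  proof -
    have "keys f = {}" if "f \<in> generated (low_vars (\<lambda>_. p)) 0" for f :: "'k arc_poly"
      using that monoms_0 by (fastforce simp: mem_generated_low_vars homog_def)
    then show ?thesis using mpv.subspace_0[OF graded_idealD(1)[OF low_vars_ideal]] by auto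
  qed
  moreover have "mpv.dim {0 :: 'k arc_poly} = 0"
    by (rule mpv.dim_unique[of "{}"]) (simp_all add: mpv.independent_empty)
  ultimately show ?thesis using True by (simp add: hilb_def)
qed

abbreviation series :: "rat fps" where
  "series \<equiv> (\<Prod>i=1..e - 1. 1 / (1 - fps_X ^ i)) ^ n * prodinf (\<lambda>i. 1 / (1 - fps_X ^ (e + i))) ^ (n - 1)"

text \<open>The series \<open>?M 1\<close> of the polynomial ring is eliminated between the formula
  for the equations up to \<open>N\<close> and the formula for killing the variables below
  \<open>N\<close>. The result is divided by finite products and then compared with
  \<open>series\<close> modulo t^N.\<close>

lemma hilb_arcs_coeff:
  assumes "e \<le> N" "j < N"
  shows "of_int (hilb (generated (arc_gens (\<lambda>_. 1) N) :: nat \<Rightarrow> ('k::field) arc_poly set) $ j) =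
    series $ j"
proof -
  let ?g = "\<lambda>i. 1 - fps_X ^ i :: rat fps"
  let ?H = "hilb (generated (arc_gens (\<lambda>_. 1) N) :: nat \<Rightarrow> 'k arc_poly set)"
  let ?M = "\<lambda>p. hilb (generated (low_vars (\<lambda>_. p)) :: nat \<Rightarrow> 'k arc_poly set)"
  let ?R = "prod ?g {1..<e}" and ?D = "prod ?g {e..<N}"
  have N: "1 \<le> N" using assms e_pos by linarith
  have "?H = ?M 1 * (\<Prod>j\<in>{e..<N}. 1 - fps_X ^ j)"
    using hilb_arc_gens[of "\<lambda>_. 1" N] assms(1) by (simp add: total_order_def)
  moreover have "?M N = (\<Prod>i\<in>{1..<N}. 1 - fps_X ^ i) ^ n * ?M 1"
    by (rule hilb_low_vars_prod[OF N])
  ultimately have "?H * (\<Prod>i\<in>{1..<N}. 1 - fps_X ^ i) ^ n = ?M N * (\<Prod>j\<in>{e..<N}. 1 - fps_X ^ j)"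
    by (simp add: mult_ac)
  then have "rat_fps (?H * (\<Prod>i\<in>{1..<N}. 1 - fps_X ^ i) ^ n) = rat_fps (?M N * (\<Prod>j\<in>{e..<N}. 1 - fps_X ^ j))"
    by (rule arg_cong)
  then have "rat_fps ?H * prod ?g {1..<N} ^ n = rat_fps (?M N) * ?D" by simp
  moreover have "prod ?g {1..<N} = ?R * ?D"
    using e_pos assms(1) by (simp add: prod.atLeastLessThan_concat)
  \<comment> \<open>One of the \<open>n\<close> copies of \<open>?D\<close> cancels against the
    contribution of the equations; this is why the factors from \<open>e\<close> on have the smaller
    exponent.\<close>
  moreover have "?D ^ n = ?D * ?D ^ (n - 1)" using e_pos e_le by (simp flip: power_Suc)
  ultimately have "?D * (rat_fps ?H * ?R ^ n * ?D ^ (n - 1)) = ?D * rat_fps (?M N)"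
    by (simp add: power_mult_distrib mult_ac)
  moreover have g0: "?g i $ 0 = 1" if "1 \<le> i" for i using that by simp
  have prod0: "prod ?g A $ 0 = 1" if "\<And>i. i \<in> A \<Longrightarrow> 1 \<le> i" for A
    using that by (induction A rule: infinite_finite_induct) (auto simp: Suc_le_eq)
  have D0: "?D $ 0 = 1" and R0: "?R $ 0 = 1" using e_pos by (auto intro!: prod0)
  then have "?D \<noteq> 0" by (metis fps_zero_nth zero_neq_one)
  ultimately have HE: "rat_fps ?H * ?R ^ n * ?D ^ (n - 1) = rat_fps (?M N)" by simp
  have inv: "prod (\<lambda>i. 1 / ?g i) A * prod ?g A = 1" if "\<And>i. i \<in> A \<Longrightarrow> 1 \<le> i" for A
    using that
  proof (induction A rule: infinite_finite_induct)
    case (insert i A)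
    have "?g i $ 0 \<noteq> 0" using g0[of i] insert.prems[of i] by simp
    then have "1 / ?g i * ?g i = 1" by (simp only: fps_divide_unit mult_1_left inverse_mult_eq_1 not_False_eq_True)
    moreover have "prod (\<lambda>i. 1 / ?g i) A * prod ?g A = 1" using insert by auto
    ultimately have "(1 / ?g i * ?g i) * (prod (\<lambda>i. 1 / ?g i) A * prod ?g A) = 1" by simp
    then show ?case using insert.hyps by (simp add: mult_ac)
  qed simp_all
  let ?R' = "prod (\<lambda>i. 1 / ?g i) {1..<e}" and ?D' = "prod (\<lambda>i. 1 / ?g i) {e..<N}"
  have "rat_fps ?H = rat_fps ?H * (?R' * ?R) ^ n * (?D' * ?D) ^ (n - 1)"
    using inv[of "{1..<e}"] inv[of "{e..<N}"] e_pos by simp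
  also have "\<dots> = rat_fps (?M N) * (?R' ^ n * ?D' ^ (n - 1))"
    unfolding HE[symmetric] by (simp add: power_mult_distrib mult_ac)
  finally have H: "rat_fps ?H = rat_fps (?M N) * (?R' ^ n * ?D' ^ (n - 1))" .
  have "?D' = prod (\<lambda>i. 1 / ?g (e + i)) {..<N - e}"
    using assms(1) prod.shift_bounds_nat_ivl[of "\<lambda>i. 1 / ?g i" 0 e "N - e"]
    by (simp add: lessThan_atLeast0 add.commute)
  then have "fps_cong N ?D' (prodinf (\<lambda>i. 1 / ?g (e + i)))"
    using prodinf_geometric[OF e_pos, of "N - e"] assms(1) by simp
  moreover have "fps_cong N (rat_fps (?M N)) 1"
    using hilb_low_vars_coeff[of _ N, where ?'k = 'k] by (auto simp: fps_cong_def rat_fps_def)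
  ultimately have "fps_cong N (rat_fps (?M N) * (?R' ^ n * ?D' ^ (n - 1)))
      (1 * (?R' ^ n * prodinf (\<lambda>i. 1 / ?g (e + i)) ^ (n - 1)))"
    by (intro fps_cong_mult fps_cong_power fps_cong_refl)
  then have "rat_fps ?H $ j = (?R' ^ n * prodinf (\<lambda>i. 1 / ?g (e + i)) ^ (n - 1)) $ j"
    using assms(2) unfolding H fps_cong_def by (simp only: mult_1_left)
  moreover have "{1..<e} = {1..e - 1}" using e_pos by auto
  ultimately show ?thesis unfolding rat_fps_def fps_nth_Abs_fps by (simp only:)
qed

definition arc_ideal :: "nat \<Rightarrow> ('k::field) arc_poly set" where
  "arc_ideal = generated {(red_coeff l, l) | l. True}"

lemma arc_ideal_eq: 
  assumes "j < N"
  shows "arc_ideal j = (generated (arc_gens (\<lambda>_. 1) N) j :: ('k::field) arc_poly set)"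
proof -
  have "low_vars (\<lambda>_. 1) = {}" by (auto simp: low_vars_def)
  then have "{monom m * g :: 'k arc_poly | m g w i. (g, w) \<in> {(red_coeff l, l) | l. True} \<and> m \<in> monoms i \<and> i + w = j} =
    {monom m * g | m g w i. (g, w) \<in> arc_gens (\<lambda>_. 1) N \<and> m \<in> monoms i \<and> i + w = j}"
    using assms by (fastforce simp: arc_gens_def)
  then show ?thesis by (simp only: arc_ideal_def generated_def)
qed

text \<open>\<open>B\<close> is a monomial basis of the quotient in weight \<open>j\<close>, and
  \<open>\<mu> b m\<close> is the coordinate of \<open>monom m\<close> along \<open>b\<close>.
  Reduction relations and dual functionals are listed separately because they reach the residue
  field by different substitutions.\<close>

lemma arc_basis:
  obtains B :: "(nat \<times> nat \<Rightarrow>\<^sub>0 nat) set" and \<mu> :: "(nat \<times> nat \<Rightarrow>\<^sub>0 nat) \<Rightarrow> (nat \<times> nat \<Rightarrow>\<^sub>0 nat) \<Rightarrow> 'k::field"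
  where "B \<subseteq> monoms j" "finite B"
    "of_nat (card B) = series $ j"
    "\<And>m. m \<in> monoms j \<Longrightarrow> monom m - (\<Sum>b\<in>B. mconst (\<mu> b m) * monom b) \<in> (arc_ideal j :: 'k arc_poly set)"
    "\<And>b f. b \<in> B \<Longrightarrow> f \<in> arc_ideal j \<Longrightarrow> (\<Sum>m\<in>keys f. lookup f m * \<mu> b m) = 0"
    "\<And>b b'. b \<in> B \<Longrightarrow> b' \<in> B \<Longrightarrow> \<mu> b b' = (if b = b' then 1 else 0)"
proof -
  let ?W = "homog j :: 'k arc_poly set" and ?I = "arc_ideal j :: 'k arc_poly set"
  let ?X = "monom ` monoms j :: 'k arc_poly set"
  define N where "N = Suc (max e j)"
  have I: "?I = generated (arc_gens (\<lambda>_. 1) N) j" by (rule arc_ideal_eq) (simp add: N_def)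
  have sub: "mpv.subspace ?I" "?I \<subseteq> ?W" unfolding I by (rule graded_idealD[OF arc_gens_ideal])+
  have fin: "finite ?X" using finite_monoms by simp
  obtain D where D: "D \<subseteq> ?I" "mpv.independent D" "mpv.span D = ?I" "finite D" "card D = mpv.dim ?I"
    by (rule mpv_finite_basis[OF sub(1) _ fin empty_subsetI mpv.independent_empty])
      (use sub(2) homog_eq_span in auto)
  \<comment> \<open>Extending a basis of the ideal by monomials makes the added vectors monomials;
    these form \<open>B\<close>.\<close>
  obtain E where E: "D \<subseteq> E" "E \<subseteq> D \<union> ?X" "mpv.independent E" "D \<union> ?X \<subseteq> mpv.span E"
    by (rule mpv.maximal_independent_subset_extend[of D "D \<union> ?X", OF _ D(2)]) auto
  have finE: "finite E" using E(2) D(4) fin finite_subset by blast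
  have "?X \<subseteq> ?W" by (auto intro: homog_single)
  then have "E \<subseteq> ?W" using E(2) D(1) sub(2) by blast
  then have "mpv.span E \<subseteq> ?W" by (rule mpv.span_minimal[OF _ homog_subspace])
  moreover have "mpv.span ?X \<subseteq> mpv.span E"
    by (rule mpv.span_minimal[OF _ mpv.subspace_span]) (use E(4) in auto)
  ultimately have spE: "mpv.span E = ?W" unfolding homog_eq_span by blast
  define B where "B = {m \<in> monoms j. monom m \<in> E - D}"
  have inj: "inj_on (monom :: _ \<Rightarrow> 'k arc_poly) A" for A
    by (rule inj_onI) (metis keys_single zero_neq_one singleton_inject)
  have imB: "monom ` B = E - D" using E(2) by (auto simp: B_def)
  have "card B = card (E - D)" using card_image[OF inj] imB by metis
  also have "\<dots> = card E - card D" using E(1) D(4) by (simp add: card_Diff_subset)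
  finally have cardB: "int (card B) = int (mpv.dim ?W) - int (mpv.dim ?I)"
    using mpv.dim_span_eq_card_independent[OF E(3)] spE D(5) card_mono[OF finE E(1)] by simp
  let ?rep = "mpv.representation E"
  define \<mu> where "\<mu> b m = ?rep (monom m) (monom b)" for b m :: "nat \<times> nat \<Rightarrow>\<^sub>0 nat"
  show thesis
  proof
    show "B \<subseteq> monoms j" "finite B" using finite_monoms[of j] by (auto simp: B_def)
    have "int (card B) = hilb (generated (arc_gens (\<lambda>_. 1) N) :: nat \<Rightarrow> 'k arc_poly set) $ j"
      unfolding hilb_def fps_nth_Abs_fps I[symmetric] by (rule cardB)
    then have "of_int (int (card B)) =
        (of_int (hilb (generated (arc_gens (\<lambda>_. 1) N) :: nat \<Rightarrow> 'k arc_poly set) $ j) :: rat)"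
      by (rule arg_cong)
    also have "\<dots> = series $ j"
      by (rule hilb_arcs_coeff) (simp_all add: N_def)
    finally show "of_nat (card B) = series $ j"
      unfolding of_int_of_nat_eq .
  next
    fix m assume "m \<in> monoms j"
    then have m: "monom m \<in> mpv.span E" using spE \<open>?X \<subseteq> ?W\<close> by auto
    have "monom m = (\<Sum>v\<in>E. mconst (?rep (monom m) v) * v)"
      using mpv.sum_representation_eq[OF E(3) m finE order_refl] by simp
    also have "\<dots> = (\<Sum>v\<in>E - D. mconst (?rep (monom m) v) * v) + (\<Sum>v\<in>D. mconst (?rep (monom m) v) * v)"
      using sum.subset_diff[OF E(1) finE] .
    also have "(\<Sum>v\<in>E - D. mconst (?rep (monom m) v) * v) = (\<Sum>b\<in>B. mconst (\<mu> b m) * monom b)"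
      unfolding imB[symmetric] \<mu>_def by (subst sum.reindex[OF inj]) simp
    finally have "monom m - (\<Sum>b\<in>B. mconst (\<mu> b m) * monom b) = (\<Sum>v\<in>D. mconst (?rep (monom m) v) * v)"
      by (simp add: algebra_simps)
    also have "\<dots> \<in> ?I"
      by (intro mpv.subspace_sum[OF sub(1)] mpv.subspace_scale[OF sub(1)]) (use D(1) in auto)
    finally show "monom m - (\<Sum>b\<in>B. mconst (\<mu> b m) * monom b) \<in> ?I" .
  next
    fix b f assume b: "b \<in> B" and f: "f \<in> ?I"
    have mono: "monom m \<in> mpv.span E" if "m \<in> keys f" for m
      using that f sub(2) spE homog_single[of m j] by (auto simp: homog_def)
    have "(\<Sum>m\<in>keys f. lookup f m * \<mu> b m) = ?rep (\<Sum>m\<in>keys f. mconst (lookup f m) * monom m) (monom b)"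
      using mono unfolding \<mu>_def
      by (subst mpv.representation_sum[OF E(3)]) (auto simp: mpv.representation_scale[OF E(3)] intro!: mpv.span_scale)
    also have "(\<Sum>m\<in>keys f. mconst (lookup f m) * monom m) = f"
      by (simp flip: single_eq_mconst_monom mpol_expand)
    \<comment> \<open>An element of the ideal involves only the basis vectors in \<open>D\<close>,
      and \<open>monom b\<close> is not one of them.\<close>
    also have "?rep f (monom b) = mpv.representation D f (monom b)"
      using mpv.representation_extend[OF E(3) _ E(1), of f] f D(3) by simp
    also have "\<dots> = 0"
      using mpv.representation_ne_zero[of D f "monom b"] b by (auto simp: B_def)
    finally show "(\<Sum>m\<in>keys f. lookup f m * \<mu> b m) = 0" .
  next
    fix b b' assume "b \<in> B" "b' \<in> B"
    then show "\<mu> b b' = (if b = b' then 1 else 0)"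
      using mpv.representation_basis[OF E(3), of "monom b'"] inj_onD[OF inj, of b b' UNIV] by (auto simp: \<mu>_def B_def)
  qed
qed

end

section \<open>Residue fields\<close>

text \<open>Operations on fractions are unions over representatives; independence of the
  representatives collapses such a union to any single member.\<close>

lemma UN_pairs_const:
  assumes "p \<in> X" "q \<in> Y" "\<And>a b c d. (a, b) \<in> X \<Longrightarrow> (c, d) \<in> Y \<Longrightarrow> F a b c d = K"
  shows "(\<Union>(a, b)\<in>X. \<Union>(c, d)\<in>Y. F a b c d) = K"
proof -
  have "(case w of (c, d) \<Rightarrow> F a b c d) = K" if "(a, b) \<in> X" "w \<in> Y" for a b w
    using assms(3) that by (cases w) simp
  then have "(\<Union>(c, d)\<in>Y. F a b c d) = K" if "(a, b) \<in> X" for a b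
    using that assms(2) by (intro SUP_eq_const) auto
  then have "(case w of (a, b) \<Rightarrow> \<Union>(c, d)\<in>Y. F a b c d) = K" if "w \<in> X" for w
    using that by (cases w) simp
  then show ?thesis using assms(1) by (intro SUP_eq_const) auto
qed

context domain
begin

abbreviation nonzero :: "'a set" where "nonzero \<equiv> carrier R - {\<zero>}"

lemma nonzero_mult: "b \<in> nonzero \<Longrightarrow> d \<in> nonzero \<Longrightarrow> b \<otimes> d \<in> nonzero"
  using integral by auto

lemma fraction_refl: "a \<in> carrier R \<Longrightarrow> b \<in> nonzero \<Longrightarrow> (a, b) \<in> fraction R a b"
  by (auto simp: fraction_def)

text \<open>Transitivity of cross multiplication: the nonzero \<open>b\<close> is cancelled, which
  is where the domain property enters.\<close>

lemma fraction_subset: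
  assumes "a \<in> carrier R" "b \<in> nonzero" "c \<in> carrier R" "d \<in> nonzero" "a \<otimes> d = c \<otimes> b"
  shows "fraction R a b \<subseteq> fraction R c d"
proof
  fix z assume "z \<in> fraction R a b"
  then obtain x y where z: "z = (x, y)" "x \<in> carrier R" "y \<in> nonzero" "a \<otimes> y = x \<otimes> b"
    by (auto simp: fraction_def)
  have "b \<otimes> (c \<otimes> y) = (c \<otimes> b) \<otimes> y" using assms(1-4) z(2,3) by (simp add: m_ac)
  also have "\<dots> = (a \<otimes> d) \<otimes> y" by (simp only: assms(5))
  also have "\<dots> = (a \<otimes> y) \<otimes> d" using assms(1-4) z(2,3) by (simp add: m_ac)
  also have "\<dots> = (x \<otimes> b) \<otimes> d" by (simp only: z(4))
  also have "\<dots> = b \<otimes> (x \<otimes> d)" using assms(1-4) z(2,3) by (simp add: m_ac)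
  finally have "c \<otimes> y = x \<otimes> d" using assms z by (subst (asm) m_lcancel) auto
  then show "z \<in> fraction R c d" using z by (auto simp: fraction_def)
qed

lemma fraction_eq_iff:
  assumes "a \<in> carrier R" "b \<in> nonzero" "c \<in> carrier R" "d \<in> nonzero"
  shows "fraction R a b = fraction R c d \<longleftrightarrow> a \<otimes> d = c \<otimes> b"
proof
  assume "fraction R a b = fraction R c d"
  then have "(c, d) \<in> fraction R a b" using fraction_refl assms by simp
  then show "a \<otimes> d = c \<otimes> b" by (simp add: fraction_def)
next
  assume "a \<otimes> d = c \<otimes> b"
  then show "fraction R a b = fraction R c d"
    using assms by (intro antisym fraction_subset) auto
qed

lemma fraction_field_carrier:
  "x \<in> carrier (fraction_field R) \<longleftrightarrow> (\<exists>a b. a \<in> carrier R \<and> b \<in> nonzero \<and> x = fraction R a b)"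
  by (auto simp: fraction_field_def)

lemma fraction_mult:
  assumes "a \<in> carrier R" "b \<in> nonzero" "c \<in> carrier R" "d \<in> nonzero"
  shows "fraction R a b \<otimes>\<^bsub>fraction_field R\<^esub> fraction R c d = fraction R (a \<otimes> c) (b \<otimes> d)"
proof -
  have "fraction R (a' \<otimes> c') (b' \<otimes> d') = fraction R (a \<otimes> c) (b \<otimes> d)"
    if "(a', b') \<in> fraction R a b" "(c', d') \<in> fraction R c d" for a' b' c' d'
  proof -
    have *: "a' \<in> carrier R" "b' \<in> nonzero" "a \<otimes> b' = a' \<otimes> b" "c' \<in> carrier R" "d' \<in> nonzero" "c \<otimes> d' = c' \<otimes> d"
      using that by (auto simp: fraction_def)
    have "(a' \<otimes> c') \<otimes> (b \<otimes> d) = (a' \<otimes> b) \<otimes> (c' \<otimes> d)" using *(1,2,4,5) assms by (simp add: m_ac)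
    also have "\<dots> = (a \<otimes> b') \<otimes> (c \<otimes> d')" by (simp only: *(3,6))
    also have "\<dots> = (a \<otimes> c) \<otimes> (b' \<otimes> d')" using *(1,2,4,5) assms by (simp add: m_ac)
    finally show ?thesis
      using * assms nonzero_mult by (subst fraction_eq_iff) auto
  qed
  then show ?thesis
    unfolding fraction_field_def
    by simp (rule UN_pairs_const[OF fraction_refl[OF assms(1,2)] fraction_refl[OF assms(3,4)]])
qed

lemma fraction_add:
  assumes "a \<in> carrier R" "b \<in> nonzero" "c \<in> carrier R" "d \<in> nonzero"
  shows "fraction R a b \<oplus>\<^bsub>fraction_field R\<^esub> fraction R c d = fraction R (a \<otimes> d \<oplus> c \<otimes> b) (b \<otimes> d)"
proof -
  have "fraction R (a' \<otimes> d' \<oplus> c' \<otimes> b') (b' \<otimes> d') = fraction R (a \<otimes> d \<oplus> c \<otimes> b) (b \<otimes> d)"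
    if "(a', b') \<in> fraction R a b" "(c', d') \<in> fraction R c d" for a' b' c' d'
  proof -
    have *: "a' \<in> carrier R" "b' \<in> nonzero" "a \<otimes> b' = a' \<otimes> b" "c' \<in> carrier R" "d' \<in> nonzero" "c \<otimes> d' = c' \<otimes> d"
      using that by (auto simp: fraction_def)
    have "(a' \<otimes> d' \<oplus> c' \<otimes> b') \<otimes> (b \<otimes> d) = (a' \<otimes> b) \<otimes> (d' \<otimes> d) \<oplus> (c' \<otimes> d) \<otimes> (b' \<otimes> b)"
      using *(1,2,4,5) assms by (simp add: l_distr r_distr m_ac)
    also have "\<dots> = (a \<otimes> b') \<otimes> (d' \<otimes> d) \<oplus> (c \<otimes> d') \<otimes> (b' \<otimes> b)"
      by (simp only: *(3,6))
    also have "\<dots> = (a \<otimes> d \<oplus> c \<otimes> b) \<otimes> (b' \<otimes> d')"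
      using *(1,2,4,5) assms by (simp add: l_distr r_distr m_ac)
    finally show ?thesis
      using * assms nonzero_mult by (subst fraction_eq_iff) auto
  qed
  then show ?thesis
    unfolding fraction_field_def
    by simp (rule UN_pairs_const[OF fraction_refl[OF assms(1,2)] fraction_refl[OF assms(3,4)]])
qed

lemma fraction_field_units [simp]:
  "\<one>\<^bsub>fraction_field R\<^esub> = fraction R \<one> \<one>" "\<zero>\<^bsub>fraction_field R\<^esub> = fraction R \<zero> \<one>"
  by (simp_all add: fraction_field_def)

lemma fraction_closed: "a \<in> carrier R \<Longrightarrow> b \<in> nonzero \<Longrightarrow> fraction R a b \<in> carrier (fraction_field R)"
  by (auto simp: fraction_field_carrier)

lemma one_nonzero: "\<one> \<in> nonzero"
  by simp

lemma fraction_field_cring: "cring (fraction_field R)"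
proof (rule cringI)
  let ?F = "fraction_field R"
  note ops = fraction_mult fraction_add nonzero_mult
  show "abelian_group ?F"
  proof (rule abelian_groupI)
    fix x y z assume "x \<in> carrier ?F" "y \<in> carrier ?F" "z \<in> carrier ?F"
    then obtain a b c d e f where x: "x = fraction R a b" "a \<in> carrier R" "b \<in> nonzero"
      and y: "y = fraction R c d" "c \<in> carrier R" "d \<in> nonzero"
      and z: "z = fraction R e f" "e \<in> carrier R" "f \<in> nonzero"
      unfolding fraction_field_carrier by blast
    have carr: "b \<in> carrier R" "d \<in> carrier R" "f \<in> carrier R" using x y z by auto
    have nz: "b \<otimes> d \<in> nonzero" "d \<otimes> f \<in> nonzero" using x y z nonzero_mult by auto
    show "x \<oplus>\<^bsub>?F\<^esub> y \<oplus>\<^bsub>?F\<^esub> z = x \<oplus>\<^bsub>?F\<^esub> (y \<oplus>\<^bsub>?F\<^esub> z)"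
      unfolding x(1) y(1) z(1)
      by (simp only: fraction_add x y z carr nz a_closed m_closed)
        (intro arg_cong2[of _ _ _ _ "fraction R"]; simp add: x y z carr l_distr r_distr m_ac a_ac)
  next
    fix x y assume "x \<in> carrier ?F" "y \<in> carrier ?F"
    then obtain a b c d where x: "x = fraction R a b" "a \<in> carrier R" "b \<in> nonzero"
      and y: "y = fraction R c d" "c \<in> carrier R" "d \<in> nonzero"
      unfolding fraction_field_carrier by blast
    have carr: "b \<in> carrier R" "d \<in> carrier R" using x y by auto
    show "x \<oplus>\<^bsub>?F\<^esub> y \<in> carrier ?F"
      unfolding x(1) y(1) using x y carr nonzero_mult by (simp only: fraction_add) (intro fraction_closed; simp)
    show "x \<oplus>\<^bsub>?F\<^esub> y = y \<oplus>\<^bsub>?F\<^esub> x"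
      unfolding x(1) y(1) using x y carr by (simp only: fraction_add) (simp add: m_ac a_ac)
  next
    show "\<zero>\<^bsub>?F\<^esub> \<in> carrier ?F" by (auto intro!: fraction_closed)
  next
    fix x assume "x \<in> carrier ?F"
    then obtain a b where x: "x = fraction R a b" "a \<in> carrier R" "b \<in> nonzero"
      unfolding fraction_field_carrier by blast
    have carr: "b \<in> carrier R" using x by auto
    show "\<zero>\<^bsub>?F\<^esub> \<oplus>\<^bsub>?F\<^esub> x = x"
      unfolding x(1) fraction_field_units using x carr one_nonzero by (simp only: fraction_add zero_closed) simp
    have "fraction R (\<ominus> a) b \<oplus>\<^bsub>?F\<^esub> x = fraction R (\<ominus> a \<otimes> b \<oplus> a \<otimes> b) (b \<otimes> b)"
      unfolding x(1) using x by (simp only: fraction_add a_inv_closed)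
    also have "\<dots> = \<zero>\<^bsub>?F\<^esub>"
      unfolding fraction_field_units using x carr nonzero_mult[OF x(3,3)] one_nonzero
      by (subst fraction_eq_iff) (auto simp: l_minus l_neg)
    finally show "\<exists>y\<in>carrier ?F. y \<oplus>\<^bsub>?F\<^esub> x = \<zero>\<^bsub>?F\<^esub>"
      using x fraction_closed[of "\<ominus> a" b] by auto
  qed
  show "Group.comm_monoid ?F"
  proof (rule comm_monoidI)
    fix x y z assume "x \<in> carrier ?F" "y \<in> carrier ?F" "z \<in> carrier ?F"
    then obtain a b c d e f where x: "x = fraction R a b" "a \<in> carrier R" "b \<in> nonzero"
      and y: "y = fraction R c d" "c \<in> carrier R" "d \<in> nonzero"
      and z: "z = fraction R e f" "e \<in> carrier R" "f \<in> nonzero"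
      unfolding fraction_field_carrier by blast
    have carr: "b \<in> carrier R" "d \<in> carrier R" "f \<in> carrier R" using x y z by auto
    have nz: "b \<otimes> d \<in> nonzero" "d \<otimes> f \<in> nonzero" using x y z nonzero_mult by auto
    show "x \<otimes>\<^bsub>?F\<^esub> y \<otimes>\<^bsub>?F\<^esub> z = x \<otimes>\<^bsub>?F\<^esub> (y \<otimes>\<^bsub>?F\<^esub> z)"
      unfolding x(1) y(1) z(1)
      by (simp only: fraction_mult x y z carr nz m_closed) (simp add: x y z carr m_ac)
  next
    fix x y assume "x \<in> carrier ?F" "y \<in> carrier ?F"
    then obtain a b c d where x: "x = fraction R a b" "a \<in> carrier R" "b \<in> nonzero"
      and y: "y = fraction R c d" "c \<in> carrier R" "d \<in> nonzero"
      unfolding fraction_field_carrier by blast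
    have carr: "b \<in> carrier R" "d \<in> carrier R" using x y by auto
    show "x \<otimes>\<^bsub>?F\<^esub> y \<in> carrier ?F"
      unfolding x(1) y(1) using x y carr nonzero_mult by (simp only: fraction_mult) (intro fraction_closed; simp)
    show "x \<otimes>\<^bsub>?F\<^esub> y = y \<otimes>\<^bsub>?F\<^esub> x"
      unfolding x(1) y(1) using x y carr by (simp only: fraction_mult) (simp add: m_ac)
  next
    show "\<one>\<^bsub>?F\<^esub> \<in> carrier ?F" by (auto intro!: fraction_closed)
  next
    fix x assume "x \<in> carrier ?F"
    then obtain a b where x: "x = fraction R a b" "a \<in> carrier R" "b \<in> nonzero"
      unfolding fraction_field_carrier by blast
    have carr: "b \<in> carrier R" using x by auto
    show "\<one>\<^bsub>?F\<^esub> \<otimes>\<^bsub>?F\<^esub> x = x"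
      unfolding x(1) fraction_field_units using x carr one_nonzero by (simp only: fraction_mult one_closed) simp
  qed
  fix x y z assume "x \<in> carrier ?F" "y \<in> carrier ?F" "z \<in> carrier ?F"
  then obtain a b c d e f where x: "x = fraction R a b" "a \<in> carrier R" "b \<in> nonzero"
    and y: "y = fraction R c d" "c \<in> carrier R" "d \<in> nonzero"
    and z: "z = fraction R e f" "e \<in> carrier R" "f \<in> nonzero"
    unfolding fraction_field_carrier by blast
  have carr: "b \<in> carrier R" "d \<in> carrier R" "f \<in> carrier R" using x y z by auto
  have nz: "b \<otimes> d \<in> nonzero" "d \<otimes> f \<in> nonzero" "b \<otimes> f \<in> nonzero" using x y z nonzero_mult by auto
  have "fraction R ((a \<otimes> d \<oplus> c \<otimes> b) \<otimes> e) (b \<otimes> d \<otimes> f) =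
      fraction R (a \<otimes> e \<otimes> (d \<otimes> f) \<oplus> c \<otimes> e \<otimes> (b \<otimes> f)) (b \<otimes> f \<otimes> (d \<otimes> f))"
    using x y z carr nz nonzero_mult
    by (subst fraction_eq_iff) (auto simp: l_distr r_distr m_ac)
  then show "(x \<oplus>\<^bsub>?F\<^esub> y) \<otimes>\<^bsub>?F\<^esub> z = x \<otimes>\<^bsub>?F\<^esub> z \<oplus>\<^bsub>?F\<^esub> y \<otimes>\<^bsub>?F\<^esub> z"
    unfolding x(1) y(1) z(1)
    by (simp only: fraction_mult fraction_add x y z carr nz m_closed a_closed)
qed

lemma fraction_field_field: "field (fraction_field R)"
proof (rule cring.cring_fieldI2[OF fraction_field_cring])
  show "\<zero>\<^bsub>fraction_field R\<^esub> \<noteq> \<one>\<^bsub>fraction_field R\<^esub>"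
    by (simp add: fraction_eq_iff)
  fix x assume "x \<in> carrier (fraction_field R)" "x \<noteq> \<zero>\<^bsub>fraction_field R\<^esub>"
  then obtain a b where x: "x = fraction R a b" "a \<in> carrier R" "b \<in> nonzero" "fraction R a b \<noteq> fraction R \<zero> \<one>"
    unfolding fraction_field_carrier by auto
  have a: "a \<in> nonzero" using x(2-4) by (auto simp: fraction_eq_iff)
  have "x \<otimes>\<^bsub>fraction_field R\<^esub> fraction R b a = fraction R (a \<otimes> b) (b \<otimes> a)"
    using x a by (simp add: fraction_mult)
  also have "\<dots> = \<one>\<^bsub>fraction_field R\<^esub>"
    using x a nonzero_mult[of b a] by (simp add: fraction_eq_iff m_ac)
  finally show "\<exists>y\<in>carrier (fraction_field R). x \<otimes>\<^bsub>fraction_field R\<^esub> y = \<one>\<^bsub>fraction_field R\<^esub>"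
    using x a fraction_closed[of b a] by auto
qed

lemma fraction_hom: "(\<lambda>a. fraction R a \<one>) \<in> ring_hom R (fraction_field R)"
  by (rule ring_hom_memI) (auto simp: fraction_mult fraction_add intro!: fraction_closed)

lemma fraction_eq_zero_iff:
  "a \<in> carrier R \<Longrightarrow> fraction R a \<one> = \<zero>\<^bsub>fraction_field R\<^esub> \<longleftrightarrow> a = \<zero>"
  by (simp add: fraction_eq_iff)

end

lemma residue_field_field: "primeideal \<pp> A \<Longrightarrow> field (residue_field A \<pp>)"
  unfolding residue_field_def by (intro domain.fraction_field_field primeideal.quotient_is_domain)

lemma to_residue_field_hom:
  assumes "primeideal \<pp> A"
  shows "to_residue_field A \<pp> \<in> ring_hom A (residue_field A \<pp>)"
proof -
  interpret primeideal \<pp> A by fact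
  have "(\<lambda>a. fraction (A Quot \<pp>) a \<one>\<^bsub>A Quot \<pp>\<^esub>) \<circ> ((+>\<^bsub>A\<^esub>) \<pp>) \<in> ring_hom A (residue_field A \<pp>)"
    unfolding residue_field_def
    by (rule ring_hom_trans[OF rcos_ring_hom domain.fraction_hom[OF quotient_is_domain]])
  then show ?thesis by (simp add: comp_def to_residue_field_def[abs_def])
qed

lemma to_residue_field_eq_zero_iff:
  assumes "primeideal \<pp> A" "a \<in> carrier A"
  shows "to_residue_field A \<pp> a = \<zero>\<^bsub>residue_field A \<pp>\<^esub> \<longleftrightarrow> a \<in> \<pp>"
proof -
  interpret primeideal \<pp> A by fact
  have "\<pp> +>\<^bsub>A\<^esub> a \<in> carrier (A Quot \<pp>)" using ring_hom_closed[OF rcos_ring_hom assms(2)] .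
  then have "to_residue_field A \<pp> a = \<zero>\<^bsub>residue_field A \<pp>\<^esub> \<longleftrightarrow> \<pp> +>\<^bsub>A\<^esub> a = \<zero>\<^bsub>A Quot \<pp>\<^esub>"
    unfolding to_residue_field_def residue_field_def
    by (rule domain.fraction_eq_zero_iff[OF quotient_is_domain])
  also have "\<dots> \<longleftrightarrow> a \<in> \<pp>"
    using a_rcos_const[of a] a_rcos_self[OF assms(2)] by (auto simp: FactRing_def)
  finally show ?thesis .
qed

section \<open>Tensor products\<close>

abbreviation pair_mult :: "('b, 'm) ring_scheme \<Rightarrow> ('c, 'n) ring_scheme \<Rightarrow> ('b \<times> 'c \<Rightarrow>\<^sub>0 int) \<Rightarrow>
    ('b \<times> 'c \<Rightarrow>\<^sub>0 int) \<Rightarrow> ('b \<times> 'c \<Rightarrow>\<^sub>0 int)" where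
  "pair_mult B C u v \<equiv> u \<otimes>\<^bsub>pair_ring B C\<^esub> v"

lemma pair_ring_simps [simp]:
  "u \<in> carrier (pair_ring B C) \<longleftrightarrow> keys u \<subseteq> carrier B \<times> carrier C"
  "u \<oplus>\<^bsub>pair_ring B C\<^esub> v = u + v" "\<zero>\<^bsub>pair_ring B C\<^esub> = 0"
  "\<one>\<^bsub>pair_ring B C\<^esub> = frag_of (\<one>\<^bsub>B\<^esub>, \<one>\<^bsub>C\<^esub>)"
  by (simp_all add: pair_ring_def)

lemma pair_mult_of [simp]: "pair_mult B C (frag_of (b, c)) (frag_of (b', c')) = frag_of (b \<otimes>\<^bsub>B\<^esub> b', c \<otimes>\<^bsub>C\<^esub> c')"
  by (simp add: pair_ring_def)

lemma pair_mult_diff_left: "pair_mult B C (u - u') v = pair_mult B C u v - pair_mult B C u' v"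
  by (simp add: pair_ring_def frag_extend_diff)

lemma frag_extend_diff_fun: "frag_extend (\<lambda>x. F x - G x) u = frag_extend F u - frag_extend G u"
  by (rule frag_induction[of u UNIV]) (simp_all add: frag_extend_diff)

lemma pair_mult_diff_right: "pair_mult B C u (v - v') = pair_mult B C u v - pair_mult B C u v'"
  by (simp add: pair_ring_def frag_extend_diff case_prod_unfold frag_extend_diff_fun)

lemma pair_mult_zero [simp]: "pair_mult B C 0 v = 0" "pair_mult B C u 0 = 0"
  using pair_mult_diff_left[of B C 0 0 v] pair_mult_diff_right[of B C u 0 0] by simp_all

lemma pair_mult_add_left: "pair_mult B C (u + u') v = pair_mult B C u v + pair_mult B C u' v"
  using pair_mult_diff_left[of B C "u + u'" u' v] by simp

text \<open>Multiplication is additive in each argument, so its laws reduce by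
  \<open>frag_induction\<close> to generators, where they are the laws of \<open>B\<close> and
  \<open>C\<close>.\<close>

lemma pair_ring_cring:
  assumes "cring B" "cring C"
  shows "cring (pair_ring B C)"
proof -
  interpret B: cring B by fact
  interpret C: cring C by fact
  let ?P = "pair_ring B C" and ?S = "carrier B \<times> carrier C"
  have closed: "keys (pair_mult B C u v) \<subseteq> ?S" if "keys u \<subseteq> ?S" "keys v \<subseteq> ?S" for u v
    using that(1)
  proof (rule frag_induction)
    fix x assume x: "x \<in> ?S"
    show "keys (pair_mult B C (frag_of x) v) \<subseteq> ?S"
      using that(2)
    proof (rule frag_induction)
      fix y assume "y \<in> ?S"
      then show "keys (pair_mult B C (frag_of x) (frag_of y)) \<subseteq> ?S"
        using x by (cases x; cases y) auto
    next
      fix a b assume "keys (pair_mult B C (frag_of x) a) \<subseteq> ?S" "keys (pair_mult B C (frag_of x) b) \<subseteq> ?S"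
      then show "keys (pair_mult B C (frag_of x) (a - b)) \<subseteq> ?S"
        unfolding pair_mult_diff_right by (rule order_trans[OF keys_diff Un_least])
    qed simp
  next
    fix a b assume "keys (pair_mult B C a v) \<subseteq> ?S" "keys (pair_mult B C b v) \<subseteq> ?S"
    then show "keys (pair_mult B C (a - b) v) \<subseteq> ?S"
      unfolding pair_mult_diff_left by (rule order_trans[OF keys_diff Un_least])
  qed simp
  have comm: "pair_mult B C u v = pair_mult B C v u" if "keys u \<subseteq> ?S" "keys v \<subseteq> ?S" for u v
    using that(1)
  proof (rule frag_induction)
    fix x assume x: "x \<in> ?S"
    show "pair_mult B C (frag_of x) v = pair_mult B C v (frag_of x)"
      using that(2)
    proof (rule frag_induction)
      fix y assume "y \<in> ?S"
      then show "pair_mult B C (frag_of x) (frag_of y) = pair_mult B C (frag_of y) (frag_of x)"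
        using x by (cases x; cases y) (auto simp: B.m_comm C.m_comm)
    qed (simp_all add: pair_mult_diff_left pair_mult_diff_right)
  qed (simp_all add: pair_mult_diff_left pair_mult_diff_right)
  have assoc: "pair_mult B C (pair_mult B C u v) w = pair_mult B C u (pair_mult B C v w)"
    if "keys u \<subseteq> ?S" "keys v \<subseteq> ?S" "keys w \<subseteq> ?S" for u v w
    using that(1)
  proof (rule frag_induction)
    fix x assume x: "x \<in> ?S"
    show "pair_mult B C (pair_mult B C (frag_of x) v) w = pair_mult B C (frag_of x) (pair_mult B C v w)"
      using that(2)
    proof (rule frag_induction)
      fix y assume y: "y \<in> ?S"
      show "pair_mult B C (pair_mult B C (frag_of x) (frag_of y)) w = pair_mult B C (frag_of x) (pair_mult B C (frag_of y) w)"
        using that(3)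
      proof (rule frag_induction)
        fix z assume "z \<in> ?S"
        then show "pair_mult B C (pair_mult B C (frag_of x) (frag_of y)) (frag_of z) =
            pair_mult B C (frag_of x) (pair_mult B C (frag_of y) (frag_of z))"
          using x y by (cases x; cases y; cases z) (auto simp: B.m_assoc C.m_assoc)
      qed (simp_all add: pair_mult_diff_left pair_mult_diff_right)
    qed (simp_all add: pair_mult_diff_left pair_mult_diff_right)
  qed (simp_all add: pair_mult_diff_left pair_mult_diff_right)
  have one: "pair_mult B C (frag_of (\<one>\<^bsub>B\<^esub>, \<one>\<^bsub>C\<^esub>)) u = u" if "keys u \<subseteq> ?S" for u
    using that
  proof (rule frag_induction)
    fix x assume "x \<in> ?S"
    then show "pair_mult B C (frag_of (\<one>\<^bsub>B\<^esub>, \<one>\<^bsub>C\<^esub>)) (frag_of x) = frag_of x" by (cases x) auto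
  qed (simp_all add: pair_mult_diff_right)
  show ?thesis
  proof (rule cringI)
    show "abelian_group ?P"
    proof (rule abelian_groupI)
      fix u assume "u \<in> carrier ?P"
      then show "\<exists>v\<in>carrier ?P. v \<oplus>\<^bsub>?P\<^esub> u = \<zero>\<^bsub>?P\<^esub>" by (intro bexI[of _ "- u"]) auto
    next
      fix u v assume "u \<in> carrier ?P" "v \<in> carrier ?P"
      then show "u \<oplus>\<^bsub>?P\<^esub> v \<in> carrier ?P" using keys_add[of u v] by auto
    qed (auto simp: algebra_simps)
    show "Group.comm_monoid ?P"
      by (rule comm_monoidI) (use closed comm assoc one in \<open>auto simp: keys_frag_of\<close>)
  qed (simp add: pair_mult_add_left)
qed

locale tensor_product = A: cring A + B: cring B + C: cring C
  for A (structure) and B (structure) and C (structure) +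
  fixes f g
  assumes f: "f \<in> ring_hom A B" and g: "g \<in> ring_hom A C"
begin

abbreviation "P \<equiv> pair_ring B C"
abbreviation "T \<equiv> tensor_algebra A B C f g"
abbreviation "rels \<equiv> tensor_relations A B C f g"
abbreviation "I \<equiv> tensor_ideal A B C f g"
abbreviation "cls \<equiv> (+>\<^bsub>P\<^esub>) I"
abbreviation "t \<equiv> tensor A B C f g"

sublocale P: cring P
  by (rule pair_ring_cring) unfold_locales

lemma P_minus: "u \<in> carrier P \<Longrightarrow> \<ominus>\<^bsub>P\<^esub> u = - u"
  by (rule P.minus_equality) auto

lemma f_closed [simp]: "a \<in> carrier A \<Longrightarrow> f a \<in> carrier B" and g_closed [simp]: "a \<in> carrier A \<Longrightarrow> g a \<in> carrier C"
  using f g by (auto dest: ring_hom_closed)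

lemma rels_carrier: "rels \<subseteq> carrier P"
proof -
  have of: "frag_of x \<in> carrier P" if "x \<in> carrier B \<times> carrier C" for x
    using that by (simp add: keys_frag_of)
  have diff: "u - v \<in> carrier P" if "u \<in> carrier P" "v \<in> carrier P" for u v
    using that keys_diff[of u v] by auto
  show ?thesis
    unfolding tensor_relations_def by (auto intro!: diff of simp del: pair_ring_simps(1))
qed

sublocale I: ideal I P
  unfolding tensor_ideal_def by (rule P.genideal_ideal[OF rels_carrier])

sublocale T: cring T
  unfolding tensor_algebra_def by (rule I.quotient_is_cring) (rule P.is_cring)

lemma cls_hom: "cls \<in> ring_hom P T"
  unfolding tensor_algebra_def by (rule I.rcos_ring_hom)

lemma cls_closed: "u \<in> carrier P \<Longrightarrow> cls u \<in> carrier T"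
  using ring_hom_closed[OF cls_hom] .

lemma cls_surj: "x \<in> carrier T \<Longrightarrow> \<exists>u\<in>carrier P. x = cls u"
  by (auto simp: tensor_algebra_def FactRing_def A_RCOSETS_def')

lemma cls_eq_iff:
  assumes "u \<in> carrier P" "v \<in> carrier P"
  shows "cls u = cls v \<longleftrightarrow> u - v \<in> I"
proof -
  have "u \<ominus>\<^bsub>P\<^esub> v = u - v" using assms by (simp add: P.minus_eq P_minus)
  moreover have "cls u = cls v \<longleftrightarrow> u \<ominus>\<^bsub>P\<^esub> v \<in> I"
    using P.quotient_eq_iff_same_a_r_cos[OF I.is_ideal assms] by simp
  ultimately show ?thesis by simp
qed

lemma cls_rel: "r \<in> rels \<Longrightarrow> r \<in> I"
  using P.genideal_self[OF rels_carrier] by (auto simp: tensor_ideal_def)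

lemma t_closed [simp]: "b \<in> carrier B \<Longrightarrow> c \<in> carrier C \<Longrightarrow> t b c \<in> carrier T"
  unfolding tensor_def by (rule cls_closed) (simp add: keys_frag_of)

lemma t_add_left:
  assumes "b \<in> carrier B" "b' \<in> carrier B" "c \<in> carrier C"
  shows "t (b \<oplus>\<^bsub>B\<^esub> b') c = t b c \<oplus>\<^bsub>T\<^esub> t b' c"
proof -
  have "frag_of (b \<oplus>\<^bsub>B\<^esub> b', c) - frag_of (b, c) - frag_of (b', c) \<in> rels"
    unfolding tensor_relations_def using assms by blast
  then have "cls (frag_of (b \<oplus>\<^bsub>B\<^esub> b', c)) = cls (frag_of (b, c) + frag_of (b', c))"
    using assms keys_add[of "frag_of (b, c)" "frag_of (b', c)"]
    by (subst cls_eq_iff) (auto simp: keys_frag_of diff_diff_eq intro: cls_rel)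
  then show ?thesis
    unfolding tensor_def using ring_hom_add[OF cls_hom] assms by (simp add: keys_frag_of)
qed

lemma t_add_right:
  assumes "b \<in> carrier B" "c \<in> carrier C" "c' \<in> carrier C"
  shows "t b (c \<oplus>\<^bsub>C\<^esub> c') = t b c \<oplus>\<^bsub>T\<^esub> t b c'"
proof -
  have "frag_of (b, c \<oplus>\<^bsub>C\<^esub> c') - frag_of (b, c) - frag_of (b, c') \<in> rels"
    unfolding tensor_relations_def using assms by blast
  then have "cls (frag_of (b, c \<oplus>\<^bsub>C\<^esub> c')) = cls (frag_of (b, c) + frag_of (b, c'))"
    using assms keys_add[of "frag_of (b, c)" "frag_of (b, c')"]
    by (subst cls_eq_iff) (auto simp: keys_frag_of diff_diff_eq intro: cls_rel)
  then show ?thesis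
    unfolding tensor_def using ring_hom_add[OF cls_hom] assms by (simp add: keys_frag_of)
qed

lemma t_balanced:
  assumes "a \<in> carrier A" "b \<in> carrier B" "c \<in> carrier C"
  shows "t (f a \<otimes>\<^bsub>B\<^esub> b) c = t b (g a \<otimes>\<^bsub>C\<^esub> c)"
proof -
  have "frag_of (f a \<otimes>\<^bsub>B\<^esub> b, c) - frag_of (b, g a \<otimes>\<^bsub>C\<^esub> c) \<in> rels"
    unfolding tensor_relations_def using assms by blast
  then show ?thesis
    unfolding tensor_def using assms by (subst cls_eq_iff) (auto simp: keys_frag_of intro: cls_rel)
qed

lemma t_mult:
  assumes "b \<in> carrier B" "c \<in> carrier C" "b' \<in> carrier B" "c' \<in> carrier C"
  shows "t b c \<otimes>\<^bsub>T\<^esub> t b' c' = t (b \<otimes>\<^bsub>B\<^esub> b') (c \<otimes>\<^bsub>C\<^esub> c')"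
  unfolding tensor_def using assms ring_hom_mult[OF cls_hom, of "frag_of (b, c)" "frag_of (b', c')"]
  by (simp add: keys_frag_of)

lemma t_one: "t \<one>\<^bsub>B\<^esub> \<one>\<^bsub>C\<^esub> = \<one>\<^bsub>T\<^esub>"
  unfolding tensor_def using ring_hom_one[OF cls_hom] by simp

lemma t_zero_left: "c \<in> carrier C \<Longrightarrow> t \<zero>\<^bsub>B\<^esub> c = \<zero>\<^bsub>T\<^esub>"
  using t_add_left[of "\<zero>\<^bsub>B\<^esub>" "\<zero>\<^bsub>B\<^esub>" c] T.add.r_cancel_one'[of "t \<zero>\<^bsub>B\<^esub> c" "t \<zero>\<^bsub>B\<^esub> c"] by simp

lemma t_zero_right: "b \<in> carrier B \<Longrightarrow> t b \<zero>\<^bsub>C\<^esub> = \<zero>\<^bsub>T\<^esub>"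
  using t_add_right[of b "\<zero>\<^bsub>C\<^esub>" "\<zero>\<^bsub>C\<^esub>"] T.add.r_cancel_one'[of "t b \<zero>\<^bsub>C\<^esub>" "t b \<zero>\<^bsub>C\<^esub>"] by simp

lemma t_scalar_hom: "t \<one>\<^bsub>B\<^esub> \<in> ring_hom C T"
  by (rule ring_hom_memI) (auto simp: t_mult t_add_right t_one)

lemma scalars_subfield:
  assumes "field C" "\<one>\<^bsub>T\<^esub> \<noteq> \<zero>\<^bsub>T\<^esub>"
  shows "subfield (t \<one>\<^bsub>B\<^esub> ` carrier C) T"
proof -
  interpret sc: ring_hom_ring C T "t \<one>\<^bsub>B\<^esub>"
    by (rule ring_hom_ringI2[OF C.ring_axioms T.ring_axioms t_scalar_hom])
  show ?thesis by (rule sc.img_is_subfield(2)[OF field.carrier_is_subfield[OF assms(1)] assms(2)])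
qed

text \<open>The universal property for the pairing \<Phi>(b) c. Since the relations generate an
  ideal and not merely a subgroup, the additive map \<open>h\<close> must be shown to vanish on all
  products of a relation with a further element.\<close>

lemma linear_extension:
  assumes \<Phi>: "\<And>b. b \<in> carrier B \<Longrightarrow> \<Phi> b \<in> carrier C"
    and add: "\<And>b b'. b \<in> carrier B \<Longrightarrow> b' \<in> carrier B \<Longrightarrow> \<Phi> (b \<oplus>\<^bsub>B\<^esub> b') = \<Phi> b \<oplus>\<^bsub>C\<^esub> \<Phi> b'"
    and lin: "\<And>a b. a \<in> carrier A \<Longrightarrow> b \<in> carrier B \<Longrightarrow> \<Phi> (f a \<otimes>\<^bsub>B\<^esub> b) = g a \<otimes>\<^bsub>C\<^esub> \<Phi> b"
  obtains L where "\<And>x. x \<in> carrier T \<Longrightarrow> L x \<in> carrier C"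
    "\<And>b c. b \<in> carrier B \<Longrightarrow> c \<in> carrier C \<Longrightarrow> L (t b c) = \<Phi> b \<otimes>\<^bsub>C\<^esub> c"
    "\<And>x y. x \<in> carrier T \<Longrightarrow> y \<in> carrier T \<Longrightarrow> L (x \<oplus>\<^bsub>T\<^esub> y) = L x \<oplus>\<^bsub>C\<^esub> L y"
    "\<And>c x. c \<in> carrier C \<Longrightarrow> x \<in> carrier T \<Longrightarrow> L (t \<one>\<^bsub>B\<^esub> c \<otimes>\<^bsub>T\<^esub> x) = c \<otimes>\<^bsub>C\<^esub> L x"
proof -
  let ?S = "carrier B \<times> carrier C"
  obtain h where h: "h \<in> hom (free_Abelian_group ?S) (add_monoid C)"
    and h_of': "\<And>x. x \<in> ?S \<Longrightarrow> h (frag_of x) = (\<lambda>(b, c). \<Phi> b \<otimes>\<^bsub>C\<^esub> c) x"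
    by (rule C.add.free_Abelian_group_universal[of "\<lambda>(b, c). \<Phi> b \<otimes>\<^bsub>C\<^esub> c" ?S]) (use \<Phi> in auto)
  have h_of: "h (frag_of (b, c)) = \<Phi> b \<otimes>\<^bsub>C\<^esub> c" if "b \<in> carrier B" "c \<in> carrier C" for b c
    using h_of'[of "(b, c)"] that by simp
  have hc [simp]: "h u \<in> carrier C" if "u \<in> carrier P" for u
    using h that by (auto simp: hom_def)
  have ha: "h (u + v) = h u \<oplus>\<^bsub>C\<^esub> h v" if "u \<in> carrier P" "v \<in> carrier P" for u v
    using h that by (auto simp: hom_def)
  have h0: "h 0 = \<zero>\<^bsub>C\<^esub>"
    using ha[of 0 0] hc[of 0] C.add.r_cancel_one'[of "h 0" "h 0"] by simp
  have diff_carrier: "u - v \<in> carrier P" if "u \<in> carrier P" "v \<in> carrier P" for u v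
    using that keys_diff[of u v] by auto
  have hd: "h (u - v) = h u \<ominus>\<^bsub>C\<^esub> h v" if "u \<in> carrier P" "v \<in> carrier P" for u v
  proof -
    have "h u = h (u - v) \<oplus>\<^bsub>C\<^esub> h v" using ha[of "u - v" v] diff_carrier that by simp
    then show ?thesis using that diff_carrier hc C.minus_eq by (metis C.add.inv_solve_right)
  qed
  have of_carrier: "frag_of x \<in> carrier P" if "x \<in> ?S" for x using that by (simp add: keys_frag_of)
  have hd_of: "h (frag_of x - frag_of y - frag_of z) = h (frag_of x) \<ominus>\<^bsub>C\<^esub> h (frag_of y) \<ominus>\<^bsub>C\<^esub> h (frag_of z)"
    if "x \<in> ?S" "y \<in> ?S" "z \<in> ?S" for x y z
    by (simp only: hd[OF diff_carrier[OF of_carrier[OF that(1)] of_carrier[OF that(2)]] of_carrier[OF that(3)]]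
      hd[OF of_carrier[OF that(1)] of_carrier[OF that(2)]])
  have cancel: "p \<oplus>\<^bsub>C\<^esub> q \<ominus>\<^bsub>C\<^esub> p \<ominus>\<^bsub>C\<^esub> q = \<zero>\<^bsub>C\<^esub>" if "p \<in> carrier C" "q \<in> carrier C" for p q
  proof -
    have "p \<oplus>\<^bsub>C\<^esub> q \<ominus>\<^bsub>C\<^esub> p = q"
      using that C.a_comm[of p q] by (simp add: C.minus_eq C.a_assoc C.r_neg)
    then show ?thesis using that by (simp add: C.minus_eq C.r_neg)
  qed
  have h_rel: "h (pair_mult B C r v) = \<zero>\<^bsub>C\<^esub>" if r: "r \<in> rels" and v: "v \<in> carrier P" for r v
  proof -
    have rP: "r \<in> carrier P" using r rels_carrier by blast
    have "keys v \<subseteq> ?S" using v by simp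
    then have "v \<in> carrier P \<and> h (pair_mult B C r v) = \<zero>\<^bsub>C\<^esub>"
    proof (rule frag_induction)
      show "0 \<in> carrier P \<and> h (pair_mult B C r 0) = \<zero>\<^bsub>C\<^esub>" by (simp add: h0)
    next
      fix x assume x: "x \<in> ?S"
      obtain b' c' where x': "x = (b', c')" "b' \<in> carrier B" "c' \<in> carrier C" using x by auto
      have "h (pair_mult B C r (frag_of (b', c'))) = \<zero>\<^bsub>C\<^esub>"
        using r unfolding tensor_relations_def
      proof (elim UnE CollectE exE conjE)
        fix b b2 c assume "r = frag_of (b \<oplus>\<^bsub>B\<^esub> b2, c) - frag_of (b, c) - frag_of (b2, c)"
          "b \<in> carrier B" "b2 \<in> carrier B" "c \<in> carrier C"
        then show ?thesis using x' \<Phi>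
          by (simp add: pair_mult_diff_left hd_of h_of add B.l_distr C.l_distr cancel)
      next
        fix b c c2 assume "r = frag_of (b, c \<oplus>\<^bsub>C\<^esub> c2) - frag_of (b, c) - frag_of (b, c2)"
          "b \<in> carrier B" "c \<in> carrier C" "c2 \<in> carrier C"
        then show ?thesis using x' \<Phi>
          by (simp add: pair_mult_diff_left hd_of h_of C.l_distr C.r_distr cancel)
      next
        fix a b c assume *: "r = frag_of (f a \<otimes>\<^bsub>B\<^esub> b, c) - frag_of (b, g a \<otimes>\<^bsub>C\<^esub> c)"
          "a \<in> carrier A" "b \<in> carrier B" "c \<in> carrier C"
        have "h (pair_mult B C r (frag_of (b', c'))) =
            \<Phi> (f a \<otimes>\<^bsub>B\<^esub> (b \<otimes>\<^bsub>B\<^esub> b')) \<otimes>\<^bsub>C\<^esub> (c \<otimes>\<^bsub>C\<^esub> c') \<ominus>\<^bsub>C\<^esub> \<Phi> (b \<otimes>\<^bsub>B\<^esub> b') \<otimes>\<^bsub>C\<^esub> (g a \<otimes>\<^bsub>C\<^esub> c \<otimes>\<^bsub>C\<^esub> c')"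
          using * x' by (simp add: pair_mult_diff_left hd keys_frag_of h_of B.m_assoc)
        also have "\<dots> = \<zero>\<^bsub>C\<^esub>"
          using * x' \<Phi> by (simp add: lin C.m_ac C.minus_eq C.r_neg)
        finally show ?thesis .
      qed
      then show "frag_of x \<in> carrier P \<and> h (pair_mult B C r (frag_of x)) = \<zero>\<^bsub>C\<^esub>"
        using of_carrier[OF x] by (simp add: x')
    next
      fix u v assume "u \<in> carrier P \<and> h (pair_mult B C r u) = \<zero>\<^bsub>C\<^esub>" "v \<in> carrier P \<and> h (pair_mult B C r v) = \<zero>\<^bsub>C\<^esub>"
      then show "u - v \<in> carrier P \<and> h (pair_mult B C r (u - v)) = \<zero>\<^bsub>C\<^esub>"
        using rP P.m_closed[OF rP] unfolding pair_mult_diff_right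
        by (intro conjI diff_carrier) (simp_all only: hd, simp_all add: C.minus_eq)
    qed
    then show ?thesis ..
  qed
  \<comment> \<open>The largest ideal inside the kernel of \<open>h\<close>; it contains the
    relations by \<open>h_rel\<close>, hence the whole tensor ideal.\<close>
  let ?Z = "{u \<in> carrier P. \<forall>v\<in>carrier P. h (pair_mult B C u v) = \<zero>\<^bsub>C\<^esub>}"
  have "ideal ?Z P"
  proof (rule idealI)
    show "ring P" by (rule P.ring_axioms)
    show "subgroup ?Z (add_monoid P)"
    proof (rule P.add.subgroupI)
      show "?Z \<noteq> {}" using h0 by (auto intro!: exI[of _ 0])
      fix u assume u: "u \<in> ?Z"
      then have "h (pair_mult B C (- u) v) = \<zero>\<^bsub>C\<^esub>" if "v \<in> carrier P" for v
        using that pair_mult_diff_left[of B C 0 u v] hd[of 0 "pair_mult B C u v"] P.m_closed[of u v] h0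
        by (simp add: C.minus_eq)
      then show "\<ominus>\<^bsub>P\<^esub> u \<in> ?Z" using u P.a_inv_closed[of u] by (simp add: P_minus)
    next
      fix u v assume "u \<in> ?Z" "v \<in> ?Z"
      then show "u \<oplus>\<^bsub>P\<^esub> v \<in> ?Z" using P.a_closed[of u v] P.m_closed ha by (simp add: pair_mult_add_left)
    qed auto
    fix u x assume u: "u \<in> ?Z" and x: "x \<in> carrier P"
    have "pair_mult B C (pair_mult B C u x) v = pair_mult B C u (pair_mult B C x v)" if "v \<in> carrier P" for v
      using u x that by (intro P.m_assoc) auto
    then show ux: "pair_mult B C u x \<in> ?Z" using u x P.m_closed by simp
    have "pair_mult B C x u = pair_mult B C u x" using u x by (intro P.m_comm) auto
    then show "pair_mult B C x u \<in> ?Z" using ux by simp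
  qed
  moreover have "rels \<subseteq> ?Z" using h_rel rels_carrier by blast
  ultimately have IZ: "I \<subseteq> ?Z" unfolding tensor_ideal_def by (rule P.genideal_minimal)
  have hI: "h u = \<zero>\<^bsub>C\<^esub>" if "u \<in> I" for u
  proof -
    have "u \<in> carrier P" "h (pair_mult B C u \<one>\<^bsub>P\<^esub>) = \<zero>\<^bsub>C\<^esub>" using that IZ P.one_closed by blast+
    then show ?thesis using P.r_one[of u] by simp
  qed
  define L where "L x = h (SOME u. u \<in> carrier P \<and> x = cls u)" for x
  have L: "L (cls u) = h u" if u: "u \<in> carrier P" for u
  proof -
    let ?v = "SOME v. v \<in> carrier P \<and> cls u = cls v"
    have v: "?v \<in> carrier P \<and> cls u = cls ?v" by (rule someI[of _ u]) (use u in simp)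
    then have "h (u - ?v) = \<zero>\<^bsub>C\<^esub>" using cls_eq_iff[OF u, of ?v] hI by blast
    then have "h u \<ominus>\<^bsub>C\<^esub> h ?v = \<zero>\<^bsub>C\<^esub>" using hd[OF u, of ?v] v by simp
    then show ?thesis using u v hc by (simp add: L_def)
  qed
  show thesis
  proof
    fix x assume "x \<in> carrier T"
    then obtain u where u: "u \<in> carrier P" "x = cls u" using cls_surj by blast
    then show "L x \<in> carrier C" by (simp only: L hc)
    fix c assume c: "c \<in> carrier C"
    let ?c = "frag_of (\<one>\<^bsub>B\<^esub>, c)"
    have cP: "?c \<in> carrier P" using c by (simp add: keys_frag_of)
    have "keys u \<subseteq> ?S" using u by simp
    then have "u \<in> carrier P \<and> h (pair_mult B C ?c u) = c \<otimes>\<^bsub>C\<^esub> h u"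
    proof (rule frag_induction)
      fix x assume x: "x \<in> ?S"
      obtain b' c' where x': "x = (b', c')" "b' \<in> carrier B" "c' \<in> carrier C" using x by auto
      then show "frag_of x \<in> carrier P \<and> h (pair_mult B C ?c (frag_of x)) = c \<otimes>\<^bsub>C\<^esub> h (frag_of x)"
        using c \<Phi> by (simp add: keys_frag_of h_of C.m_ac)
    next
      fix v w assume "v \<in> carrier P \<and> h (pair_mult B C ?c v) = c \<otimes>\<^bsub>C\<^esub> h v" "w \<in> carrier P \<and> h (pair_mult B C ?c w) = c \<otimes>\<^bsub>C\<^esub> h w"
      then show "v - w \<in> carrier P \<and> h (pair_mult B C ?c (v - w)) = c \<otimes>\<^bsub>C\<^esub> h (v - w)"
        using c P.m_closed[OF cP] unfolding pair_mult_diff_right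
        by (intro conjI diff_carrier) (simp_all only: hd, simp_all add: C.minus_eq C.r_distr C.r_minus del: pair_ring_simps)
    qed (simp add: h0 c)
    moreover have "t \<one>\<^bsub>B\<^esub> c \<otimes>\<^bsub>T\<^esub> x = cls (pair_mult B C ?c u)"
      unfolding u(2) tensor_def by (rule ring_hom_mult[OF cls_hom cP u(1), symmetric])
    ultimately show "L (t \<one>\<^bsub>B\<^esub> c \<otimes>\<^bsub>T\<^esub> x) = c \<otimes>\<^bsub>C\<^esub> L x"
      using L[OF P.m_closed[OF cP u(1)]] L[OF u(1)] u(2) by simp
  next
    fix b c assume "b \<in> carrier B" "c \<in> carrier C"
    then show "L (t b c) = \<Phi> b \<otimes>\<^bsub>C\<^esub> c" unfolding tensor_def by (subst L) (simp_all add: keys_frag_of h_of)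
  next
    fix x y assume "x \<in> carrier T" "y \<in> carrier T"
    then obtain u v where u: "u \<in> carrier P" "x = cls u" and v: "v \<in> carrier P" "y = cls v"
      using cls_surj by metis
    have "x \<oplus>\<^bsub>T\<^esub> y = cls (u + v)" using ring_hom_add[OF cls_hom u(1) v(1)] u v by simp
    then show "L (x \<oplus>\<^bsub>T\<^esub> y) = L x \<oplus>\<^bsub>C\<^esub> L y"
      using L[OF P.a_closed[OF u(1) v(1)]] L[OF u(1)] L[OF v(1)] u v ha[OF u(1) v(1)] by simp
  qed
qed

end

text \<open>The functional induced by \<open>\<Phi> b\<close> kills the tensors of
  \<open>x b'\<close> with 1 for \<open>b' \<noteq> b\<close> but not that of \<open>x b\<close>,
  which gives independence. Spanning is assumed in terms of additive subgroups \<open>E\<close>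
  because the space in question is generated additively by pure tensors.\<close>

lemma (in tensor_product) dimension_by_dual_basis:
  assumes C: "field C" and nontrivial: "\<one>\<^bsub>T\<^esub> \<noteq> \<zero>\<^bsub>T\<^esub>"
    and fin: "finite X" and x: "\<And>b. b \<in> X \<Longrightarrow> x b \<in> S" and S: "S \<subseteq> carrier B"
    and closed: "\<And>b s. b \<in> X \<Longrightarrow> s \<in> carrier B \<Longrightarrow> \<Phi> b s \<in> carrier C"
    and add: "\<And>b s s'. b \<in> X \<Longrightarrow> s \<in> carrier B \<Longrightarrow> s' \<in> carrier B \<Longrightarrow> \<Phi> b (s \<oplus>\<^bsub>B\<^esub> s') = \<Phi> b s \<oplus>\<^bsub>C\<^esub> \<Phi> b s'"
    and lin: "\<And>b a s. b \<in> X \<Longrightarrow> a \<in> carrier A \<Longrightarrow> s \<in> carrier B \<Longrightarrow> \<Phi> b (f a \<otimes>\<^bsub>B\<^esub> s) = g a \<otimes>\<^bsub>C\<^esub> \<Phi> b s"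
    and dual: "\<And>b b'. b \<in> X \<Longrightarrow> b' \<in> X \<Longrightarrow> \<Phi> b (x b') = \<zero>\<^bsub>C\<^esub> \<longleftrightarrow> b \<noteq> b'"
    and span: "\<And>s c E. s \<in> S \<Longrightarrow> c \<in> carrier C \<Longrightarrow> subgroup E (add_monoid T) \<Longrightarrow>
      (\<And>b c. b \<in> X \<Longrightarrow> c \<in> carrier C \<Longrightarrow> t (x b) c \<in> E) \<Longrightarrow> t s c \<in> E"
  shows "T.dimension (card X) (t \<one>\<^bsub>B\<^esub> ` carrier C)
    (generate (add_monoid T) {t s c | s c. s \<in> S \<and> c \<in> carrier C})"
proof -
  interpret C': field C by fact
  let ?K = "t \<one>\<^bsub>B\<^esub> ` carrier C"
  let ?G = "{t s c | s c. s \<in> S \<and> c \<in> carrier C}"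
  have K: "subfield ?K T" by (rule scalars_subfield[OF C nontrivial])
  have Kc: "?K \<subseteq> carrier T" by auto
  have xB: "x b \<in> carrier B" if "b \<in> X" for b using x S that by blast
  have tx: "t (x b) c = t \<one>\<^bsub>B\<^esub> c \<otimes>\<^bsub>T\<^esub> t (x b) \<one>\<^bsub>C\<^esub>" if "b \<in> X" "c \<in> carrier C" for b c
    using that xB by (simp add: t_mult)
  obtain bs where bs: "set bs = X" "distinct bs" using finite_distinct_list[OF fin] by blast
  let ?U = "\<lambda>bs. map (\<lambda>b. t (x b) \<one>\<^bsub>C\<^esub>) bs"
  have U: "set (?U bs') \<subseteq> carrier T" if "set bs' \<subseteq> X" for bs' using that xB by auto
  have indep: "T.independent ?K (?U bs')" if "set bs' \<subseteq> X" "distinct bs'" for bs'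
    using that
  proof (induction bs')
    case (Cons b bs')
    have b: "b \<in> X" "b \<notin> set bs'" "set bs' \<subseteq> X" using Cons.prems by auto
    obtain L where L: "\<And>x. x \<in> carrier T \<Longrightarrow> L x \<in> carrier C"
      "\<And>b' c. b' \<in> carrier B \<Longrightarrow> c \<in> carrier C \<Longrightarrow> L (t b' c) = \<Phi> b b' \<otimes>\<^bsub>C\<^esub> c"
      "\<And>x y. x \<in> carrier T \<Longrightarrow> y \<in> carrier T \<Longrightarrow> L (x \<oplus>\<^bsub>T\<^esub> y) = L x \<oplus>\<^bsub>C\<^esub> L y"
      "\<And>c x. c \<in> carrier C \<Longrightarrow> x \<in> carrier T \<Longrightarrow> L (t \<one>\<^bsub>B\<^esub> c \<otimes>\<^bsub>T\<^esub> x) = c \<otimes>\<^bsub>C\<^esub> L x"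
      by (rule linear_extension[of "\<Phi> b"]) (use closed add lin b(1) in auto)
    have L0: "L \<zero>\<^bsub>T\<^esub> = \<zero>\<^bsub>C\<^esub>"
      using L(3)[of "\<zero>\<^bsub>T\<^esub>" "\<zero>\<^bsub>T\<^esub>"] L(1)[of "\<zero>\<^bsub>T\<^esub>"] C.add.r_cancel_one'[of "L \<zero>\<^bsub>T\<^esub>" "L \<zero>\<^bsub>T\<^esub>"] by simp
    \<comment> \<open>\<open>Span\<close> recurses along its list, so vanishing of \<open>L\<close>
      is proved for every list drawn from \<open>bs'\<close>, which avoids \<open>b\<close>.\<close>
    have "L y = \<zero>\<^bsub>C\<^esub>" if "y \<in> T.Span ?K (?U ds)" "set ds \<subseteq> set bs'" for y ds
      using that
    proof (induction ds arbitrary: y)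
      case (Cons d ds)
      then obtain k v where kv: "k \<in> ?K" "v \<in> T.Span ?K (?U ds)" "y = k \<otimes>\<^bsub>T\<^esub> t (x d) \<one>\<^bsub>C\<^esub> \<oplus>\<^bsub>T\<^esub> v"
        by (auto simp: T.line_extension_mem_iff)
      then obtain c where c: "k = t \<one>\<^bsub>B\<^esub> c" "c \<in> carrier C" by blast
      have d: "d \<in> X" "d \<noteq> b" using Cons.prems b by auto
      have v: "v \<in> carrier T"
        using kv(2) T.Span_in_carrier[OF Kc U, of ds] Cons.prems b(3) by auto
      have "L y = c \<otimes>\<^bsub>C\<^esub> L (t (x d) \<one>\<^bsub>C\<^esub>) \<oplus>\<^bsub>C\<^esub> L v"
        unfolding kv(3) c(1) using L(3,4) c(2) xB[OF d(1)] v by simp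
      also have "L (t (x d) \<one>\<^bsub>C\<^esub>) = \<zero>\<^bsub>C\<^esub>"
        using L(2)[OF xB[OF d(1)], of "\<one>\<^bsub>C\<^esub>"] dual[OF b(1) d(1)] d(2) by simp
      also have "L v = \<zero>\<^bsub>C\<^esub>" using Cons kv(2) by auto
      finally show ?case using c(2) by simp
    qed (simp add: L0)
    moreover have "L (t (x b) \<one>\<^bsub>C\<^esub>) \<noteq> \<zero>\<^bsub>C\<^esub>"
      using L(2)[OF xB[OF b(1)], of "\<one>\<^bsub>C\<^esub>"] dual[OF b(1) b(1)] closed[OF b(1) xB[OF b(1)]] by simp
    ultimately have "t (x b) \<one>\<^bsub>C\<^esub> \<notin> T.Span ?K (?U bs')" by blast
    then show ?case using Cons b xB by (auto intro: T.li_Cons)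
  qed simp
  have Ubs: "set (?U bs) \<subseteq> carrier T" by (rule U) (simp add: bs)
  have Gc: "?G \<subseteq> carrier T" using S by auto
  have sub: "subgroup (T.Span ?K (?U bs)) (add_monoid T)" by (rule T.Span_is_add_subgroup[OF K Ubs])
  have "generate (add_monoid T) ?G = T.Span ?K (?U bs)"
  proof
    have "?G \<subseteq> T.Span ?K (?U bs)"
    proof clarify
      fix s c assume "s \<in> S" "c \<in> carrier C"
      then show "t s c \<in> T.Span ?K (?U bs)"
      proof (rule span[OF _ _ sub])
        fix b c assume b: "b \<in> X" "c \<in> carrier C"
        have "t (x b) \<one>\<^bsub>C\<^esub> \<in> T.Span ?K (?U bs)"
          by (rule subsetD[OF T.Span_base_incl[OF K Ubs]]) (simp add: bs(1) b(1))
        then show "t (x b) c \<in> T.Span ?K (?U bs)"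
          unfolding tx[OF b] using b(2) by (intro T.Span_smult_closed[OF K Ubs]) auto
      qed
    qed
    then show "generate (add_monoid T) ?G \<subseteq> T.Span ?K (?U bs)"
      by (rule T.add.generate_subgroup_incl[OF _ sub])
    show "T.Span ?K (?U bs) \<subseteq> generate (add_monoid T) ?G"
    proof (rule T.Span_min[OF K Ubs])
      show "subgroup (generate (add_monoid T) ?G) (add_monoid T)"
        by (rule T.add.generate_is_subgroup) (use Gc in simp)
      show "?K <#>\<^bsub>T\<^esub> set (?U bs) \<subseteq> generate (add_monoid T) ?G"
      proof
        fix y assume "y \<in> ?K <#>\<^bsub>T\<^esub> set (?U bs)"
        then obtain c b where cb: "c \<in> carrier C" "b \<in> X" "y = t \<one>\<^bsub>B\<^esub> c \<otimes>\<^bsub>T\<^esub> t (x b) \<one>\<^bsub>C\<^esub>"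
          using bs by (auto simp: set_mult_def)
        have "y = t (x b) c" unfolding cb(3) by (rule tx[OF cb(2,1), symmetric])
        then have "y \<in> ?G" using cb x by blast
        then show "y \<in> generate (add_monoid T) ?G" by (rule generate.incl)
      qed
    qed
  qed
  moreover have "T.dimension (length (?U bs)) ?K (T.Span ?K (?U bs))"
    by (rule T.dimension_independent[OF indep]) (use bs in auto)
  moreover have "length (?U bs) = card X" using bs distinct_card by fastforce
  ultimately show ?thesis by simp
qed

section \<open>Transport between the base field and the residue field\<close>

lemma keys_add_nat: "keys (m + m') = keys m \<union> keys m'" for m m' :: "'v \<Rightarrow>\<^sub>0 nat"
  by (auto simp: in_keys_iff lookup_add)

lemma monom_eval_mult: "monom_eval (\<lambda>v. a v * b v) m = monom_eval a m * monom_eval b m"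
  by (simp add: monom_eval_def power_mult_distrib prod.distrib)

lemma monom_eval_cong: "(\<And>v. v \<in> keys m \<Longrightarrow> a v = b v) \<Longrightarrow> monom_eval a m = monom_eval b m"
  by (simp add: monom_eval_def)

lemma monom_eval_closed:
  assumes "\<And>v. v \<in> keys m \<Longrightarrow> P (a v)" "P 1" "\<And>x y. P x \<Longrightarrow> P y \<Longrightarrow> P (x * y)"
  shows "P (monom_eval a m)"
proof -
  have pow: "P (x ^ k)" if "P x" for x k
    using that by (induction k) (auto intro: assms)
  have "P (\<Prod>v\<in>A. a v ^ lookup m v)" if "A \<subseteq> keys m" for A
    using that by (induction A rule: infinite_finite_induct) (auto intro: assms pow)
  then show ?thesis by (simp add: monom_eval_def)
qed

lemma (in coeff_hom) h_prod: "h (prod F A) = (\<Prod>i\<in>A. h (F i))"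
  by (induction A rule: infinite_finite_induct) (simp_all add: h_mult)

lemma (in coeff_hom) h_power: "h (x ^ k) = h x ^ k"
  by (induction k) (simp_all add: h_mult)

lemma (in coeff_hom) h_sum: "h (sum F A) = (\<Sum>i\<in>A. h (F i))"
  by (induction A rule: infinite_finite_induct) (simp_all add: h_add)

lemma (in coeff_hom) h_monom_eval: "h (monom_eval a m) = monom_eval (\<lambda>v. h (a v)) m"
  by (simp add: monom_eval_def h_prod h_power)

lemma (in coeff_hom) meval_hom: "coeff_hom (meval h a)"
  by standard (simp_all add: meval_add meval_mult)

definition fps_map :: "('a::comm_ring_1 \<Rightarrow> 'b::comm_ring_1) \<Rightarrow> 'a fps \<Rightarrow> 'b fps" where
  "fps_map h F = Abs_fps (\<lambda>i. h (F $ i))"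

lemma fps_map_nth [simp]: "fps_map h F $ i = h (F $ i)"
  by (simp add: fps_map_def)

lemma (in coeff_hom) fps_map_prod: "fps_map h (prod F A) = (\<Prod>s\<in>A. fps_map h (F s))"
proof (induction A rule: infinite_finite_induct)
  case (insert s A)
  have "fps_map h (F s * G) = fps_map h (F s) * fps_map h G" for G
    by (simp add: fps_eq_iff fps_mult_nth h_sum h_mult)
  then show ?case using insert by simp
qed (auto simp: fps_eq_iff)

abbreviation embed :: "(nat, 'k::comm_ring_1) mpol \<Rightarrow> 'k arc_poly" where
  "embed \<equiv> meval mconst (\<lambda>s. mvar (s, 0))"

interpretation embed: coeff_hom embed
  by (rule mconst.meval_hom)

interpretation mconst2: coeff_hom "\<lambda>c. mconst (mconst c)"
  by standard (simp_all add: mconst_add mconst_mult)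

lemma arc_coeff_coord_product: "arc_coeff (coord_product n) l = (\<Prod>s\<in>{1..n}. generic_arc s) $ l"
  by (simp add: arc_coeff_def coord_product_def fps_mconst.meval_prod)

lemma generic_arc_nth [simp]: "generic_arc s $ i = mvar (s, i)"
  by (simp add: generic_arc_def)

lemma embed_closed: "h \<in> mpols {1..n} \<Longrightarrow> embed h \<in> mpols (arc_vars n)"
  by (induction rule: mpol_ring_induct) (auto simp: mconst.meval_add mconst.meval_mult)

lemma arc_coeff_closed: "arc_coeff (coord_product n) l \<in> mpols (arc_vars n)"
  unfolding arc_coeff_coord_product
  by (rule fps_prod_in_family[where H = "\<lambda>_. mpols (arc_vars n)"]) auto

text \<open>Variables of weight zero will act through the residue field, so they are split off as a
  polynomial factor, leaving a monomial of the same weight in the other variables.\<close>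

lemma monom_split:
  fixes m :: "nat \<times> nat \<Rightarrow>\<^sub>0 nat"
  assumes "keys m \<subseteq> arc_vars n"
  shows "\<exists>h\<in>mpols {1..n}. \<exists>w. keys w \<subseteq> {1..n} \<times> {0<..} \<and> weight w = weight m \<and>
    (monom m :: ('k::comm_ring_1) arc_poly) = embed h * monom w"
  using assms
proof (induction m rule: poly_mapping_induct_add)
  case zero
  then show ?case by (intro bexI[of _ 1] exI[of _ 0]) auto
next
  case (single v c)
  obtain s i where v: "v = (s, i)" by (cases v)
  show ?case
  proof (cases "c = 0")
    case True
    then show ?thesis by (intro bexI[of _ 1] exI[of _ 0]) auto
  next
    case c: False
    then have s: "s \<in> {1..n}" using single by (simp add: v)
    show ?thesis
    proof (cases "i = 0")
      case True
      have "embed (mvar s ^ c) = (monom (single v c) :: 'k arc_poly)"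
        using monom_eval_mvar[of "single v c", where ?'b = 'k] True by (simp add: mconst.meval_power v)
      then show ?thesis using True s c
        by (intro bexI[of _ "mvar s ^ c"] exI[of _ 0]) (auto simp: v intro: mpol_ring_power)
    next
      case False
      then show ?thesis using s c
        by (intro bexI[of _ 1] exI[of _ "single v c"]) (auto simp: v)
    qed
  qed
next
  case (add m m')
  then obtain h w h' w' where *: "h \<in> mpols {1..n}" "keys w \<subseteq> {1..n} \<times> {0<..}" "weight w = weight m"
      "(monom m :: 'k arc_poly) = embed h * monom w"
    "h' \<in> mpols {1..n}" "keys w' \<subseteq> {1..n} \<times> {0<..}" "weight w' = weight m'"
      "(monom m' :: 'k arc_poly) = embed h' * monom w'"
    by (auto simp: keys_add_nat)
  have "(monom (m + m') :: 'k arc_poly) = monom m * monom m'" by (simp add: mult_single)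
  also have "\<dots> = embed (h * h') * (monom w * monom w')"
    unfolding *(4,8) by (simp only: mconst.meval_mult mult_ac)
  also have "monom w * monom w' = (monom (w + w') :: 'k arc_poly)" by (simp add: mult_single)
  finally show ?case using * by (intro bexI[of _ "h * h'"] exI[of _ "w + w'"]) (auto simp: keys_add_nat)
qed

context reduced_arcs
begin

lemma monoms_iff: "m \<in> monoms i \<longleftrightarrow> keys m \<subseteq> {1..n} \<times> {0<..} \<and> weight m = i"
  unfolding monoms_def unfolding pos_vars_def by simp

text \<open>The \<open>k\<close>-linear relations in weight \<open>j\<close> between monomials in the \<open>x\<^sub>s\<^sup>(\<^sup>i\<^sup>)\<close>, \<open>i > 0\<close>, are transported
  by the substitution \<open>x\<^sub>s\<^sup>(\<^sup>i\<^sup>) \<mapsto> Y\<^sup>i x\<^sub>s\<^sup>(\<^sup>i\<^sup>)\<close> for \<open>s \<le> e\<close> and \<open>x\<^sub>s\<^sup>(\<^sup>i\<^sup>) \<mapsto> (Y\<^sup>i / y\<^sub>s) x\<^sub>s\<^sup>(\<^sup>i\<^sup>)\<close> for \<open>s > e\<close>, where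
  \<open>Y\<close> is the product of the \<open>y\<^sub>s\<close> with \<open>s > e\<close>: it maps \<open>1 + \<Sum> x\<^sub>s\<^sup>(\<^sup>i\<^sup>) t\<^sup>i\<close> to the arc with constant term
  \<open>y\<^sub>s\<close>, divided by \<open>y\<^sub>s\<close> and reparametrised by \<open>Y t\<close>. The powers of \<open>Y\<close> clear the denominators.\<close>

lemma spanning_by_basis:
  fixes SS :: "('k::field) arc_poly set" and U :: "(nat, 'k) mpol set"
  defines "S \<equiv> mpols (arc_vars n) :: 'k arc_poly set"
    and "R \<equiv> mpols {1..n} :: (nat, 'k) mpol set"
  assumes B: "B \<subseteq> monoms j"
    and rel: "\<And>m. m \<in> monoms j \<Longrightarrow> monom m - (\<Sum>b\<in>B. mconst (\<mu> b m) * monom b) \<in> (arc_ideal j :: 'k arc_poly set)"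
    and SS: "0 \<in> SS" "\<And>f g. f \<in> SS \<Longrightarrow> g \<in> SS \<Longrightarrow> f + g \<in> SS"
    and smult: "\<And>h f. h \<in> R \<Longrightarrow> f \<in> SS \<Longrightarrow> embed h * f \<in> SS"
    and U: "U \<subseteq> R" "1 \<in> U" "\<And>x y. x \<in> U \<Longrightarrow> y \<in> U \<Longrightarrow> x * y \<in> U" "\<And>s. s \<in> {e<..n} \<Longrightarrow> mvar s \<in> U"
    and cancel: "\<And>u f. u \<in> U \<Longrightarrow> f \<in> S \<Longrightarrow> embed u * f \<in> SS \<Longrightarrow> f \<in> SS"
    and low: "\<And>s f. s \<in> {1..e} \<Longrightarrow> f \<in> S \<Longrightarrow> mvar (s, 0) * f \<in> SS"
    and arcs: "\<And>l f. f \<in> S \<Longrightarrow> arc_coeff (coord_product n) l * f \<in> SS"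
    and base: "\<And>b. b \<in> B \<Longrightarrow> monom b \<in> SS"
    and f: "f \<in> S" "\<And>m. m \<in> keys f \<Longrightarrow> weight m = j"
  shows "f \<in> SS"
proof -
  define Y :: "(nat, 'k) mpol" where "Y = (\<Prod>s\<in>{e<..n}. mvar s)"
  \<comment> \<open>For \<open>s > e\<close> and \<open>i > 0\<close> this is Y^i divided by y_s,
    written without a division.\<close>
  define r :: "nat \<times> nat \<Rightarrow> (nat, 'k) mpol" where
    "r = (\<lambda>(s, i). if s \<le> e then Y ^ i else Y ^ (i - 1) * (\<Prod>s'\<in>{e<..n} - {s}. mvar s'))"
  define \<tau> :: "'k arc_poly \<Rightarrow> 'k arc_poly" where
    "\<tau> = meval mconst (\<lambda>v. embed (r v) * mvar v)"
  interpret \<tau>: coeff_hom \<tau> unfolding \<tau>_def by (rule mconst.meval_hom)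
  have U_prod: "prod F A \<in> U" if "\<And>i. i \<in> A \<Longrightarrow> F i \<in> U" for F :: "nat \<Rightarrow> (nat, 'k) mpol" and A
    using that by (induction A rule: infinite_finite_induct) (auto intro: U)
  have U_power: "x ^ k \<in> U" if "x \<in> U" for x k
    using that by (induction k) (auto intro: U)
  have Y_U: "Y \<in> U" unfolding Y_def by (rule U_prod) (rule U(4))
  have r_U: "r v \<in> U" for v
    using U(4) by (auto simp: r_def split: prod.splits intro!: U(3) U_power Y_U U_prod)
  have embS: "embed h \<in> S" if "h \<in> R" for h using that unfolding S_def R_def by (rule embed_closed)
  have embU: "embed h \<in> S" if "h \<in> U" for h using that U(1) embS by blast
  \<comment> \<open>\<open>SS\<close> is only closed under addition and multiplication by
    \<open>R\<close>. The elements of \<open>S\<close> all of whose multiples lie in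
    \<open>SS\<close> form an ideal, modulo which products of arcs can be computed.\<close>
  define N where "N = {f \<in> S. \<forall>g\<in>S. f * g \<in> SS}"
  have S_closed: "f * g \<in> S" "f + g \<in> S" if "f \<in> S" "g \<in> S" for f g
    using that by (auto simp: S_def)
  have N0: "0 \<in> N" using SS by (auto simp: N_def S_def)
  have N_add: "f + g \<in> N" if "f \<in> N" "g \<in> N" for f g
    using that by (auto simp: N_def distrib_right intro: SS S_closed)
  have N_mult: "f * g \<in> N" "g * f \<in> N" if "f \<in> N" "g \<in> S" for f g
    using that by (auto simp: N_def mult.assoc mult.left_commute[of g] mult.commute[of g] intro: S_closed)
  have cS: "mconst c \<in> S" for c by (simp add: S_def)
  have N_diff: "f - g \<in> N" if "f \<in> N" "g \<in> N" for f g
    using N_add[OF that(1) N_mult(2)[OF that(2) cS[of "- 1"]]] by (simp add: mconst_uminus)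
  have N_sum: "sum F A \<in> N" if "\<And>x. x \<in> A \<Longrightarrow> F x \<in> N" for F and A :: "nat set"
    using that by (induction A rule: infinite_finite_induct) (auto intro: N0 N_add)
  have NS: "f \<in> SS" if "f \<in> N" for f
  proof -
    have "f * 1 \<in> SS" using that unfolding N_def S_def by blast
    then show ?thesis by simp
  qed
  have varS: "mvar (s, i) \<in> S" if "s \<in> {1..n}" for s i using that by (auto simp: S_def)
  have low_N: "mvar (s, 0) \<in> N" if "s \<in> {1..e}" for s
    using that low e_le varS[of s 0] by (auto simp: N_def)
  have arc_N: "arc_coeff (coord_product n) l \<in> N" for l
    using arcs arc_coeff_closed by (auto simp: N_def S_def)
  \<comment> \<open>The reparametrisation replacing t by Y t is a ring endomorphism, so it commutes
    with the product of the arcs.\<close>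
  have scale: "coeff_hom (\<lambda>F :: 'k arc_poly fps. Abs_fps (\<lambda>i. embed Y ^ i * F $ i))"
  proof
    fix F G :: "'k arc_poly fps"
    show "Abs_fps (\<lambda>i. embed Y ^ i * (F * G) $ i) = Abs_fps (\<lambda>i. embed Y ^ i * F $ i) * Abs_fps (\<lambda>i. embed Y ^ i * G $ i)"
    proof (rule fps_ext)
      fix l
      have "embed Y ^ l * (F $ i * G $ (l - i)) = embed Y ^ i * F $ i * (embed Y ^ (l - i) * G $ (l - i))" if "i \<in> {0..l}" for i
      proof -
        have "embed Y ^ l = embed Y ^ i * embed Y ^ (l - i)" using that by (simp flip: power_add)
        then show ?thesis by (simp add: mult_ac)
      qed
      then show "Abs_fps (\<lambda>i. embed Y ^ i * (F * G) $ i) $ l =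
          (Abs_fps (\<lambda>i. embed Y ^ i * F $ i) * Abs_fps (\<lambda>i. embed Y ^ i * G $ i)) $ l"
        by (simp add: fps_mult_nth sum_distrib_left)
    qed
  qed (auto simp: fps_eq_iff algebra_simps)
  let ?sc = "\<lambda>F :: 'k arc_poly fps. Abs_fps (\<lambda>i. embed Y ^ i * F $ i)"
  define F where "F s = ?sc (generic_arc s)" for s
  define G where "G s = fps_const (if s \<le> e then 1 else mvar (s, 0)) * fps_map \<tau> (red_arc s)" for s
  have embed_Y: "embed Y = mvar (s, 0) * embed (\<Prod>s'\<in>{e<..n} - {s}. mvar s')" if "s \<in> {e<..n}" for s
    unfolding Y_def using that by (simp add: prod.remove[of "{e<..n}" s] mconst.meval_mult)
  \<comment> \<open>For \<open>s \<le> e\<close> the arcs differ only in the constant term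
    \<open>mvar (s, 0)\<close>, an element of \<open>N\<close>; for \<open>s > e\<close> they agree
    because y_s times \<open>r (s, i)\<close> is Y^i.\<close>
  have FG: "F s $ i - G s $ i \<in> N" if s: "s \<in> {1..n}" for s i
  proof (cases "s \<le> e")
    case True
    then show ?thesis using s N0 low_N[of s]
      by (auto simp: F_def G_def red_arc_def \<tau>_def r_def mconst.meval_power)
  next
    case False
    have "F s $ i = G s $ i"
    proof (cases i)
      case 0
      then show ?thesis using False by (simp add: F_def G_def red_arc_def)
    next
      case (Suc i')
      then show ?thesis using False embed_Y[of s] s
        by (simp add: F_def G_def red_arc_def \<tau>_def r_def mconst.meval_power mconst.meval_mult mult_ac)
    qed
    then show ?thesis using N0 by simp
  qed
  have F_S: "F s $ i \<in> S" if "s \<in> {1..n}" for s i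
    using varS[OF that] embU[OF Y_U] unfolding F_def S_def by (auto intro!: mpol_ring_power)
  have G_S: "G s $ i \<in> S" if "s \<in> {1..n}" for s i
    using that varS embU[OF r_U] by (auto simp: G_def red_arc_def \<tau>_def S_def)
  have prods: "prod F A $ l - prod G A $ l \<in> N" "prod F A $ l \<in> S" "prod G A $ l \<in> S"
    if "A \<subseteq> {1..n}" for A l
  proof -
    have S: "prod F A $ l \<in> S" "prod G A $ l \<in> S" if "A \<subseteq> {1..n}" for A l
    proof -
      have "prod Q A $ l \<in> S" if Q: "\<And>s i. s \<in> A \<Longrightarrow> Q s $ i \<in> S" for Q :: "nat \<Rightarrow> 'k arc_poly fps"
        using Q by (rule fps_prod_in_family[where H = "\<lambda>_. S"]) (auto simp: S_def)
      then show "prod F A $ l \<in> S" "prod G A $ l \<in> S" using F_S G_S that by blast+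
    qed
    then show "prod F A $ l \<in> S" "prod G A $ l \<in> S" using that by blast+
    have "finite A" using that finite_subset by blast
    then show "prod F A $ l - prod G A $ l \<in> N" using that
    proof (induction A arbitrary: l)
      case (insert s A)
      \<comment> \<open>The identity F F' - G G' = F (F' - G') + (F - G) G', taken coefficient by
        coefficient.\<close>
      have "(\<Sum>i=0..l. F s $ i * (prod F A $ (l - i) - prod G A $ (l - i)) + (F s $ i - G s $ i) * prod G A $ (l - i)) \<in> N"
        using insert.prems by (intro N_sum N_add N_mult(2)[OF insert.IH F_S] N_mult(1)[OF FG S(2)]) auto
      also have "(\<Sum>i=0..l. F s $ i * (prod F A $ (l - i) - prod G A $ (l - i)) + (F s $ i - G s $ i) * prod G A $ (l - i)) =
          (F s * prod F A) $ l - (G s * prod G A) $ l"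
        unfolding fps_mult_nth sum_subtractf[symmetric] by (intro sum.cong) (simp_all add: algebra_simps)
      finally show ?case using insert.hyps by simp
    qed (simp add: N0)
  qed
  have "prod F {1..n} = ?sc (\<Prod>s\<in>{1..n}. generic_arc s)"
    unfolding F_def by (rule coeff_hom.h_prod[OF scale, symmetric])
  then have "prod F {1..n} $ l = embed Y ^ l * arc_coeff (coord_product n) l" for l
    by (simp add: arc_coeff_coord_product)
  moreover have "embed Y ^ l \<in> S" for l using embU[OF Y_U] unfolding S_def by (rule mpol_ring_power)
  ultimately have F_N: "prod F {1..n} $ l \<in> N" for l using N_mult(2)[OF arc_N] by simp
  have "prod G {1..n} = fps_const (embed Y) * fps_map \<tau> (prod red_arc {1..n})"
  proof -
    have "{1..n} \<inter> - {s. s \<le> e} = {e<..n}" by auto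
    then have "(\<Prod>s\<in>{1..n}. if s \<le> e then 1 else mvar (s, 0) :: 'k arc_poly) = embed Y"
      by (simp add: prod.If_cases Y_def mconst.meval_prod)
    moreover have "(\<Prod>s\<in>A. fps_const (c s)) = fps_const (prod c A)" for c :: "nat \<Rightarrow> 'k arc_poly" and A
      by (induction A rule: infinite_finite_induct) (simp_all flip: fps_const_mult)
    ultimately show ?thesis by (simp add: G_def prod.distrib \<tau>.fps_map_prod)
  qed
  then have "prod G {1..n} $ l = embed Y * \<tau> (red_coeff l)" for l by (simp add: red_coeff_def)
  then have red_N: "embed Y * \<tau> (red_coeff l) \<in> N" for l
    using N_diff[OF F_N prods(1)[OF order_refl], of l l] by simp
  have \<tau>_monom: "\<tau> (monom m) = embed (monom_eval r m) * monom m" for m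
    unfolding \<tau>_def mconst.meval_single by (simp add: monom_eval_mult monom_eval_mvar embed.h_monom_eval)
  have monomS: "monom m \<in> S" if "m \<in> monoms i" for m i
    using that unfolding S_def by (intro mpol_ring_single) (auto simp: monoms_iff)
  have rU: "monom_eval r m \<in> U" for m by (rule monom_eval_closed) (auto intro: U r_U)
  have ideal_N: "embed Y * \<tau> f \<in> N" if "f \<in> arc_ideal j" for f
    using that unfolding arc_ideal_def generated_def
  proof (induction rule: mpv.span_induct)
    case base
    have "\<tau> (mconst c * x) = mconst c * \<tau> x" for c x
      by (simp add: \<tau>.h_mult) (simp add: \<tau>_def)
    then show ?case using N0 N_add N_mult(2)[OF _ cS]
      by (intro mpv.subspaceI) (auto simp: \<tau>.h_add distrib_left mult.left_commute[of "embed Y"])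
  next
    case (step x)
    then obtain m l i where x: "x = monom m * red_coeff l" "m \<in> monoms i" by blast
    have "embed Y * \<tau> x = \<tau> (monom m) * (embed Y * \<tau> (red_coeff l))"
      by (simp add: x \<tau>.h_mult mult_ac)
    moreover have "\<tau> (monom m) \<in> S"
      unfolding \<tau>_monom using embU[OF rU] monomS[OF x(2)] by (rule S_closed)
    ultimately show ?case using N_mult(2)[OF red_N] by simp
  qed
  have monom_SS: "monom m \<in> SS" if m: "m \<in> monoms j" for m
  proof -
    have YrR: "Y * monom_eval r b * mconst c \<in> R" for b c
      using subsetD[OF U(1) U(3)[OF Y_U rU, of b]] by (auto simp: R_def)
    let ?f = "monom m - (\<Sum>b\<in>B. mconst (\<mu> b m) * monom b) :: 'k arc_poly"
    have split: "\<tau> (monom m) = \<tau> ?f + (\<Sum>b\<in>B. \<tau> (mconst (\<mu> b m) * monom b))"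
      by (simp flip: \<tau>.h_sum \<tau>.h_add)
    have summand: "embed Y * \<tau> (mconst (\<mu> b m) * monom b) = embed (Y * monom_eval r b * mconst (\<mu> b m)) * monom b" for b
      by (simp add: \<tau>.h_mult \<tau>_monom mconst.meval_mult mult_ac) (simp add: \<tau>_def)
    have eq: "embed Y * \<tau> ?f + (\<Sum>b\<in>B. embed (Y * monom_eval r b * mconst (\<mu> b m)) * monom b) = embed Y * \<tau> (monom m)"
      unfolding split distrib_left sum_distrib_left summand ..
    have sum_SS: "(\<Sum>b\<in>A. embed (Y * monom_eval r b * mconst (\<mu> b m)) * monom b) \<in> SS" if "A \<subseteq> B" for A
      using that by (induction A rule: infinite_finite_induct) (auto intro!: SS smult YrR base)
    have "embed Y * \<tau> (monom m) \<in> SS"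
      unfolding eq[symmetric] by (rule SS(2)[OF NS[OF ideal_N[OF rel[OF m]]] sum_SS[OF order_refl]])
    \<comment> \<open>The factor in front of \<open>monom m\<close> is a product of coordinates with
      \<open>s > e\<close>, hence lies in \<open>U\<close> and can be cancelled.\<close>
    then have "embed (Y * monom_eval r m) * monom m \<in> SS" by (simp add: \<tau>_monom mconst.meval_mult mult_ac)
    then show ?thesis by (rule cancel[OF U(3)[OF Y_U rU] monomS[OF m]])
  qed
  have single: "single m c \<in> SS" if m: "keys m \<subseteq> arc_vars n" "weight m = j" for m c
  proof -
    obtain h w where hw: "h \<in> R" "keys w \<subseteq> {1..n} \<times> {0<..}" "weight w = j" "(monom m :: 'k arc_poly) = embed h * monom w"
      using monom_split[OF m(1), where ?'k = 'k] m(2) unfolding R_def by auto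
    have "single m c = embed (mconst c * h) * monom w"
      unfolding single_eq_mconst_monom[of m c] hw(4) by (simp add: mconst.meval_mult mult.assoc)
    moreover have "mconst c * h \<in> R" using hw(1) by (auto simp: R_def)
    moreover have "w \<in> monoms j" using hw by (simp add: monoms_iff)
    ultimately show ?thesis using smult monom_SS by simp
  qed
  have single': "single m (lookup f m) \<in> SS" if "m \<in> keys f" for m
    using that f unfolding S_def carrier_mpol_ring by (intro single) blast+
  have "(\<Sum>m\<in>A. single m (lookup f m)) \<in> SS" if "A \<subseteq> keys f" for A
    using that by (induction A rule: infinite_finite_induct) (auto intro!: SS single')
  from this[OF order_refl] show ?thesis by (simp flip: mpol_expand)
qed

text \<open>Conversely, a functional killing the relations over \<open>k\<close> extends to the arc algebra by the
  substitution \<open>x\<^sub>s\<^sup>(\<^sup>0\<^sup>) \<mapsto> y\<^sub>s\<close> and \<open>x\<^sub>s\<^sup>(\<^sup>i\<^sup>) \<mapsto> y\<^sub>s x\<^sub>s\<^sup>(\<^sup>i\<^sup>)\<close> for \<open>s > e\<close>, and \<open>x\<^sub>s\<^sup>(\<^sup>0\<^sup>) \<mapsto> 0\<close> for \<open>s \<le> e\<close>.\<close>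

abbreviation restrict_to_point :: "(nat, 'k::comm_ring_1) mpol \<Rightarrow> (nat, 'k) mpol" where
  "restrict_to_point \<equiv> meval mconst (\<lambda>s. if s \<le> e then 0 else mvar s)"

lemma extend_functional:
  fixes \<mu> :: "(nat \<times> nat \<Rightarrow>\<^sub>0 nat) \<Rightarrow> 'k::field"
  assumes kill: "\<And>f. f \<in> arc_ideal j \<Longrightarrow> (\<Sum>m\<in>keys f. lookup f m * \<mu> m) = 0"
  obtains \<Psi> :: "'k arc_poly \<Rightarrow> (nat, 'k) mpol" and \<zeta> :: "(nat \<times> nat \<Rightarrow>\<^sub>0 nat) \<Rightarrow> (nat, 'k) mpol"
  where "\<And>f g. \<Psi> (f + g) = \<Psi> f + \<Psi> g"
    "\<And>h f. \<Psi> (embed h * f) = restrict_to_point h * \<Psi> f"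
    "\<And>l f. \<Psi> (arc_coeff (coord_product n) l * f) = 0"
    "\<And>f. f \<in> mpols (arc_vars n) \<Longrightarrow> \<Psi> f \<in> mpols {1..n}"
    "\<And>m. m \<in> monoms j \<Longrightarrow> \<Psi> (monom m) = \<zeta> m * mconst (\<mu> m)"
    "\<And>U m. m \<in> monoms j \<Longrightarrow> 1 \<in> U \<Longrightarrow> \<forall>x\<in>U. \<forall>y\<in>U. x * y \<in> U \<Longrightarrow> mvar ` {e<..n} \<subseteq> U \<Longrightarrow> \<zeta> m \<in> U"
proof -
  define c :: "nat \<Rightarrow> (nat, 'k) mpol" where "c s = (if s \<le> e then 1 else mvar s)" for s
  define \<sigma>0 :: "nat \<times> nat \<Rightarrow> (nat \<times> nat, (nat, 'k) mpol) mpol" where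
    "\<sigma>0 = (\<lambda>(s, i). if i = 0 then (if s \<le> e then 0 else mconst (mvar s)) else mconst (c s) * mvar (s, i))"
  define \<sigma> :: "'k arc_poly \<Rightarrow> (nat \<times> nat, (nat, 'k) mpol) mpol" where
    "\<sigma> = meval (\<lambda>c. mconst (mconst c)) \<sigma>0"
  define lift :: "'k arc_poly \<Rightarrow> (nat \<times> nat, (nat, 'k) mpol) mpol" where
    "lift = meval (\<lambda>c. mconst (mconst c)) mvar"
  interpret \<sigma>: coeff_hom \<sigma> unfolding \<sigma>_def by (rule mconst2.meval_hom)
  interpret lift: coeff_hom lift unfolding lift_def by (rule mconst2.meval_hom)
  \<comment> \<open>Cut off outside weight \<open>j\<close>: the functional has to vanish on all
    multiples of each \<open>red_coeff l\<close>, whatever their weight.\<close>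
  define \<nu> where "\<nu> m = (if m \<in> monoms j then \<mu> m else 0)" for m
  interpret \<Lambda>: additive_family "\<lambda>m p. p * mconst (\<nu> m) :: (nat, 'k) mpol"
    by standard (simp_all add: algebra_simps)
  interpret \<nu>: additive_family "\<lambda>m c. c * \<nu> m"
    by standard (simp_all add: algebra_simps)
  \<comment> \<open>The functional \<open>\<nu>\<close> with scalars extended from k to the
    polynomials in the y_s; \<open>lift\<close> is the corresponding inclusion of polynomial
    rings.\<close>
  define \<Lambda> where "\<Lambda> = additive_ext (\<lambda>m p. p * mconst (\<nu> m) :: (nat, 'k) mpol)"
  have \<Lambda>_add: "\<Lambda> (F + G) = \<Lambda> F + \<Lambda> G" and \<Lambda>_single: "\<Lambda> (single m p) = p * mconst (\<nu> m)"
    and \<Lambda>_0: "\<Lambda> 0 = 0" for F G m p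
    by (simp_all add: \<Lambda>_def \<Lambda>.ext_add)
  have \<Lambda>_scale: "\<Lambda> (mconst p * F) = p * \<Lambda> F" for p F
    by (induction F rule: poly_mapping_induct_add)
      (simp_all add: \<Lambda>_0 \<Lambda>_add \<Lambda>_single mconst_mult_single algebra_simps)
  have lift_single: "lift (single m d) = single m (mconst d)" for m d
    by (simp add: lift_def mconst2.meval_single monom_eval_mvar mconst_mult_single)
  have \<Lambda>_lift: "\<Lambda> (lift f) = mconst (\<Sum>m\<in>keys f. lookup f m * \<nu> m)" for f
  proof -
    have "\<Lambda> (lift f) = mconst (additive_ext (\<lambda>m c. c * \<nu> m) f)"
      by (induction f rule: poly_mapping_induct_add)
        (simp_all add: \<Lambda>_0 \<Lambda>_add \<Lambda>_single lift_single lift.h_add \<nu>.ext_add mconst_add mconst_mult)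
    then show ?thesis by (simp add: additive_ext_def)
  qed
  have red_homog: "keys (red_coeff l :: 'k arc_poly) \<subseteq> monoms l" for l
    using red_coeff_homog unfolding homog_def by blast
  \<comment> \<open>By linearity over the coefficients only monomial multiples matter. Those of
    weight \<open>j\<close> lie in \<open>arc_ideal j\<close>; in the others every monomial is
    outside \<open>monoms j\<close>.\<close>
  have \<Lambda>_red: "\<Lambda> (F * lift (red_coeff l)) = 0" for F l
  proof (induction F rule: poly_mapping_induct_add)
    case (single m p)
    let ?g = "monom m * red_coeff l :: 'k arc_poly"
    have "(\<Sum>m'\<in>keys ?g. lookup ?g m' * \<nu> m') = 0"
    proof (cases "\<exists>i. m \<in> monoms i \<and> i + l = j")
      case True
      then have "?g \<in> arc_ideal j" unfolding arc_ideal_def generated_def by (intro mpv.span_base) blast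
      moreover have "?g \<in> homog j"
        using True homog_mult[OF homog_single red_coeff_homog, of m _ 1 l] by blast
      ultimately show ?thesis using kill[of ?g] by (simp add: \<nu>_def homog_def subset_iff cong: sum.cong)
    next
      case False
      have "\<nu> m' = 0" if "m' \<in> keys ?g" for m'
      proof -
        obtain a b where "a \<in> keys (monom m :: 'k arc_poly)" and b: "b \<in> keys (red_coeff l :: 'k arc_poly)" "m' = a + b"
          using \<open>m' \<in> keys ?g\<close> keys_mult[of "monom m :: 'k arc_poly" "red_coeff l"] by blast
        then have "m' = m + b" by simp
        moreover have "b \<in> monoms l" using b subsetD[OF red_homog] by blast
        ultimately have "m' \<notin> monoms j"
          using False by (auto simp: monoms_def keys_add_nat)
        then show ?thesis by (simp add: \<nu>_def)
      qed
      then show ?thesis by simp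
    qed
    then have "\<Lambda> (mconst p * lift ?g) = 0" by (simp add: \<Lambda>_scale \<Lambda>_lift)
    moreover have "single m p * lift (red_coeff l) = mconst p * lift ?g"
      by (simp add: lift.h_mult lift_single mconst_mult_single flip: mult.assoc)
    ultimately show ?case by simp
  qed (simp_all add: \<Lambda>_0 \<Lambda>_add distrib_right)
  have \<sigma>_arc: "\<sigma> (arc_coeff (coord_product n) l) = mconst (\<Prod>s\<in>{1..n}. c s) * lift (red_coeff l)" for l
  proof -
    \<comment> \<open>Each substituted arc is \<open>c s\<close> times the reduced one, so all
      coefficients of the product acquire the same factor.\<close>
    have "fps_map \<sigma> (generic_arc s) = fps_const (mconst (c s)) * fps_map lift (red_arc s)" for s
      by (auto simp: fps_eq_iff \<sigma>_def \<sigma>0_def red_arc_def c_def lift_def)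
    then have "fps_map \<sigma> (\<Prod>s\<in>{1..n}. generic_arc s) =
        (\<Prod>s\<in>{1..n}. fps_const (mconst (c s))) * fps_map lift (prod red_arc {1..n})"
      by (simp add: \<sigma>.fps_map_prod lift.fps_map_prod prod.distrib)
    also have "(\<Prod>s\<in>A. fps_const (mconst (c s))) = fps_const (mconst (\<Prod>s\<in>A. c s))" for A
      by (rule fps_mconst.h_prod[symmetric])
    finally have "fps_map \<sigma> (\<Prod>s\<in>{1..n}. generic_arc s) $ l =
        (fps_const (mconst (\<Prod>s\<in>{1..n}. c s)) * fps_map lift (prod red_arc {1..n})) $ l" by simp
    then show ?thesis by (simp add: arc_coeff_coord_product red_coeff_def)
  qed
  \<comment> \<open>The factor that the substitution puts in front of a monomial: a product of
    coordinates with \<open>s > e\<close>.\<close>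
  define \<zeta> where "\<zeta> = monom_eval (\<lambda>(s, i :: nat). c s)"
  have \<sigma>_monom: "\<sigma> (monom m) = single m (\<zeta> m)" if "m \<in> monoms i" for m i
  proof -
    have "\<sigma> (monom m) = monom_eval \<sigma>0 m" by (simp add: \<sigma>_def mconst2.meval_single)
    also have "\<dots> = monom_eval (\<lambda>v. mconst (case v of (s, i) \<Rightarrow> c s) * mvar v) m"
      using that by (intro monom_eval_cong) (auto simp: \<sigma>0_def monoms_iff)
    also have "\<dots> = mconst (\<zeta> m) * monom m"
      by (simp add: monom_eval_mult monom_eval_mvar \<zeta>_def mconst.h_monom_eval)
    finally show ?thesis by (simp add: mconst_mult_single)
  qed
  \<comment> \<open>The values stay in a polynomial type; evaluation at the point, whose target is
    only a carrier set, is applied afterwards.\<close>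
  define \<Psi> where "\<Psi> f = \<Lambda> (\<sigma> f)" for f
  show thesis
  proof (rule that[of \<Psi> \<zeta>])
    show add: "\<Psi> (f + g) = \<Psi> f + \<Psi> g" for f g by (simp add: \<Psi>_def \<sigma>.h_add \<Lambda>_add)
    show "\<Psi> (embed h * f) = restrict_to_point h * \<Psi> f" for h f
    proof -
      have "h \<in> mpols UNIV" by (simp add: carrier_mpol_ring)
      then have "\<sigma> (embed h) = mconst (restrict_to_point h)"
        by (induction rule: mpol_ring_induct)
          (simp_all add: mconst.meval_add mconst.meval_mult \<sigma>.h_add \<sigma>.h_mult mconst_add mconst_mult, simp_all add: \<sigma>_def \<sigma>0_def)
      then show ?thesis by (simp add: \<Psi>_def \<sigma>.h_mult \<Lambda>_scale)
    qed
    show "\<Psi> (arc_coeff (coord_product n) l * f) = 0" for l f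
      using \<Lambda>_red[of "mconst (\<Prod>s\<in>{1..n}. c s) * \<sigma> f" l]
      by (simp add: \<Psi>_def \<sigma>.h_mult \<sigma>_arc mult_ac)
    show "\<Psi> (monom m) = \<zeta> m * mconst (\<mu> m)" if "m \<in> monoms j" for m
      using that by (simp add: \<Psi>_def \<sigma>_monom \<Lambda>_single \<nu>_def)
    show "\<zeta> m \<in> U" if m: "m \<in> monoms j" and U: "1 \<in> U" "\<forall>x\<in>U. \<forall>y\<in>U. x * y \<in> U" "mvar ` {e<..n} \<subseteq> U" for U m
      unfolding \<zeta>_def
    proof (rule monom_eval_closed)
      fix v assume "v \<in> keys m"
      then obtain s i where v: "v = (s, i)" "s \<in> {1..n}" using m by (auto simp: monoms_iff)
      then show "(case v of (s, i) \<Rightarrow> c s) \<in> U" using U by (auto simp: c_def)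
    qed (use U in auto)
    show "\<Psi> f \<in> mpols {1..n}" if f: "f \<in> mpols (arc_vars n)" for f
    proof -
      let ?R = "mpols {1..n} :: (nat, 'k) mpol set"
      \<comment> \<open>The substitution sends each variable to a single term or to zero, so the
        same holds for monomials and only one coefficient has to be tracked.\<close>
      let ?Q = "\<lambda>x :: (nat \<times> nat, (nat, 'k) mpol) mpol. \<exists>w. \<exists>p\<in>?R. x = single w p"
      have Q_mult: "?Q (x * y)" if xy: "?Q x" "?Q y" for x y
      proof -
        obtain w p w' p' where "p \<in> ?R" "x = single w p" "p' \<in> ?R" "y = single w' p'"
          using xy by blast
        then show ?thesis by (intro exI[of _ "w + w'"] bexI[of _ "p * p'"]) (auto simp: mult_single)
      qed
      have Q_const: "?Q (mconst p)" if "p \<in> ?R" for p using that by (auto simp: mconst_def)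
      have Q1: "?Q 1" using Q_const[of 1] by auto
      have cR: "c s \<in> ?R" "mvar s \<in> ?R" if "s \<in> {1..n}" for s using that by (auto simp: c_def)
      have Q_var: "?Q (mvar v)" for v using mpol_ring_closed(2)[of "{1..n}"] by (auto simp: mvar_def)
      have Q_\<sigma>0: "?Q (\<sigma>0 v)" if "v \<in> arc_vars n" for v
      proof -
        obtain s i where v: "v = (s, i)" "s \<in> {1..n}" using \<open>v \<in> arc_vars n\<close> by auto
        have "?Q 0" using Q_const[of 0] by auto
        then show ?thesis using Q_const[OF cR(2)[OF v(2)]] Q_mult[OF Q_const[OF cR(1)[OF v(2)]] Q_var[of v]]
          by (simp add: \<sigma>0_def v(1))
      qed
      have single: "\<Psi> (single m d) \<in> ?R" if "keys m \<subseteq> arc_vars n" for m d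
      proof -
        have "?Q (monom_eval \<sigma>0 m)"
        proof (rule monom_eval_closed)
          show "?Q (\<sigma>0 v)" if "v \<in> keys m" for v
            using that \<open>keys m \<subseteq> arc_vars n\<close> by (intro Q_\<sigma>0) blast
        qed (fact Q1 Q_mult)+
        then obtain w p where p: "p \<in> ?R" "monom_eval \<sigma>0 m = single w p" by blast
        have "\<Psi> (single m d) = mconst d * (p * mconst (\<nu> w))"
          by (simp add: \<Psi>_def \<sigma>_def mconst2.meval_single p \<Lambda>_scale \<Lambda>_single)
        then show ?thesis using p(1) by auto
      qed
      have zero: "\<Psi> 0 = 0" by (simp add: \<Psi>_def \<Lambda>_0)
      have single': "\<Psi> (single m (lookup f m)) \<in> ?R" if "m \<in> keys f" for m
        using that f[unfolded carrier_mpol_ring] by (intro single) blast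
      have "\<Psi> (\<Sum>m\<in>A. single m (lookup f m)) \<in> ?R" if "A \<subseteq> keys f" for A
        using that by (induction A rule: infinite_finite_induct) (auto simp: add zero simp del: One_nat_def intro!: single')
      from this[OF order_refl] show ?thesis by (simp flip: mpol_expand)
    qed
  qed
qed

end

section \<open>The focussed arc algebra of the coordinate hyperplanes\<close>

declare One_nat_def [simp del]

locale coord_hyperplanes_point =
  fixes n :: nat and \<qq> :: "(nat, 'k::field) mpol set set"
  assumes prime: "primeideal \<qq> (J0 n [coord_product n])"
begin

abbreviation "gs \<equiv> [coord_product n] :: (nat, 'k) mpol list"
abbreviation "A \<equiv> J0 n gs"
abbreviation "B \<equiv> Jinf n gs"
abbreviation "K \<equiv> residue_field A \<qq>"
abbreviation "R \<equiv> mpol_ring {1..n} :: (nat, 'k) mpol ring"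
abbreviation "S \<equiv> mpol_ring (arc_vars n) :: 'k arc_poly ring"
abbreviation "cl \<equiv> Jinf_class n gs"
abbreviation "to_K \<equiv> to_residue_field A \<qq>"

definition \<rho> :: "(nat, 'k) mpol \<Rightarrow> 'k kappa" where
  "\<rho> f = to_K (J0_class n gs f)"

sublocale R: cring R by (rule mpol_ring_cring)
sublocale S: cring S by (rule mpol_ring_cring)

lemma coord_product_closed: "coord_product n \<in> carrier R"
  unfolding coord_product_def by (rule mpol_ring_prod) auto

sublocale J0: ideal "J0_ideal n gs" R
  unfolding J0_ideal_def by (rule R.genideal_ideal) (use coord_product_closed in simp)

lemma Jinf_gens_closed: "{arc_coeff g j | g j. g \<in> set gs} \<subseteq> carrier S"
  using arc_coeff_closed by auto

sublocale Jinf: ideal "Jinf_ideal n gs" S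
  unfolding Jinf_ideal_def by (rule S.genideal_ideal[OF Jinf_gens_closed])

sublocale A: cring A
  unfolding J0_def by (rule J0.quotient_is_cring[OF R.is_cring])

sublocale B: cring B
  unfolding Jinf_def by (rule Jinf.quotient_is_cring[OF S.is_cring])

sublocale K: field K
  by (rule residue_field_field[OF prime])

lemma J0_class_hom: "J0_class n gs \<in> ring_hom R A"
  using J0.rcos_ring_hom by (simp add: J0_def J0_class_def[abs_def])

lemma cl_hom: "cl \<in> ring_hom S B"
  using Jinf.rcos_ring_hom by (simp add: Jinf_def Jinf_class_def[abs_def])

lemma J0_class_surj: "x \<in> carrier A \<Longrightarrow> \<exists>f\<in>carrier R. x = J0_class n gs f"
  by (auto simp: J0_def J0_class_def FactRing_def A_RCOSETS_def')

lemma cl_surj: "x \<in> carrier B \<Longrightarrow> \<exists>f\<in>carrier S. x = cl f"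
  by (auto simp: Jinf_def Jinf_class_def FactRing_def A_RCOSETS_def')

lemma cl_closed: "f \<in> carrier S \<Longrightarrow> cl f \<in> carrier B"
  by (rule ring_hom_closed[OF cl_hom])

lemma cl_simps:
  assumes "f \<in> carrier S" "g \<in> carrier S"
  shows "cl (f + g) = cl f \<oplus>\<^bsub>B\<^esub> cl g" "cl (f * g) = cl f \<otimes>\<^bsub>B\<^esub> cl g"
  using ring_hom_add[OF cl_hom assms] ring_hom_mult[OF cl_hom assms] by simp_all

lemma cl_eq_iff:
  assumes "f \<in> carrier S" "g \<in> carrier S"
  shows "cl f = cl g \<longleftrightarrow> f - g \<in> Jinf_ideal n gs"
proof -
  have "f \<ominus>\<^bsub>S\<^esub> g = f - g" using assms by (simp add: S.minus_eq mpol_ring_minus)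
  moreover have "cl f = cl g \<longleftrightarrow> f \<ominus>\<^bsub>S\<^esub> g \<in> Jinf_ideal n gs"
    unfolding Jinf_class_def using S.quotient_eq_iff_same_a_r_cos[OF Jinf.is_ideal assms] by simp
  ultimately show ?thesis by simp
qed

lemma arc_coeff_in_ideal: "arc_coeff (coord_product n) l \<in> Jinf_ideal n gs"
  using S.genideal_self[OF Jinf_gens_closed] unfolding Jinf_ideal_def by auto

lemma cl_zero: "cl 0 = \<zero>\<^bsub>B\<^esub>"
  using ring_hom_zero[OF cl_hom S.ring_axioms B.ring_axioms] by simp

lemma cl_ideal: "f \<in> Jinf_ideal n gs \<Longrightarrow> cl f = \<zero>\<^bsub>B\<^esub>"
  using cl_eq_iff[of f 0] Jinf.Icarr[of f] cl_zero by simp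

lemma embed_hom: "embed \<in> ring_hom R S"
  by (rule ring_hom_memI) (auto simp: mconst.meval_add mconst.meval_mult intro: embed_closed)

text \<open>The coefficient of t^0 of the equation along the generic arc is the equation itself in
  the variables \<open>mvar (s, 0)\<close>.\<close>

lemma embed_ideal: "f \<in> J0_ideal n gs \<Longrightarrow> embed f \<in> Jinf_ideal n gs"
proof -
  interpret E: ring_hom_ring R S embed
    by (rule ring_hom_ringI2[OF R.ring_axioms S.ring_axioms embed_hom])
  have "embed (coord_product n :: (nat, 'k) mpol) = arc_coeff (coord_product n) 0"
  proof -
    have "(\<Prod>s\<in>X. generic_arc s :: 'k arc_poly fps) $ 0 = (\<Prod>s\<in>X. mvar (s, 0))" for X
      by (induction X rule: infinite_finite_induct) simp_all
    then show ?thesis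
      by (simp add: arc_coeff_coord_product) (simp add: coord_product_def mconst.meval_prod)
  qed
  then have "set gs \<subseteq> {r \<in> carrier R. embed r \<in> Jinf_ideal n gs}"
    using coord_product_closed arc_coeff_in_ideal by simp
  then have "J0_ideal n gs \<subseteq> {r \<in> carrier R. embed r \<in> Jinf_ideal n gs}"
    unfolding J0_ideal_def by (rule R.genideal_minimal[OF E.ideal_vimage[OF Jinf.is_ideal]])
  then show "f \<in> J0_ideal n gs \<Longrightarrow> embed f \<in> Jinf_ideal n gs" by blast
qed

text \<open>\<open>embed\<close> sends a whole coset into one class, so \<open>the_elem\<close> is
  applied to a singleton.\<close>

lemma J0_to_Jinf_class:
  assumes f: "f \<in> carrier R"
  shows "J0_to_Jinf n gs (J0_class n gs f) = cl (embed f)"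
proof -
  have "cl (embed f') = cl (embed f)" if f': "f' \<in> J0_class n gs f" for f'
  proof -
    obtain i where i: "i \<in> J0_ideal n gs" "f' = i + f"
      using f' by (auto simp: J0_class_def a_r_coset_def')
    have "i \<in> carrier R" using J0.Icarr[OF i(1)] .
    then have "f' \<in> carrier R" using i f by simp
    moreover have "embed f' - embed f \<in> Jinf_ideal n gs"
      using embed_ideal[OF i(1)] by (simp add: i(2) mconst.meval_add)
    ultimately show ?thesis using f by (subst cl_eq_iff) (auto intro: embed_closed)
  qed
  moreover have "f \<in> J0_class n gs f" unfolding J0_class_def by (rule J0.a_rcos_self[OF f])
  ultimately have "(\<lambda>f. cl (embed f)) ` J0_class n gs f = {cl (embed f)}" by blast
  then show ?thesis by (simp add: J0_to_Jinf_def)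
qed

lemma J0_to_Jinf_hom: "J0_to_Jinf n gs \<in> ring_hom A B"
proof (rule ring_hom_memI)
  fix x y assume "x \<in> carrier A" "y \<in> carrier A"
  then obtain f g where f: "f \<in> carrier R" "x = J0_class n gs f" and g: "g \<in> carrier R" "y = J0_class n gs g"
    using J0_class_surj by metis
  note E = embed_closed[OF f(1)] embed_closed[OF g(1)]
  show "J0_to_Jinf n gs x \<in> carrier B"
    unfolding f J0_to_Jinf_class[OF f(1)] by (rule cl_closed[OF E(1)])
  have "x \<otimes>\<^bsub>A\<^esub> y = J0_class n gs (f * g)" "x \<oplus>\<^bsub>A\<^esub> y = J0_class n gs (f + g)"
    using ring_hom_mult[OF J0_class_hom f(1) g(1)] ring_hom_add[OF J0_class_hom f(1) g(1)] f g by simp_all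
  moreover have "f * g \<in> carrier R" "f + g \<in> carrier R" using f g by auto
  ultimately show "J0_to_Jinf n gs (x \<otimes>\<^bsub>A\<^esub> y) = J0_to_Jinf n gs x \<otimes>\<^bsub>B\<^esub> J0_to_Jinf n gs y"
    "J0_to_Jinf n gs (x \<oplus>\<^bsub>A\<^esub> y) = J0_to_Jinf n gs x \<oplus>\<^bsub>B\<^esub> J0_to_Jinf n gs y"
    using cl_simps[OF E] f g by (simp_all add: J0_to_Jinf_class mconst.meval_add mconst.meval_mult)
next
  have "J0_to_Jinf n gs (J0_class n gs 1) = cl 1" by (simp add: J0_to_Jinf_class)
  then show "J0_to_Jinf n gs \<one>\<^bsub>A\<^esub> = \<one>\<^bsub>B\<^esub>"
    using ring_hom_one[OF J0_class_hom] ring_hom_one[OF cl_hom] by simp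
qed

sublocale tensor_product A B K "J0_to_Jinf n gs" to_K
  by unfold_locales (rule J0_to_Jinf_hom, rule to_residue_field_hom[OF prime])

lemma \<rho>_hom: "\<rho> \<in> ring_hom R K"
  using ring_hom_trans[OF J0_class_hom to_residue_field_hom[OF prime]]
  by (simp add: \<rho>_def[abs_def] comp_def)

lemma \<rho>_closed: "f \<in> carrier R \<Longrightarrow> \<rho> f \<in> carrier K"
  by (rule ring_hom_closed[OF \<rho>_hom])

lemma \<rho>_simps:
  assumes "f \<in> carrier R" "g \<in> carrier R"
  shows "\<rho> (f + g) = \<rho> f \<oplus>\<^bsub>K\<^esub> \<rho> g" "\<rho> (f * g) = \<rho> f \<otimes>\<^bsub>K\<^esub> \<rho> g"
  using ring_hom_add[OF \<rho>_hom assms] ring_hom_mult[OF \<rho>_hom assms] by simp_all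

lemma \<rho>_one: "\<rho> 1 = \<one>\<^bsub>K\<^esub>" and \<rho>_zero: "\<rho> 0 = \<zero>\<^bsub>K\<^esub>"
  using ring_hom_one[OF \<rho>_hom] ring_hom_zero[OF \<rho>_hom R.ring_axioms K.ring_axioms] by simp_all

lemma \<rho>_eq_zero_iff: "f \<in> carrier R \<Longrightarrow> \<rho> f = \<zero>\<^bsub>K\<^esub> \<longleftrightarrow> J0_class n gs f \<in> \<qq>"
  unfolding \<rho>_def by (intro to_residue_field_eq_zero_iff[OF prime] ring_hom_closed[OF J0_class_hom])

lemma \<rho>_mult_nonzero:
  assumes "f \<in> carrier R" "g \<in> carrier R" "\<rho> f \<noteq> \<zero>\<^bsub>K\<^esub>" "\<rho> g \<noteq> \<zero>\<^bsub>K\<^esub>"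
  shows "\<rho> (f * g) \<noteq> \<zero>\<^bsub>K\<^esub>"
  using assms K.integral[of "\<rho> f" "\<rho> g"] \<rho>_closed \<rho>_simps(2) by metis

lemma \<rho>_const_eq_zero_iff: "\<rho> (mconst c) = \<zero>\<^bsub>K\<^esub> \<longleftrightarrow> c = 0"
proof
  assume *: "\<rho> (mconst c) = \<zero>\<^bsub>K\<^esub>"
  show "c = 0"
  proof (rule ccontr)
    assume "c \<noteq> 0"
    then have "mconst (inverse c) * mconst c = (1 :: (nat, 'k) mpol)" by (simp flip: mconst_mult)
    then have "\<rho> (mconst (inverse c)) \<otimes>\<^bsub>K\<^esub> \<rho> (mconst c) = \<one>\<^bsub>K\<^esub>"
      using \<rho>_simps(2)[of "mconst (inverse c)" "mconst c"] \<rho>_one by simp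
    then show False using * \<rho>_closed[of "mconst (inverse c)"] by simp
  qed
qed (simp add: \<rho>_zero)

abbreviation nonvanishing :: "(nat, 'k) mpol set" where
  "nonvanishing \<equiv> {u \<in> carrier R. \<rho> u \<noteq> \<zero>\<^bsub>K\<^esub>}"

lemma nonvanishing_mult: "u \<in> nonvanishing \<Longrightarrow> v \<in> nonvanishing \<Longrightarrow> u * v \<in> nonvanishing"
  using \<rho>_mult_nonzero mpol_ring_mult_closed by blast

lemma nonvanishing_one: "1 \<in> nonvanishing"
  by (simp add: \<rho>_one)

text \<open>The product of the coordinates vanishes at \<open>\<qq>\<close>, hence so does one of them.\<close>

lemma exists_vanishing_coordinate: "\<exists>s\<in>{1..n}. \<rho> (mvar s) = \<zero>\<^bsub>K\<^esub>"
proof (rule ccontr)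
  assume *: "\<not> ?thesis"
  have "(\<Prod>s\<in>X. mvar s) \<in> carrier R \<and> \<rho> (\<Prod>s\<in>X. mvar s) \<noteq> \<zero>\<^bsub>K\<^esub>" if "X \<subseteq> {1..n}" for X
    using that
  proof (induction X rule: infinite_finite_induct)
    case (insert s X)
    then have "s \<in> {1..n}" by blast
    then have "mvar s \<in> carrier R" "\<rho> (mvar s) \<noteq> \<zero>\<^bsub>K\<^esub>" using * by auto
    then show ?case using insert \<rho>_mult_nonzero[of "mvar s" "\<Prod>s\<in>X. mvar s"] by auto
  qed (auto simp: \<rho>_one)
  then have "\<rho> (coord_product n) \<noteq> \<zero>\<^bsub>K\<^esub>" by (simp add: coord_product_def)
  moreover have "coord_product n \<in> J0_ideal n gs"
    using R.genideal_self[of "set gs"] coord_product_closed by (simp add: J0_ideal_def)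
  then have "J0_class n gs (coord_product n) = \<zero>\<^bsub>A\<^esub>"
    by (simp add: J0_class_def J0_def FactRing_def J0.a_rcos_const)
  then have "\<rho> (coord_product n) = \<zero>\<^bsub>K\<^esub>"
    using ring_hom_zero[OF to_residue_field_hom[OF prime] A.ring_axioms K.ring_axioms] by (simp add: \<rho>_def)
  ultimately show False by simp
qed

end

section \<open>Points lying on exactly the first \<open>e\<close> coordinate hyperplanes\<close>

locale coord_hyperplanes_strata = coord_hyperplanes_point n \<qq> + arcs: reduced_arcs n e
  for n e :: nat and \<qq> :: "(nat, 'k::field) mpol set set" +
  assumes strata: "s \<in> {1..n} \<Longrightarrow> \<rho> (mvar s) = \<zero>\<^bsub>K\<^esub> \<longleftrightarrow> s \<le> e"
begin

text \<open>The coordinates set to zero vanish at the point anyway. Linearity of the extended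
  functional along \<open>restrict_to_point\<close> thereby becomes linearity along
  \<open>\<rho>\<close>.\<close>

lemma \<rho>_restrict:
  assumes "h \<in> carrier R"
  shows "arcs.restrict_to_point h \<in> carrier R \<and> \<rho> (arcs.restrict_to_point h) = \<rho> h"
  using assms
proof (induction rule: mpol_ring_induct)
  case (var s)
  then show ?case using strata[of s] by (auto simp: \<rho>_zero)
qed (auto simp: mconst.meval_add mconst.meval_mult \<rho>_simps)

text \<open>Module homomorphisms from the arc algebra to the residue field over the coordinate ring,
  exactly the input of \<open>linear_extension\<close>.\<close>

definition J0_linear :: "('k arc_poly set \<Rightarrow> 'k kappa) \<Rightarrow> bool" where
  "J0_linear \<Phi> \<longleftrightarrow> (\<forall>x\<in>carrier B. \<Phi> x \<in> carrier K) \<and>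
    (\<forall>x\<in>carrier B. \<forall>y\<in>carrier B. \<Phi> (x \<oplus>\<^bsub>B\<^esub> y) = \<Phi> x \<oplus>\<^bsub>K\<^esub> \<Phi> y) \<and>
    (\<forall>a\<in>carrier A. \<forall>x\<in>carrier B. \<Phi> (J0_to_Jinf n gs a \<otimes>\<^bsub>B\<^esub> x) = to_K a \<otimes>\<^bsub>K\<^esub> \<Phi> x)"

lemma J0_linearD:
  assumes "J0_linear \<Phi>"
  shows "x \<in> carrier B \<Longrightarrow> \<Phi> x \<in> carrier K"
    "x \<in> carrier B \<Longrightarrow> y \<in> carrier B \<Longrightarrow> \<Phi> (x \<oplus>\<^bsub>B\<^esub> y) = \<Phi> x \<oplus>\<^bsub>K\<^esub> \<Phi> y"
    "a \<in> carrier A \<Longrightarrow> x \<in> carrier B \<Longrightarrow> \<Phi> (J0_to_Jinf n gs a \<otimes>\<^bsub>B\<^esub> x) = to_K a \<otimes>\<^bsub>K\<^esub> \<Phi> x"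
  using assms unfolding J0_linear_def by blast+

text \<open>The map is \<open>\<rho>\<close> applied to the polynomial-valued extension of
  \<open>\<mu>\<close>. On a monomial this gives \<open>\<mu> m\<close> times the nonzero value of
  \<open>\<zeta> m\<close> at the point, which is why only vanishing is compared.\<close>

lemma dual_map:
  fixes \<mu> :: "(nat \<times> nat \<Rightarrow>\<^sub>0 nat) \<Rightarrow> 'k"
  assumes kill: "\<And>f. f \<in> arcs.arc_ideal j \<Longrightarrow> (\<Sum>m\<in>keys f. lookup f m * \<mu> m) = 0"
  shows "\<exists>\<Phi>. J0_linear \<Phi> \<and>
    (\<forall>m\<in>arcs.monoms j. \<Phi> (cl (monom m)) = \<zero>\<^bsub>K\<^esub> \<longleftrightarrow> \<mu> m = 0)"
proof -
  obtain \<Psi> :: "'k arc_poly \<Rightarrow> (nat, 'k) mpol" and \<zeta> :: "(nat \<times> nat \<Rightarrow>\<^sub>0 nat) \<Rightarrow> (nat, 'k) mpol"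
    where add: "\<And>f g. \<Psi> (f + g) = \<Psi> f + \<Psi> g"
    and lin: "\<And>h f. \<Psi> (embed h * f) = arcs.restrict_to_point h * \<Psi> f"
    and arc: "\<And>l f. \<Psi> (arc_coeff (coord_product n) l * f) = 0"
    and closed: "\<And>f. f \<in> carrier S \<Longrightarrow> \<Psi> f \<in> carrier R"
    and monom: "\<And>m. m \<in> arcs.monoms j \<Longrightarrow> \<Psi> (monom m) = \<zeta> m * mconst (\<mu> m)"
    and \<zeta>: "\<And>U m. m \<in> arcs.monoms j \<Longrightarrow> 1 \<in> U \<Longrightarrow> \<forall>x\<in>U. \<forall>y\<in>U. x * y \<in> U \<Longrightarrow>
       mvar ` {e<..n} \<subseteq> U \<Longrightarrow> \<zeta> m \<in> U"
    by (rule arcs.extend_functional[of j \<mu>, OF kill]) (assumption, rule that)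
  have "\<Psi> 0 + \<Psi> 0 = \<Psi> 0 + 0" using add[of 0 0] by (simp only: add_0_right)
  then have zero: "\<Psi> 0 = 0" by (rule add_left_imp_eq)
  have neg: "\<Psi> (- f) = - \<Psi> f" for f using add[of f "- f"] zero by (simp add: add_eq_0_iff)
  \<comment> \<open>The largest ideal inside the kernel of \<open>\<Psi>\<close>, so that it
    suffices to look at the generators.\<close>
  let ?Z = "{f \<in> carrier S. \<forall>g\<in>carrier S. \<Psi> (f * g) = 0}"
  have "ideal ?Z S"
  proof (rule idealI)
    show "subgroup ?Z (add_monoid S)"
      by (rule S.add.subgroupI) (auto simp: mpol_ring_minus add neg zero distrib_right intro!: exI[of _ 0])
  qed (auto simp: S.ring_axioms mult.assoc mult.left_commute)
  moreover have "{arc_coeff g j | g j. g \<in> set gs} \<subseteq> ?Z" using arc arc_coeff_closed by auto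
  ultimately have "Jinf_ideal n gs \<subseteq> ?Z" unfolding Jinf_ideal_def by (rule S.genideal_minimal)
  then have kill_ideal: "\<Psi> f = 0" if "f \<in> Jinf_ideal n gs" for f
  proof -
    have "\<Psi> (f * 1) = 0" using that \<open>Jinf_ideal n gs \<subseteq> ?Z\<close> mpol_ring_closed(2) by blast
    then show ?thesis by simp
  qed
  define \<Phi> where "\<Phi> x = \<rho> (\<Psi> (SOME f. f \<in> carrier S \<and> x = cl f))" for x
  have \<Phi>: "\<Phi> (cl f) = \<rho> (\<Psi> f)" if f: "f \<in> carrier S" for f
  proof -
    let ?g = "SOME g. g \<in> carrier S \<and> cl f = cl g"
    have g: "?g \<in> carrier S \<and> cl f = cl ?g" by (rule someI[of _ f]) (use f in simp)
    then have "\<Psi> (f - ?g) = 0" using cl_eq_iff[OF f] kill_ideal by blast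
    then have "\<Psi> f = \<Psi> ?g" using add[of "f - ?g" ?g] by simp
    then show ?thesis by (simp add: \<Phi>_def)
  qed
  show ?thesis
    unfolding J0_linear_def
  proof (intro exI[of _ \<Phi>] conjI ballI)
    fix x assume "x \<in> carrier B"
    then obtain f where f: "f \<in> carrier S" "x = cl f" using cl_surj by blast
    show "\<Phi> x \<in> carrier K" unfolding f(2) \<Phi>[OF f(1)] by (rule \<rho>_closed[OF closed[OF f(1)]])
    fix y assume "y \<in> carrier B"
    then obtain g where g: "g \<in> carrier S" "y = cl g" using cl_surj by blast
    have "\<Phi> (cl (f + g)) = \<Phi> (cl f) \<oplus>\<^bsub>K\<^esub> \<Phi> (cl g)"
      using f g by (simp add: \<Phi> add \<rho>_simps closed)
    then show "\<Phi> (x \<oplus>\<^bsub>B\<^esub> y) = \<Phi> x \<oplus>\<^bsub>K\<^esub> \<Phi> y" using f g by (simp add: cl_simps)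
  next
    fix a x assume "a \<in> carrier A" "x \<in> carrier B"
    then obtain h f where h: "h \<in> carrier R" "a = J0_class n gs h" and f: "f \<in> carrier S" "x = cl f"
      using J0_class_surj cl_surj by metis
    note E = embed_closed[OF h(1)]
    have "J0_to_Jinf n gs a \<otimes>\<^bsub>B\<^esub> x = cl (embed h * f)"
      unfolding h(2) f(2) J0_to_Jinf_class[OF h(1)] by (rule cl_simps(2)[OF E f(1), symmetric])
    moreover have "\<Phi> (cl (embed h * f)) = \<rho> h \<otimes>\<^bsub>K\<^esub> \<rho> (\<Psi> f)"
      using \<rho>_restrict[OF h(1)] closed[OF f(1)] E f(1) by (simp add: \<Phi> lin \<rho>_simps)
    ultimately show "\<Phi> (J0_to_Jinf n gs a \<otimes>\<^bsub>B\<^esub> x) = to_K a \<otimes>\<^bsub>K\<^esub> \<Phi> x"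
      using \<Phi>[OF f(1)] f(2) h(2) by (simp add: \<rho>_def)
  next
    fix m assume m: "m \<in> arcs.monoms j"
    have mS: "monom m \<in> carrier S"
      using m by (intro mpol_ring_single) (auto simp: arcs.monoms_iff)
    have "\<zeta> m \<in> nonvanishing"
    proof (rule \<zeta>[OF m nonvanishing_one])
      show "\<forall>u\<in>nonvanishing. \<forall>v\<in>nonvanishing. u * v \<in> nonvanishing" using nonvanishing_mult by blast
      show "mvar ` {e<..n} \<subseteq> nonvanishing" using strata by auto
    qed
    then have \<zeta>m: "\<zeta> m \<in> carrier R \<and> \<rho> (\<zeta> m) \<noteq> \<zero>\<^bsub>K\<^esub>" by blast
    have "\<Phi> (cl (monom m)) = \<rho> (\<zeta> m) \<otimes>\<^bsub>K\<^esub> \<rho> (mconst (\<mu> m))"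
      using \<zeta>m by (simp add: \<Phi>[OF mS] monom[OF m] \<rho>_simps)
    also have "\<dots> = \<zero>\<^bsub>K\<^esub> \<longleftrightarrow> \<mu> m = 0"
      using \<zeta>m \<rho>_closed[of "\<zeta> m"] \<rho>_closed[of "mconst (\<mu> m)"] K.integral_iff[of "\<rho> (\<zeta> m)" "\<rho> (mconst (\<mu> m))"]
        \<rho>_const_eq_zero_iff by auto
    finally show "\<Phi> (cl (monom m)) = \<zero>\<^bsub>K\<^esub> \<longleftrightarrow> \<mu> m = 0" .
  qed
qed

text \<open>Since \<open>e \<ge> 1\<close>, the coefficient of weight zero is 0 and there is no
  relation in weight zero over k. The constant functional 1 therefore extends to one that is nonzero
  on the unit. Nontriviality makes the scalars a subfield.\<close>

lemma focussed_nontrivial: "\<one>\<^bsub>T\<^esub> \<noteq> \<zero>\<^bsub>T\<^esub>"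
proof
  assume triv: "\<one>\<^bsub>T\<^esub> = \<zero>\<^bsub>T\<^esub>"
  have "arcs.red_arc 1 $ 0 = (0 :: 'k arc_poly)"
    using arcs.e_pos by (simp add: arcs.red_arc_def)
  then have "arcs.red_coeff 0 = (0 :: 'k arc_poly)"
    unfolding arcs.red_coeff_def using arcs.e_pos arcs.e_le
    by (subst prod.remove[of _ 1]) auto
  then have "{monom m * g :: 'k arc_poly | m g w i. (g, w) \<in> {(arcs.red_coeff l, l) | l. True} \<and> m \<in> arcs.monoms i \<and> i + w = 0} \<subseteq> {0}"
    by auto
  then have "arcs.arc_ideal 0 \<subseteq> {0 :: 'k arc_poly}"
    unfolding arcs.arc_ideal_def arcs.generated_def by (rule mpv.span_minimal[OF _ mpv.subspace_single_0])
  then have "(\<Sum>m\<in>keys f. lookup f m * 1) = 0" if "f \<in> arcs.arc_ideal 0" for f :: "'k arc_poly"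
    using that by auto
  then obtain \<Phi> where \<Phi>: "J0_linear \<Phi>" "\<forall>m\<in>arcs.monoms 0. \<Phi> (cl (monom m)) = \<zero>\<^bsub>K\<^esub> \<longleftrightarrow> (1 :: 'k) = 0"
    using dual_map[of 0 "\<lambda>_. 1"] by blast
  obtain L where L: "\<And>x. x \<in> carrier T \<Longrightarrow> L x \<in> carrier K"
    "\<And>b c. b \<in> carrier B \<Longrightarrow> c \<in> carrier K \<Longrightarrow> L (t b c) = \<Phi> b \<otimes>\<^bsub>K\<^esub> c"
    "\<And>x y. x \<in> carrier T \<Longrightarrow> y \<in> carrier T \<Longrightarrow> L (x \<oplus>\<^bsub>T\<^esub> y) = L x \<oplus>\<^bsub>K\<^esub> L y"
    "\<And>c x. c \<in> carrier K \<Longrightarrow> x \<in> carrier T \<Longrightarrow> L (t \<one>\<^bsub>B\<^esub> c \<otimes>\<^bsub>T\<^esub> x) = c \<otimes>\<^bsub>K\<^esub> L x"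
    by (rule linear_extension[of \<Phi>]) (use J0_linearD[OF \<Phi>(1)] in auto)
  have "\<Phi> (cl 1) = L \<one>\<^bsub>T\<^esub>"
    using L(2)[of "\<one>\<^bsub>B\<^esub>" "\<one>\<^bsub>K\<^esub>"] J0_linearD(1)[OF \<Phi>(1), of "\<one>\<^bsub>B\<^esub>"] t_one ring_hom_one[OF cl_hom] by simp
  also have "\<dots> = \<zero>\<^bsub>K\<^esub>"
    using L(3)[of "\<zero>\<^bsub>T\<^esub>" "\<zero>\<^bsub>T\<^esub>"] L(1)[of "\<zero>\<^bsub>T\<^esub>"] K.add.r_cancel_one'[of "L \<zero>\<^bsub>T\<^esub>" "L \<zero>\<^bsub>T\<^esub>"] by (simp add: triv)
  finally show False using \<Phi>(2) by (simp add: arcs.monoms_0)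
qed

text \<open>The monomials found over k remain a basis over the residue field:
  \<open>dual_map\<close> provides the functionals and \<open>spanning_by_basis\<close> the
  spanning.\<close>

lemma focussed_dimension:
  "\<exists>h. of_nat h = arcs.series $ j \<and>
    T.dimension h (focussed_scalars n gs \<qq>) (focussed_graded n gs \<qq> j)"
proof -
  obtain X :: "(nat \<times> nat \<Rightarrow>\<^sub>0 nat) set" and \<mu> :: "(nat \<times> nat \<Rightarrow>\<^sub>0 nat) \<Rightarrow> (nat \<times> nat \<Rightarrow>\<^sub>0 nat) \<Rightarrow> 'k"
  where X: "X \<subseteq> arcs.monoms j" "finite X"
    and card: "of_nat (card X) = arcs.series $ j"
    and rel: "\<And>m. m \<in> arcs.monoms j \<Longrightarrow> monom m - (\<Sum>b\<in>X. mconst (\<mu> b m) * monom b) \<in> (arcs.arc_ideal j :: 'k arc_poly set)"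
    and kill: "\<And>b f. b \<in> X \<Longrightarrow> f \<in> arcs.arc_ideal j \<Longrightarrow> (\<Sum>m\<in>keys f. lookup f m * \<mu> b m) = 0"
    and dual: "\<And>b b'. b \<in> X \<Longrightarrow> b' \<in> X \<Longrightarrow> \<mu> b b' = (if b = b' then 1 else 0)"
    by (rule arcs.arc_basis[of j]) (rule that)
  have "\<forall>b\<in>X. \<exists>\<Phi>. J0_linear \<Phi> \<and>
    (\<forall>m\<in>arcs.monoms j. \<Phi> (cl (monom m)) = \<zero>\<^bsub>K\<^esub> \<longleftrightarrow> \<mu> b m = 0)"
    using dual_map kill by blast
  from bchoice[OF this] obtain \<Phi> where \<Phi>: "\<forall>b\<in>X. J0_linear (\<Phi> b) \<and>
    (\<forall>m\<in>arcs.monoms j. \<Phi> b (cl (monom m)) = \<zero>\<^bsub>K\<^esub> \<longleftrightarrow> \<mu> b m = 0)" ..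
  then have linear: "J0_linear (\<Phi> b)" if "b \<in> X" for b using that by blast
  let ?H = "{f \<in> carrier S. \<forall>m\<in>keys f. weight m = j}"
  have mono: "monom b \<in> ?H" if "b \<in> X" for b
    using that X(1) by (auto simp: arcs.monoms_iff carrier_mpol_ring subset_iff)
  have "T.dimension (card X) (t \<one>\<^bsub>B\<^esub> ` carrier K)
    (generate (add_monoid T) {t s c | s c. s \<in> Jinf_graded n gs j \<and> c \<in> carrier K})"
  proof (rule dimension_by_dual_basis[where x = "\<lambda>b. cl (monom b)" and \<Phi> = \<Phi>])
    show "field K" by (rule K.field_axioms)
    show "\<one>\<^bsub>T\<^esub> \<noteq> \<zero>\<^bsub>T\<^esub>" by (rule focussed_nontrivial)
    show "finite X" by (rule X(2))
    show "Jinf_graded n gs j \<subseteq> carrier B" unfolding Jinf_graded_def using cl_closed by blast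
    show "cl (monom b) \<in> Jinf_graded n gs j" if "b \<in> X" for b
      unfolding Jinf_graded_def using mono[OF that] by (rule imageI)
    show "\<Phi> b (cl (monom b')) = \<zero>\<^bsub>K\<^esub> \<longleftrightarrow> b \<noteq> b'" if "b \<in> X" "b' \<in> X" for b b'
    proof -
      have "b' \<in> arcs.monoms j" using that X(1) by blast
      then have "\<Phi> b (cl (monom b')) = \<zero>\<^bsub>K\<^esub> \<longleftrightarrow> \<mu> b b' = 0" using \<Phi> that by blast
      then show ?thesis by (simp add: dual[OF that])
    qed
  next
    fix x c E assume x: "x \<in> Jinf_graded n gs j" and c: "c \<in> carrier K" and E: "subgroup E (add_monoid T)"
      and base: "\<And>b c. b \<in> X \<Longrightarrow> c \<in> carrier K \<Longrightarrow> t (cl (monom b)) c \<in> E"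
    have E0: "\<zero>\<^bsub>T\<^esub> \<in> E" and Eadd: "\<And>x y. x \<in> E \<Longrightarrow> y \<in> E \<Longrightarrow> x \<oplus>\<^bsub>T\<^esub> y \<in> E"
      using subgroup.one_closed[OF E] subgroup.m_closed[OF E] by auto
    have bal: "t (cl (embed h * f)) c = t (cl f) (\<rho> h \<otimes>\<^bsub>K\<^esub> c)"
      if "h \<in> carrier R" "f \<in> carrier S" "c \<in> carrier K" for h f c
    proof -
      have "cl (embed h * f) = J0_to_Jinf n gs (J0_class n gs h) \<otimes>\<^bsub>B\<^esub> cl f"
        using that embed_closed[OF that(1)] by (simp add: cl_simps J0_to_Jinf_class)
      then show ?thesis unfolding \<rho>_def
        using t_balanced[OF ring_hom_closed[OF J0_class_hom that(1)] cl_closed[OF that(2)] that(3)] by simp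
    qed
    \<comment> \<open>Quantifying over all scalars \<open>c\<close> makes this set stable under
      \<open>embed h\<close>, which crosses the tensor sign as multiplication of \<open>c\<close> by
      \<open>\<rho> h\<close>.\<close>
    let ?SS = "{f \<in> carrier S. \<forall>c\<in>carrier K. t (cl f) c \<in> E}"
    obtain f where f: "f \<in> carrier S" "\<And>m. m \<in> keys f \<Longrightarrow> weight m = j" "x = cl f"
      using x by (auto simp: Jinf_graded_def)
    have "f \<in> ?SS"
    proof (rule arcs.spanning_by_basis[where U = "nonvanishing" and \<mu> = \<mu> and B = X])
      show "X \<subseteq> arcs.monoms j" by (rule X(1))
      show "monom m - (\<Sum>b\<in>X. mconst (\<mu> b m) * monom b) \<in> (arcs.arc_ideal j :: 'k arc_poly set)"
        if "m \<in> arcs.monoms j" for m by (rule rel[OF that])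
      show "0 \<in> ?SS" using E0 by (simp add: cl_zero t_zero_left)
      show "f + g \<in> ?SS" if "f \<in> ?SS" "g \<in> ?SS" for f g
        using that Eadd by (simp add: cl_simps cl_closed t_add_left)
      show "embed h * f \<in> ?SS" if "h \<in> carrier R" "f \<in> ?SS" for h f
        using that embed_closed[OF that(1)] by (simp add: bal \<rho>_closed)
      show "nonvanishing \<subseteq> carrier R" by blast
      show "1 \<in> nonvanishing" by (rule nonvanishing_one)
      show "u * v \<in> nonvanishing"
        if "u \<in> nonvanishing" "v \<in> nonvanishing" for u v
        using that by (rule nonvanishing_mult)
      show "mvar s \<in> nonvanishing" if "s \<in> {e<..n}" for s
        using that strata[of s] by auto
      show "f \<in> ?SS" if u: "u \<in> nonvanishing" and f: "f \<in> carrier S" and uf: "embed u * f \<in> ?SS" for u f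
      proof -
        have "t (cl f) c \<in> E" if c: "c \<in> carrier K" for c
        proof -
          have \<rho>u: "\<rho> u \<in> Units K" using u \<rho>_closed[of u] K.field_Units by auto
          \<comment> \<open>The inverse compensates for \<open>\<rho> u\<close> once it has crossed
            the tensor sign.\<close>
          let ?c = "inv\<^bsub>K\<^esub> (\<rho> u) \<otimes>\<^bsub>K\<^esub> c"
          have "?c \<in> carrier K" using \<rho>u c by simp
          then have "t (cl (embed u * f)) ?c \<in> E" using uf by blast
          moreover have "\<rho> u \<otimes>\<^bsub>K\<^esub> ?c = c"
            using K.m_assoc[of "\<rho> u" "inv\<^bsub>K\<^esub> (\<rho> u)" c] K.Units_closed[OF \<rho>u] \<rho>u c by simp
          ultimately show ?thesis using bal[of u f ?c] u f \<open>?c \<in> carrier K\<close> by simp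
        qed
        then show ?thesis using f by blast
      qed
      show "mvar (s, 0) * f \<in> ?SS" if "s \<in> {1..e}" "f \<in> carrier S" for s f
      proof -
        have s: "s \<in> {1..n}" using that arcs.e_le by auto
        then have "mvar s \<in> carrier R" "\<rho> (mvar s) = \<zero>\<^bsub>K\<^esub>" using strata[OF s] that(1) by auto
        then have "t (cl (embed (mvar s) * f)) c \<in> E" if "c \<in> carrier K" for c
          using bal[of "mvar s" f c] that \<open>f \<in> carrier S\<close> E0 by (simp add: t_zero_right cl_closed)
        moreover have "mvar (s, 0) \<in> carrier S" using s by auto
        ultimately show ?thesis using that(2) by simp
      qed
      show "arc_coeff (coord_product n) l * f \<in> ?SS" if "f \<in> carrier S" for l f
        using that E0 cl_ideal[OF Jinf.I_r_closed[OF arc_coeff_in_ideal that]]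
        by (auto simp: t_zero_left intro!: mpol_ring_mult_closed arc_coeff_closed)
      show "monom b \<in> ?SS" if "b \<in> X" for b using base[OF that] mono[OF that] by blast
      show "f \<in> carrier S" "\<And>m. m \<in> keys f \<Longrightarrow> weight m = j" by fact+
    qed
    then show "t x c \<in> E" using c f(3) by blast
  qed (rule J0_linearD[OF linear]; assumption)+
  then show ?thesis
    using card by (auto simp: focussed_scalars_def focussed_graded_def focussed_tensor_def[abs_def] focussed_arc_algebra_def)
qed

end

theorem proposition3p9:
  fixes d e :: nat
    and \<qq> :: "(nat, 'k::{alg_closed_field, field_char_0}) mpol set set"
  assumes "\<qq> \<in> spec (J0 (d + 1) [coord_product (d + 1)])"
    and "{s \<in> {1..d + 1}. \<qq> \<in> zero_locus (J0 (d + 1) [coord_product (d + 1)])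
            (J0_class (d + 1) [coord_product (d + 1)] (mvar s))} = {1..e}"
  shows "(\<forall>j. ring.finite_dimension (focussed_arc_algebra (d + 1) [coord_product (d + 1)] \<qq>)
            (focussed_scalars (d + 1) [coord_product (d + 1)] \<qq>)
            (focussed_graded (d + 1) [coord_product (d + 1)] \<qq> j)) \<and>
         focussed_HP (d + 1) [coord_product (d + 1)] \<qq> =
           (\<Prod>i = 1..e - 1. 1 / (1 - fps_X ^ i)) ^ (d + 1) * prodinf (\<lambda>i. 1 / (1 - fps_X ^ (e + i))) ^ d"
proof -
  interpret pt: coord_hyperplanes_point "d + 1" \<qq>
    using assms(1) by (intro coord_hyperplanes_point.intro) (simp add: spec_def)
  have vanish: "pt.\<rho> (mvar s) = \<zero>\<^bsub>pt.K\<^esub> \<longleftrightarrow> s \<in> {1..e}" if s: "s \<in> {1..d + 1}" for s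
  proof -
    have "pt.\<rho> (mvar s) = \<zero>\<^bsub>pt.K\<^esub> \<longleftrightarrow> \<qq> \<in> zero_locus pt.A (J0_class (d + 1) pt.gs (mvar s))"
      using assms(1) s by (subst pt.\<rho>_eq_zero_iff) (auto simp: zero_locus_def)
    also have "\<dots> \<longleftrightarrow> s \<in> {1..e}"
      unfolding assms(2)[symmetric] using s by blast
    finally show ?thesis .
  qed
  \<comment> \<open>This excludes \<open>e = 0\<close>: a point of the hypersurface lies on at least
    one of the components.\<close>
  obtain s where "s \<in> {1..d + 1}" "pt.\<rho> (mvar s) = \<zero>\<^bsub>pt.K\<^esub>"
    using pt.exists_vanishing_coordinate by blast
  then have "s \<in> {1..e}" using vanish by blast
  then have e_pos: "1 \<le> e" by simp
  have "{1..e} \<subseteq> {1..d + 1}" unfolding assms(2)[symmetric] by blast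
  then have e_le: "e \<le> d + 1" using e_pos by simp
  interpret coord_hyperplanes_strata "d + 1" e \<qq>
  proof (intro coord_hyperplanes_strata.intro coord_hyperplanes_strata_axioms.intro reduced_arcs.intro)
    show "coord_hyperplanes_point (d + 1) \<qq>" by (rule pt.coord_hyperplanes_point_axioms)
    show "pt.\<rho> (mvar s) = \<zero>\<^bsub>pt.K\<^esub> \<longleftrightarrow> s \<le> e" if "s \<in> {1..d + 1}" for s
      using vanish[OF that] that by simp
  qed (fact e_pos e_le)+
  let ?P = "(\<Prod>i=1..e - 1. 1 / (1 - fps_X ^ i)) ^ (d + 1) *
      prodinf (\<lambda>i. 1 / (1 - fps_X ^ (e + i))) ^ d :: rat fps"
  let ?gs = "[coord_product (d + 1)] :: (nat, 'k) mpol list"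
  let ?T = "focussed_arc_algebra (d + 1) ?gs \<qq>"
  let ?k = "focussed_scalars (d + 1) ?gs \<qq>" and ?E = "focussed_graded (d + 1) ?gs \<qq>"
  have ring: "ring ?T"
    using pt.T.ring_axioms unfolding focussed_arc_algebra_def .
  have sub: "subfield ?k ?T"
    using pt.scalars_subfield[OF pt.K.field_axioms focussed_nontrivial]
    unfolding focussed_scalars_def focussed_tensor_def focussed_arc_algebra_def .
  \<comment> \<open>A basis of explicit size settles finiteness and the value together; with
    \<open>n = d + 1\<close> the exponent \<open>n - 1\<close> of \<open>series\<close> is
    \<open>d\<close>.\<close>
  have dims: "ring.finite_dimension ?T ?k (?E j) \<and> of_nat (ring.dim ?T ?k (?E j)) = ?P $ j" for j
  proof -
    obtain h where h: "of_nat h = ?P $ j" "ring.dimension ?T h ?k (?E j)"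
      using focussed_dimension[of j] unfolding focussed_arc_algebra_def by auto
    then show ?thesis
      using ring.finite_dimensionI[OF ring h(2)] ring.dimI[OF ring sub h(2)] by (simp add: over_def)
  qed
  then show ?thesis
    unfolding focussed_HP_def by (auto simp: fps_eq_iff)
qed

end
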